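(* Assume the setting described in the context, with scaling exponent $\beta>0$. Then for any fixed $t>0$, $$\lim_{\varepsilon\to0}\frac{N^\varepsilon(t)}{m^\varepsilon(t)}=1\quad\text{in }\mathbb P\text{-probability},$$ i.e. for all $\delta>0$, $\lim_{\varepsilon\to0}\mathbb P\left(\left|\frac{N^\varepsilon(t)}{m^\varepsilon(t)}-1\right|\ge\delta\right)=0$. Furthermore, $$\lim_{\varepsilon\to0}\frac{\varepsilon^\beta N^\varepsilon(t)}{\bar m_0(t)}=1\quad\text{in }\mathbb P\text{-probability}.$$
   Context: Environment. $Z=\{Z_t;t\ge0\}$ is an $\mathbb R^d$-valued stochastic process with right-continuous paths with left limits on a probability space $(\Omega,\mathcal F,\mathbb P)$ (the annealed probability, with expectation $\mathbb E$); it has a unique invariant probability measure $\pi$. $\mathbb E_Z=\mathbb E(\cdot\mid Z)$ is the quenched expectation. The functions $\lambda:[0,\infty)\to\mathbb R_+$ and $\psi:\mathbb R^d\to\mathbb R_+$ are positive, bounded and Lipschitz (or $C^1$), and $\bar\psi=\int_{\mathbb R^d}\psi(z)\,\pi(dz)$. $L^1$-ergodicity is assumed: $\lim_{t\to\infty}\mathbb E\left|\frac1t\int_0^t\psi(Z_r)\,dr-\bar\psi\right|=0$. Service times. $\{\nu(s,dr);s\ge0\}$ is a family of probability laws on $[0,\infty)$ with densities, $\nu(s,dr)=\ell_s(r)\,dr$, and there are $\alpha>0$ and constants $c,C>0$ such that for all $r,s>0$: $c\,(r^{-1-\alpha}\wedge1)\le\ell_s(r)\le C\,(r^{-1-\alpha}\wedge1)$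 and $\frac{\partial\ell_s(r)}{\partial s}\le C\,(r^{-1-\alpha}\wedge1)$. Set $\bar F_s(r)=\int_r^\infty\ell_s(\tau)\,d\tau$. Queue. For $\varepsilon>0$, conditionally on $Z$ the arrival times $\{\Gamma^\varepsilon_k;k\ge1\}$ form a Poisson process on $[0,\infty)$ with intensity $\mu^\varepsilon(ds)=\varepsilon^{-\beta}\lambda(s)\psi(Z_{s/\varepsilon})\,ds$; conditionally on $Z$ and the arrival times, the service times $L^\varepsilon_k$ are independent with $L^\varepsilon_k\sim\nu(\Gamma^\varepsilon_k,\cdot)$. The number of active jobs is $N^\varepsilon(t)=\sum_{k\ge1}\mathbf 1_{\{\Gamma^\varepsilon_k<t<\Gamma^\varepsilon_k+L^\varepsilon_k\}}$. Its quenched mean is $m^\varepsilon(t)=\mathbb E_Z[N^\varepsilon(t)]=\varepsilon^{-\beta}\int_0^t\lambda(s)\bar F_s(t-s)\psi(Z_{s/\varepsilon})\,ds$, and $\bar m_0(t)=\bar\psi\int_0^t\lambda(s)\bar F_s(t-s)\,ds$. *)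

theory Defs
  imports "HOL-Probability.Probability"
begin

definition C1_on :: "'b::real_normed_vector set \<Rightarrow> ('b \<Rightarrow> real) \<Rightarrow> bool" where
  "C1_on S f \<longleftrightarrow>
     (\<exists>f' :: 'b \<Rightarrow> 'b \<Rightarrow>\<^sub>L real. continuous_on S f' \<and>
        (\<forall>x\<in>S. (f has_derivative blinfun_apply (f' x)) (at x within S)))"

definition rate_function :: "'b::real_normed_vector set \<Rightarrow> ('b \<Rightarrow> real) \<Rightarrow> bool" where
  "rate_function S f \<longleftrightarrow>
     (\<forall>x\<in>S. 0 < f x) \<and> bounded (f ` S) \<and> ((\<exists>A. A-lipschitz_on S f) \<or> C1_on S f)"

definition cadlag :: "(real \<Rightarrow> 'b::topological_space) \<Rightarrow> bool" where
  "cadlag z \<longleftrightarrow>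
     (\<forall>t\<ge>0. (z \<longlongrightarrow> z t) (at_right t)) \<and> (\<forall>t>0. \<exists>l. (z \<longlongrightarrow> l) (at_left t))"

text \<open>
  Conditional probability of an event given a sub-sigma-algebra, as a version of a conditional
  expectation; statements about it are meaningful only almost everywhere.
\<close>

definition cprob :: "'a measure \<Rightarrow> 'a measure \<Rightarrow> 'a set \<Rightarrow> 'a \<Rightarrow> real" where
  "cprob M F A = real_cond_exp M F (indicator A)"

definition sigma_Z :: "'a measure \<Rightarrow> (real \<Rightarrow> 'a \<Rightarrow> 'b::topological_space) \<Rightarrow> 'a measure" where
  "sigma_Z M Z = sigma (space M) {Z t -` A \<inter> space M | t A. 0 \<le> t \<and> A \<in> sets borel}"

definition sigma_Z_arrivals ::
    "'a measure \<Rightarrow> (real \<Rightarrow> 'a \<Rightarrow> 'b::topological_space) \<Rightarrow> (nat \<Rightarrow> 'a \<Rightarrow> ereal) \<Rightarrow> 'a measure" where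
  "sigma_Z_arrivals M Z \<Gamma> = sigma (space M)
     ({Z t -` A \<inter> space M | t A. 0 \<le> t \<and> A \<in> sets borel} \<union>
      {\<Gamma> k -` A \<inter> space M | k A. 1 \<le> k \<and> A \<in> sets borel})"

text \<open>
  An invariant measure of a process refers to its (time-homogeneous) transition probabilities:
  \<open>K t z\<close> is the law of the process at time \<open>s + t\<close> given that it is at \<open>z\<close> at time \<open>s\<close>.
  The Markov property is not required.
\<close>

definition transition_probabilities ::
    "'a measure \<Rightarrow> (real \<Rightarrow> 'a \<Rightarrow> 'b::topological_space) \<Rightarrow> (real \<Rightarrow> 'b \<Rightarrow> 'b measure) \<Rightarrow> bool" where
  "transition_probabilities M Z K \<longleftrightarrow>
     (\<forall>t\<ge>0. K t \<in> borel \<rightarrow>\<^sub>M prob_algebra borel) \<and>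
     (\<forall>s\<ge>0. \<forall>t\<ge>0. \<forall>A\<in>sets borel. AE \<omega> in M.
        cprob M (vimage_algebra (space M) (Z s) borel) (Z (s + t) -` A \<inter> space M) \<omega>
          = measure (K t (Z s \<omega>)) A)"

definition invariant_prob ::
    "(real \<Rightarrow> 'b \<Rightarrow> 'b::topological_space measure) \<Rightarrow> 'b measure \<Rightarrow> bool" where
  "invariant_prob K \<pi> \<longleftrightarrow> \<pi> \<in> space (prob_algebra borel) \<and> (\<forall>t\<ge>0. \<pi> \<bind> K t = \<pi>)"

definition service_law :: "(real \<Rightarrow> real \<Rightarrow> real) \<Rightarrow> real \<Rightarrow> real measure" where
  "service_law l s = density lborel (\<lambda>r. ennreal (indicator {0..} r * l s r))"

definition service_tail :: "(real \<Rightarrow> real \<Rightarrow> real) \<Rightarrow> real \<Rightarrow> real \<Rightarrow> real" where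
  "service_tail l s r = (LINT \<tau>:{r..}|lborel. l s \<tau>)"

definition arrival_intensity ::
    "real \<Rightarrow> (real \<Rightarrow> real) \<Rightarrow> ('b \<Rightarrow> real) \<Rightarrow> (real \<Rightarrow> 'b) \<Rightarrow> real \<Rightarrow> real measure" where
  "arrival_intensity \<beta> lam \<psi> z \<epsilon> =
     density lborel
       (\<lambda>s. ennreal (indicator {0..} s * (\<epsilon> powr (- \<beta>) * lam s * \<psi> (z (s / \<epsilon>)))))"

text \<open>
  Arrival times are indexed by \<open>k \<ge> 1\<close>. The total intensity may be finite, in which case there
  are only finitely many arrivals; \<open>\<Gamma> k \<omega> = \<infinity>\<close> means that no arrival carries the index \<open>k\<close>.
  Poisson processes are characterised by their counts on disjoint bounded Borel sets,
  here conditionally on a sub-sigma-algebra \<open>F\<close> with respect to which the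
  intensity \<open>\<mu>\<close> is random. The order in which the points are enumerated plays no role.
\<close>

definition arrivals_in :: "(nat \<Rightarrow> 'a \<Rightarrow> ereal) \<Rightarrow> 'a \<Rightarrow> real set \<Rightarrow> nat set" where
  "arrivals_in \<Gamma> \<omega> B = {k. 1 \<le> k \<and> \<Gamma> k \<omega> \<in> ereal ` B}"

definition cond_poisson_process ::
    "'a measure \<Rightarrow> 'a measure \<Rightarrow> (nat \<Rightarrow> 'a \<Rightarrow> ereal) \<Rightarrow> ('a \<Rightarrow> real measure) \<Rightarrow> bool" where
  "cond_poisson_process M F \<Gamma> \<mu> \<longleftrightarrow>
     (\<forall>k\<ge>1. \<Gamma> k \<in> borel_measurable M \<and> (\<forall>\<omega>\<in>space M. 0 \<le> \<Gamma> k \<omega>)) \<and>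
     (\<forall>n (B :: nat \<Rightarrow> real set) (j :: nat \<Rightarrow> nat).
        (\<forall>i<n. B i \<in> sets borel \<and> bounded (B i) \<and> B i \<subseteq> {0..}) \<and> disjoint_family_on B {..<n} \<longrightarrow>
        (AE \<omega> in M.
           cprob M F {\<omega>'\<in>space M. \<forall>i<n. finite (arrivals_in \<Gamma> \<omega>' (B i)) \<and>
                                           card (arrivals_in \<Gamma> \<omega>' (B i)) = j i} \<omega>
             = (\<Prod>i<n. exp (- measure (\<mu> \<omega>) (B i)) * measure (\<mu> \<omega>) (B i) ^ j i / fact (j i))))"

text \<open>
  Conditionally on \<open>F\<close>, the service times are independent, the \<open>k\<close>-th one with law
  \<open>\<nu> (\<Gamma> k)\<close>; this concerns only the indices \<open>k\<close> of actual arrivals.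
\<close>

definition cond_service_times ::
    "'a measure \<Rightarrow> 'a measure \<Rightarrow> (nat \<Rightarrow> 'a \<Rightarrow> ereal) \<Rightarrow> (real \<Rightarrow> real measure) \<Rightarrow>
     (nat \<Rightarrow> 'a \<Rightarrow> real) \<Rightarrow> bool" where
  "cond_service_times M F \<Gamma> \<nu> L \<longleftrightarrow>
     (\<forall>k\<ge>1. L k \<in> borel_measurable M) \<and>
     (\<forall>I (A :: nat \<Rightarrow> real set). finite I \<and> I \<subseteq> {1..} \<and> (\<forall>k\<in>I. A k \<in> sets borel) \<longrightarrow>
        (AE \<omega> in M. (\<forall>k\<in>I. \<Gamma> k \<omega> < \<infinity>) \<longrightarrow>
           cprob M F {\<omega>'\<in>space M. \<forall>k\<in>I. L k \<omega>' \<in> A k} \<omega>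
             = (\<Prod>k\<in>I. measure (\<nu> (real_of_ereal (\<Gamma> k \<omega>))) (A k))))"

definition active_jobs ::
    "(nat \<Rightarrow> 'a \<Rightarrow> ereal) \<Rightarrow> (nat \<Rightarrow> 'a \<Rightarrow> real) \<Rightarrow> real \<Rightarrow> 'a \<Rightarrow> real" where
  "active_jobs \<Gamma> L t \<omega> =
     (\<Sum>\<^sub>\<infinity>k\<in>{1..}. of_bool (\<Gamma> k \<omega> < ereal t \<and> ereal t < \<Gamma> k \<omega> + ereal (L k \<omega>)))"

definition quenched_mean ::
    "'a measure \<Rightarrow> (real \<Rightarrow> 'a \<Rightarrow> 'b::topological_space) \<Rightarrow> ('a \<Rightarrow> real) \<Rightarrow> 'a \<Rightarrow> real" where
  "quenched_mean M Z X = real_cond_exp M (sigma_Z M Z) X"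

definition averaged_mean ::
    "(real \<Rightarrow> real) \<Rightarrow> (real \<Rightarrow> real \<Rightarrow> real) \<Rightarrow> real \<Rightarrow> real \<Rightarrow> real" where
  "averaged_mean lam l \<psi>bar t =
     \<psi>bar * (LINT s:{0..t}|lborel. lam s * service_tail l s (t - s))"

definition tendsto_in_prob ::
    "'a measure \<Rightarrow> ('i \<Rightarrow> 'a \<Rightarrow> real) \<Rightarrow> real \<Rightarrow> 'i filter \<Rightarrow> bool" where
  "tendsto_in_prob M X x G \<longleftrightarrow>
     (\<forall>\<delta>>0. ((\<lambda>i. measure M {\<omega>\<in>space M. \<delta> \<le> \<bar>X i \<omega> - x\<bar>}) \<longlongrightarrow> 0) G)"

end

(* For each eps, the number N of active jobs is compared with its quenched mean m in two
   steps.  Given Z and the arrivals, the jobs are active independently of each other, so replacing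
   each indicator "job k is active" by its conditional probability h(Gamma_k) costs at most the
   square root of the expected number of arrivals, which is of order eps^(-beta).  The sum of the
   h(Gamma_k) is then compared with its Poisson mean m; writing h as an average of indicators of its
   superlevel sets reduces this to the variance of Poisson counts of single sets, and the error has
   the same order.  Hence eps^beta (N - m) tends to 0 in L1.  L1-ergodicity on intervals extends,
   by linearity and density, to weights in L1, so eps^beta m tends to the averaged mean
   in L1.  No formula for E(N | Z) is needed for the first limit: conditional expectation contracts
   L1, so eps^beta E(N | Z) has the same limit as eps^beta N. *)

theory Submission
  imports Defs
begin

text \<open>The hypotheses on the queue speak of fixed data: counts of fixed Borel sets and service
  times in fixed sets, each identity holding off a null set that depends on the sets. The number of
  active jobs, however, is a sum over random points with the random thresholds
  \<open>t - \<Gamma> k\<close>. Both comparisons therefore have to be discretised, and their bounds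
  must survive refinement of the grid. In the Poisson step they do because an average of n
  deviations, each of L1 norm at most sqrt R, again has L1 norm at most sqrt R, whatever n is; the
  square root reflects that a Poisson variance equals its mean. In the service step, rounding the
  thresholds leaves the centred indicators orthogonal, so that their second moments add up to no
  more than the expected number of arrivals. Here R bounds the intensity of \<open>{0..<t}\<close>,
  and the normalised error is a constant times \<epsilon>^(\<beta>/2). Passing to ratios is possible
  because the averaged mean is strictly positive: the rates are positive and the densities are
  bounded below.\<close>

section \<open>Poisson counts given a sub-sigma-algebra\<close>

text \<open>The sum counts the positive integers up to \<open>real n * x\<close>, so it is a floor,
  and division by \<open>n\<close> leaves an error of at most \<open>1 / real n\<close>. The
  assumption \<open>x \<le> 1\<close> keeps the floor inside \<open>{1..n}\<close>. The levels start
  at \<open>1\<close>, since level \<open>0\<close> would be reached by every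
  \<open>x\<close>.\<close>

lemma layer_approx:
  fixes x :: real
  assumes "0 \<le> x" "x \<le> 1" "0 < n"
  shows "\<bar>(\<Sum>i\<in>{1..n}. of_bool (real i / real n \<le> x)) / real n - x\<bar> \<le> 1 / real n"
proof -
  have "(\<Sum>i\<in>{1..n}. of_bool (real i / real n \<le> x)) = real (card {i\<in>{1..n}. real i / real n \<le> x})"
    by (simp add: sum.If_cases of_bool_def Int_def)
  also have "{i\<in>{1..n}. real i / real n \<le> x} = {1..nat \<lfloor>real n * x\<rfloor>}"
  proof -
    have le: "real n * x \<le> real n"
      using assms by (simp add: mult_left_le)
    have "\<lfloor>real n * x\<rfloor> \<le> \<lfloor>real n\<rfloor>"
      using le by (rule floor_mono)
    then have "nat \<lfloor>real n * x\<rfloor> \<le> n"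
      by (simp add: nat_le_iff)
    moreover have "real i / real n \<le> x \<longleftrightarrow> i \<le> nat \<lfloor>real n * x\<rfloor>" for i
    proof -
      have "real i / real n \<le> x \<longleftrightarrow> real i \<le> real n * x"
        using assms(3) by (simp add: pos_divide_le_eq mult.commute)
      also have "\<dots> \<longleftrightarrow> int i \<le> \<lfloor>real n * x\<rfloor>"
        by (simp add: le_floor_iff)
      also have "\<dots> \<longleftrightarrow> i \<le> nat \<lfloor>real n * x\<rfloor>"
        using assms by (simp add: le_nat_iff)
      finally show ?thesis .
    qed
    ultimately show ?thesis
      by (intro set_eqI) (simp only: mem_Collect_eq atLeastAtMost_iff, linarith)
  qed
  finally have "(\<Sum>i\<in>{1..n}. of_bool (real i / real n \<le> x)) = real (nat \<lfloor>real n * x\<rfloor>)"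
    by simp
  moreover have "\<bar>real (nat \<lfloor>real n * x\<rfloor>) - real n * x\<bar> \<le> 1"
    using assms by (simp add: of_nat_nat) linarith
  ultimately show ?thesis
    using assms(3) by (simp add: field_simps abs_le_iff)
qed

text \<open>Total mass, mean and variance of the Poisson weights. The index shift
  \<open>real (Suc j) * p (Suc j) = a * p j\<close> reduces each moment to those of lower
  order.\<close>

lemma poisson_sums:
  fixes a :: real
  shows "(\<lambda>j. exp (- a) * a ^ j / fact j) sums 1"
    and "(\<lambda>j. real j * (exp (- a) * a ^ j / fact j)) sums a"
    and "(\<lambda>j. (real j - a)\<^sup>2 * (exp (- a) * a ^ j / fact j)) sums a"
proof -
  define p where "p j = exp (- a) * a ^ j / fact j" for j
  have 1: "p sums 1"
  proof -
    have "(\<lambda>j. exp (- a) * (a ^ j /\<^sub>R fact j)) sums (exp (- a) * exp a)"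
      by (intro sums_mult exp_converges)
    then show ?thesis by (simp add: p_def [abs_def] exp_minus field_simps)
  qed
  have p_Suc: "real (Suc j) * p (Suc j) = a * p j" for j
    unfolding p_def by (simp add: field_simps del: of_nat_Suc)
  have 2: "(\<lambda>j. real j * p j) sums a"
  proof -
    have "(\<lambda>j. real (Suc j) * p (Suc j)) sums a"
      unfolding p_Suc using sums_mult[OF 1, of a] by simp
    then show ?thesis by (subst (asm) sums_Suc_iff) simp
  qed
  have 3: "(\<lambda>j. (real j)\<^sup>2 * p j) sums (a\<^sup>2 + a)"
  proof -
    have "(real (Suc j))\<^sup>2 * p (Suc j) = a * (real j * p j) + a * p j" for j
    proof -
      have "(real (Suc j))\<^sup>2 * p (Suc j) = real (Suc j) * (a * p j)"
        unfolding power2_eq_square mult.assoc p_Suc ..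
      then show ?thesis by (simp add: algebra_simps)
    qed
    then have "(\<lambda>j. (real (Suc j))\<^sup>2 * p (Suc j)) sums (a * a + a * 1)"
      using sums_add[OF sums_mult[OF 2, of a] sums_mult[OF 1, of a]] by simp
    then show ?thesis
      by (subst (asm) sums_Suc_iff) (simp add: power2_eq_square)
  qed
  have "(\<lambda>j. (real j)\<^sup>2 * p j - 2 * a * (real j * p j) + a\<^sup>2 * p j) sums (a\<^sup>2 + a - 2 * a * a + a\<^sup>2 * 1)"
    by (intro sums_add sums_diff sums_mult 1 2 3)
  then have 4: "(\<lambda>j. (real j - a)\<^sup>2 * p j) sums a"
    by (simp add: power2_eq_square algebra_simps)
  show "(\<lambda>j. exp (- a) * a ^ j / fact j) sums 1"
    "(\<lambda>j. real j * (exp (- a) * a ^ j / fact j)) sums a"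
    "(\<lambda>j. (real j - a)\<^sup>2 * (exp (- a) * a ^ j / fact j)) sums a"
    using 1 2 4 by (simp_all add: p_def [abs_def])
qed

text \<open>The variance of the absolute value is nonnegative. Through this inequality the second
  moments of the Poisson counts and of the service indicators become L1 bounds.\<close>

lemma (in prob_space) expectation_abs_le_sqrt:
  assumes [measurable]: "X \<in> borel_measurable M" and sq: "integrable M (\<lambda>\<omega>. (X \<omega>)\<^sup>2)"
    and le: "expectation (\<lambda>\<omega>. (X \<omega>)\<^sup>2) \<le> R"
  shows "expectation (\<lambda>\<omega>. \<bar>X \<omega>\<bar>) \<le> sqrt R"
proof -
  have "integrable M X"
    using square_integrable_imp_integrable[OF _ sq] by simp
  then have "variance (\<lambda>\<omega>. \<bar>X \<omega>\<bar>) = expectation (\<lambda>\<omega>. (X \<omega>)\<^sup>2) - (expectation (\<lambda>\<omega>. \<bar>X \<omega>\<bar>))\<^sup>2"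
    using sq by (subst variance_eq) auto
  then have "(expectation (\<lambda>\<omega>. \<bar>X \<omega>\<bar>))\<^sup>2 \<le> R"
    using variance_positive[of "\<lambda>\<omega>. \<bar>X \<omega>\<bar>"] le by simp
  then show ?thesis by (rule real_le_rsqrt)
qed

lemma (in prob_space) finite_measure_subalgebraI:
  "subalgebra M F \<Longrightarrow> finite_measure_subalgebra M F"
  by unfold_locales

text \<open>This is the defining property of conditional expectation, tested against a bounded
  \<open>F\<close>-measurable \<open>Y\<close>. The formula for \<open>cprob\<close> is required
  only where \<open>Y\<close> is nonzero, because the law of a service time is prescribed only where
  the corresponding arrival exists.\<close>

lemma (in prob_space) integral_mult_indicator_eq_cprob:
  assumes sub: "subalgebra M F" and [measurable]: "A \<in> sets M" "p \<in> borel_measurable M"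
    and Y: "Y \<in> borel_measurable F" and bdd: "\<And>\<omega>. \<bar>Y \<omega>\<bar> \<le> B"
    and cp: "AE \<omega> in M. Y \<omega> \<noteq> 0 \<longrightarrow> cprob M F A \<omega> = p \<omega>"
  shows "expectation (\<lambda>\<omega>. Y \<omega> * indicator A \<omega>) = expectation (\<lambda>\<omega>. Y \<omega> * p \<omega>)"
proof -
  interpret finite_measure_subalgebra M F
    using sub by (rule finite_measure_subalgebraI)
  have [measurable]: "Y \<in> borel_measurable M"
    using measurable_from_subalg[OF sub Y] .
  have "integrable M (\<lambda>\<omega>. Y \<omega> * indicator A \<omega>)"
    using bdd order_trans[OF abs_ge_zero bdd]
    by (intro integrable_const_bound[where B = B]) (auto simp: abs_mult indicator_def)
  then have "expectation (\<lambda>\<omega>. Y \<omega> * indicator A \<omega>) = expectation (\<lambda>\<omega>. Y \<omega> * cprob M F A \<omega>)"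
    unfolding cprob_def using Y by (intro real_cond_exp_intg(2)[symmetric]) auto
  also have "\<dots> = expectation (\<lambda>\<omega>. Y \<omega> * p \<omega>)"
    using cp by (intro integral_cong_AE) (auto simp: cprob_def)
  finally show ?thesis .
qed

text \<open>Conditionally on \<open>F\<close> the count \<open>U\<close> is Poisson with the random
  parameter \<open>a\<close>, so integrating mass, mean and variance over \<open>a\<close> gives
  everything. The predicate \<open>fin\<close> stands for finiteness of the counted set:
  \<open>card\<close> is \<open>0\<close> on infinite sets, so the value of \<open>U\<close> alone
  cannot detect it.\<close>

lemma (in prob_space) cond_poisson_count:
  fixes U :: "'a \<Rightarrow> nat"
  assumes sub: "subalgebra M F" and [measurable]: "Measurable.pred M fin" "U \<in> M \<rightarrow>\<^sub>M count_space UNIV"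
    and a[measurable]: "a \<in> borel_measurable F" and a_bd: "\<And>\<omega>. 0 \<le> a \<omega> \<and> a \<omega> \<le> R"
    and cp: "\<And>j. AE \<omega> in M. cprob M F {\<omega>\<in>space M. fin \<omega> \<and> U \<omega> = j} \<omega> = exp (- a \<omega>) * a \<omega> ^ j / fact j"
  shows "AE \<omega> in M. fin \<omega>" and "integrable M (\<lambda>\<omega>. real (U \<omega>))"
    and "expectation (\<lambda>\<omega>. real (U \<omega>)) \<le> R"
    and "expectation (\<lambda>\<omega>. \<bar>real (U \<omega>) - a \<omega>\<bar>) \<le> sqrt R"
proof -
  have aM[measurable]: "a \<in> borel_measurable M"
    using measurable_from_subalg[OF sub a] .
  define E where "E j = {\<omega>\<in>space M. fin \<omega> \<and> U \<omega> = j}" for j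
  have E[measurable]: "E j \<in> sets M" for j unfolding E_def by measurable
  define p where "p j x = exp (- x) * x ^ j / fact j" for j and x :: real
  have p[measurable]: "p j \<in> borel_measurable borel" for j unfolding p_def by measurable
  have p_nn: "0 \<le> p j (a \<omega>)" for j \<omega> unfolding p_def using a_bd by simp
  \<comment> \<open>One identity for all moments: the event \<open>E j\<close> is replaced by its
    conditional probability \<open>p j (a \<omega>)\<close>, and the terms are summed over
    \<open>j\<close>. The bounds \<open>B j\<close> are needed term by term only, so weights
    unbounded in \<open>j\<close> are allowed; working with nonnegative integrals makes the exchange
    of sum and integral free.\<close>
  have key: "(\<integral>\<^sup>+\<omega>. ennreal (of_bool (fin \<omega>) * w (U \<omega>) (a \<omega>)) \<partial>M) = (\<integral>\<^sup>+\<omega>. ennreal (s (a \<omega>)) \<partial>M)"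
    if w[measurable]: "\<And>j. w j \<in> borel_measurable borel" and w_bd: "\<And>j x. 0 \<le> x \<Longrightarrow> x \<le> R \<Longrightarrow> 0 \<le> w j x \<and> w j x \<le> B j"
      and sums: "\<And>x. 0 \<le> x \<Longrightarrow> (\<lambda>j. w j x * p j x) sums s x" for w s B
  proof -
    have step: "(\<integral>\<^sup>+\<omega>. ennreal (indicator (E j) \<omega> * w j (a \<omega>)) \<partial>M) = (\<integral>\<^sup>+\<omega>. ennreal (w j (a \<omega>) * p j (a \<omega>)) \<partial>M)" for j
    proof -
      have bd: "\<bar>w j (a \<omega>)\<bar> \<le> B j" for \<omega> using w_bd[of "a \<omega>" j] a_bd[of \<omega>] by auto
      have eq: "expectation (\<lambda>\<omega>. w j (a \<omega>) * indicator (E j) \<omega>) = expectation (\<lambda>\<omega>. w j (a \<omega>) * p j (a \<omega>))"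
        using cp[of j] bd by (intro integral_mult_indicator_eq_cprob[OF sub]) (auto simp: E_def p_def)
      have i1: "integrable M (\<lambda>\<omega>. w j (a \<omega>) * indicator (E j) \<omega>)"
        using bd order_trans[OF abs_ge_zero bd]
        by (intro integrable_const_bound[where B = "B j"]) (auto simp: abs_mult indicator_def)
      have "p j (a \<omega>) \<le> R ^ j" for \<omega>
      proof -
        have "exp (- a \<omega>) * a \<omega> ^ j / fact j \<le> 1 * R ^ j / 1"
          using a_bd[of \<omega>] order_trans[of 0 "a \<omega>" R]
          by (intro frac_le mult_mono power_mono) (auto simp: fact_ge_1)
        then show ?thesis by (simp add: p_def)
      qed
      then have i2: "integrable M (\<lambda>\<omega>. w j (a \<omega>) * p j (a \<omega>))"
        using bd p_nn order_trans[OF abs_ge_zero bd]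
        by (intro integrable_const_bound[where B = "B j * R ^ j"]) (auto simp: abs_mult intro!: mult_mono)
      show ?thesis
        using i1 i2 eq w_bd a_bd p_nn
        by (simp add: nn_integral_eq_integral mult.commute)
    qed
    \<comment> \<open>At most one term of the series is nonzero, the one with
      \<open>j = U \<omega>\<close>, and none is where \<open>fin\<close> fails.\<close>
    have "ennreal (of_bool (fin \<omega>) * w (U \<omega>) (a \<omega>)) = (\<Sum>j. ennreal (indicator (E j) \<omega> * w j (a \<omega>)))"
      if "\<omega> \<in> space M" for \<omega>
    proof -
      have "(\<lambda>j. ennreal (indicator (E j) \<omega> * w j (a \<omega>))) sums (\<Sum>j\<in>{U \<omega>}. ennreal (indicator (E j) \<omega> * w j (a \<omega>)))"
        using that by (intro sums_finite) (auto simp: E_def indicator_def)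
      then show ?thesis using that by (auto simp: sums_iff E_def indicator_def)
    qed
    then have "(\<integral>\<^sup>+\<omega>. ennreal (of_bool (fin \<omega>) * w (U \<omega>) (a \<omega>)) \<partial>M)
        = (\<integral>\<^sup>+\<omega>. (\<Sum>j. ennreal (indicator (E j) \<omega> * w j (a \<omega>))) \<partial>M)"
      by (intro nn_integral_cong)
    also have "\<dots> = (\<Sum>j. \<integral>\<^sup>+\<omega>. ennreal (indicator (E j) \<omega> * w j (a \<omega>)) \<partial>M)"
      by (intro nn_integral_suminf) measurable
    also have "\<dots> = (\<Sum>j. \<integral>\<^sup>+\<omega>. ennreal (w j (a \<omega>) * p j (a \<omega>)) \<partial>M)"
      by (simp add: step)
    also have "\<dots> = (\<integral>\<^sup>+\<omega>. (\<Sum>j. ennreal (w j (a \<omega>) * p j (a \<omega>))) \<partial>M)"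
      by (intro nn_integral_suminf[symmetric]) measurable
    also have "\<dots> = (\<integral>\<^sup>+\<omega>. ennreal (s (a \<omega>)) \<partial>M)"
      using w_bd a_bd p_nn sums by (intro nn_integral_cong suminf_ennreal_eq) auto
    finally show ?thesis .
  qed
  have nnR: "0 \<le> R" using a_bd order_trans by blast
  have Ea: "(\<integral>\<^sup>+\<omega>. ennreal (a \<omega>) \<partial>M) \<le> ennreal R"
  proof -
    have "(\<integral>\<^sup>+\<omega>. ennreal (a \<omega>) \<partial>M) \<le> (\<integral>\<^sup>+\<omega>. ennreal R \<partial>M)"
      using a_bd by (intro nn_integral_mono) (auto intro: ennreal_leI)
    then show ?thesis by (simp add: emeasure_space_1)
  qed
  \<comment> \<open>Weight \<open>1\<close>: the conditional probabilities sum to \<open>1\<close>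
    over all finite counts, which leaves no mass for an infinite one.\<close>
  have "(\<integral>\<^sup>+\<omega>. ennreal (of_bool (fin \<omega>) * 1) \<partial>M) = (\<integral>\<^sup>+\<omega>. ennreal 1 \<partial>M)"
    using poisson_sums(1) by (intro key[of "\<lambda>_ _. 1" "\<lambda>_. 1" "\<lambda>_. 1"]) (auto simp: p_def)
  moreover have "(\<integral>\<^sup>+\<omega>. ennreal (of_bool (fin \<omega>) * 1) \<partial>M) = (\<integral>\<^sup>+\<omega>. indicator {\<omega>\<in>space M. fin \<omega>} \<omega> \<partial>M)"
    by (intro nn_integral_cong) (auto simp: indicator_def)
  ultimately have "emeasure M {\<omega>\<in>space M. fin \<omega>} = 1"
    by (simp add: emeasure_space_1)
  then have "prob {\<omega>\<in>space M. fin \<omega>} = 1" by (simp add: measure_def)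
  then show fin: "AE \<omega> in M. fin \<omega>" by (simp add: prob_Collect_eq_1)
  have drop: "(\<integral>\<^sup>+\<omega>. ennreal (of_bool (fin \<omega>) * w \<omega>) \<partial>M) = (\<integral>\<^sup>+\<omega>. ennreal (w \<omega>) \<partial>M)" for w :: "'a \<Rightarrow> real"
    using fin by (intro nn_integral_cong_AE) auto
  have "(\<integral>\<^sup>+\<omega>. ennreal (of_bool (fin \<omega>) * real (U \<omega>)) \<partial>M) = (\<integral>\<^sup>+\<omega>. ennreal (a \<omega>) \<partial>M)"
    using poisson_sums(2) by (intro key[of "\<lambda>j _. real j" "\<lambda>j. real j" "\<lambda>x. x"]) (auto simp: p_def)
  then have EU: "(\<integral>\<^sup>+\<omega>. ennreal (real (U \<omega>)) \<partial>M) \<le> ennreal R"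
    using Ea by (simp add: drop)
  show "integrable M (\<lambda>\<omega>. real (U \<omega>))"
    using EU by (intro integrableI_nonneg) (auto simp: le_less_trans)
  then show "expectation (\<lambda>\<omega>. real (U \<omega>)) \<le> R"
    using EU nnR by (simp add: nn_integral_eq_integral)
  \<comment> \<open>For the weight \<open>(real j - x)\<^sup>2\<close> the series is the Poisson
    variance, which is the parameter \<open>x\<close> again. So the second moment of the centred
    count is the mean of \<open>a\<close>, at most \<open>R\<close>.\<close>
  have "(\<integral>\<^sup>+\<omega>. ennreal (of_bool (fin \<omega>) * (real (U \<omega>) - a \<omega>)\<^sup>2) \<partial>M) = (\<integral>\<^sup>+\<omega>. ennreal (a \<omega>) \<partial>M)"
  proof (intro key[of "\<lambda>j x. (real j - x)\<^sup>2" "\<lambda>j. (real j + R)\<^sup>2" "\<lambda>x. x"])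
    show "0 \<le> (real j - x)\<^sup>2 \<and> (real j - x)\<^sup>2 \<le> (real j + R)\<^sup>2" if "0 \<le> x" "x \<le> R" for j x
      using that by (auto intro!: abs_le_square_iff[THEN iffD1])
  qed (use poisson_sums(3) in \<open>auto simp: p_def\<close>)
  then have EV: "(\<integral>\<^sup>+\<omega>. ennreal ((real (U \<omega>) - a \<omega>)\<^sup>2) \<partial>M) \<le> ennreal R"
    using Ea by (simp add: drop)
  have "integrable M (\<lambda>\<omega>. (real (U \<omega>) - a \<omega>)\<^sup>2)"
    using EV by (intro integrableI_nonneg) (auto simp: le_less_trans)
  then show "expectation (\<lambda>\<omega>. \<bar>real (U \<omega>) - a \<omega>\<bar>) \<le> sqrt R"
    using EV nnR by (intro expectation_abs_le_sqrt) (auto simp: nn_integral_eq_integral)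
qed

lemma measurable_arrivals_in:
  assumes "\<And>k. 1 \<le> k \<Longrightarrow> \<Gamma> k \<in> borel_measurable M" and "B \<in> sets borel"
  shows "Measurable.pred M (\<lambda>\<omega>. k \<in> arrivals_in \<Gamma> \<omega> B)"
proof (cases "1 \<le> k")
  case True
  have [measurable]: "\<Gamma> k \<in> borel_measurable M" "B \<in> sets borel" using True assms by auto
  have "k \<in> arrivals_in \<Gamma> \<omega> B \<longleftrightarrow> \<Gamma> k \<omega> \<noteq> \<infinity> \<and> \<Gamma> k \<omega> \<noteq> - \<infinity> \<and> real_of_ereal (\<Gamma> k \<omega>) \<in> B" for \<omega>
    using True by (cases "\<Gamma> k \<omega>") (auto simp: arrivals_in_def)
  then show ?thesis by simp
qed (simp add: arrivals_in_def)

text \<open>The random index set is moved into the summand, which leaves a series over all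
  \<open>k\<close>. Where \<open>A \<omega>\<close> is infinite, \<open>sum\<close> has the default
  value \<open>0\<close>, hence the case distinction.\<close>

lemma borel_measurable_sum_random_set:
  fixes A :: "'a \<Rightarrow> nat set" and f :: "nat \<Rightarrow> 'a \<Rightarrow> real"
  assumes [measurable]: "\<And>k. Measurable.pred M (\<lambda>\<omega>. k \<in> A \<omega>)"
    and f: "\<And>k. (\<lambda>\<omega>. of_bool (k \<in> A \<omega>) * f k \<omega>) \<in> borel_measurable M"
  shows "(\<lambda>\<omega>. \<Sum>k\<in>A \<omega>. f k \<omega>) \<in> borel_measurable M"
proof -
  have "(\<Sum>k\<in>A \<omega>. f k \<omega>) = (if finite (A \<omega>) then \<Sum>k. of_bool (k \<in> A \<omega>) * f k \<omega> else 0)" for \<omega>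
    by (auto simp: suminf_finite[where N = "A \<omega>"])
  moreover have "(\<lambda>\<omega>. \<Sum>k. of_bool (k \<in> A \<omega>) * f k \<omega>) \<in> borel_measurable M"
    using f by (rule borel_measurable_suminf)
  ultimately show ?thesis by simp
qed

lemma (in prob_space) cond_poisson_process_count:
  assumes sub: "subalgebra M F" and pois: "cond_poisson_process M F \<Gamma> \<mu>"
    and B: "B \<in> sets borel" "bounded B" "B \<subseteq> {0..}"
    and meas: "(\<lambda>\<omega>. measure (\<mu> \<omega>) B) \<in> borel_measurable F"
    and bd: "\<forall>\<omega>\<in>space M. measure (\<mu> \<omega>) B \<le> R"
  shows "AE \<omega> in M. finite (arrivals_in \<Gamma> \<omega> B)"
    and "integrable M (\<lambda>\<omega>. real (card (arrivals_in \<Gamma> \<omega> B)))"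
    and "expectation (\<lambda>\<omega>. real (card (arrivals_in \<Gamma> \<omega> B))) \<le> R"
    and "expectation (\<lambda>\<omega>. \<bar>real (card (arrivals_in \<Gamma> \<omega> B)) - measure (\<mu> \<omega>) B\<bar>) \<le> sqrt R"
proof -
  have [measurable]: "Measurable.pred M (\<lambda>\<omega>. k \<in> arrivals_in \<Gamma> \<omega> B)" for k
    using pois B(1) by (intro measurable_arrivals_in) (auto simp: cond_poisson_process_def)
  obtain \<omega>0 where \<omega>0: "\<omega>0 \<in> space M" using not_empty by blast
  then have R: "0 \<le> R" using bspec[OF bd \<omega>0] measure_nonneg[of "\<mu> \<omega>0" B] by linarith
  \<comment> \<open>The bound by \<open>R\<close> is known on \<open>space M\<close> only.
    Truncation makes it hold everywhere, preserves measurability with respect to \<open>F\<close>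
    and changes nothing on \<open>space M\<close>.\<close>
  define a where "a \<omega> = max 0 (min R (measure (\<mu> \<omega>) B))" for \<omega>
  have a_eq: "a \<omega> = measure (\<mu> \<omega>) B" if "\<omega> \<in> space M" for \<omega>
    using bd that by (simp add: a_def)
  have a_meas: "a \<in> borel_measurable F"
    unfolding a_def using meas by (intro borel_measurable_max borel_measurable_min) auto
  have cp: "AE \<omega> in M. cprob M F {\<omega>\<in>space M. finite (arrivals_in \<Gamma> \<omega> B) \<and> card (arrivals_in \<Gamma> \<omega> B) = j} \<omega>
      = exp (- a \<omega>) * a \<omega> ^ j / fact j" for j
  proof -
    have "AE \<omega> in M.
           cprob M F {\<omega>'\<in>space M. \<forall>i<1::nat. finite (arrivals_in \<Gamma> \<omega>' B) \<and> card (arrivals_in \<Gamma> \<omega>' B) = j} \<omega>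
             = (\<Prod>i<1::nat. exp (- measure (\<mu> \<omega>) B) * measure (\<mu> \<omega>) B ^ j / fact j)"
      using pois[unfolded cond_poisson_process_def, THEN conjunct2, rule_format,
          of 1 "\<lambda>_. B" "\<lambda>_. j"] B by (simp add: disjoint_family_on_def)
    then show ?thesis
      by (rule AE_mp, intro AE_I2) (simp add: a_eq)
  qed
  note count = cond_poisson_count[OF sub _ _ a_meas _ cp, of R]
  show "AE \<omega> in M. finite (arrivals_in \<Gamma> \<omega> B)"
    "integrable M (\<lambda>\<omega>. real (card (arrivals_in \<Gamma> \<omega> B)))"
    "expectation (\<lambda>\<omega>. real (card (arrivals_in \<Gamma> \<omega> B))) \<le> R"
    using R by (intro count; force simp: a_def)+
  have "expectation (\<lambda>\<omega>. \<bar>real (card (arrivals_in \<Gamma> \<omega> B)) - a \<omega>\<bar>) \<le> sqrt R"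
    using R by (intro count; force simp: a_def)
  then show "expectation (\<lambda>\<omega>. \<bar>real (card (arrivals_in \<Gamma> \<omega> B)) - measure (\<mu> \<omega>) B\<bar>) \<le> sqrt R"
    by (simp add: a_eq cong: Bochner_Integration.integral_cong)
qed

text \<open>
  Since \<open>h\<close> is within \<open>1 / n\<close> of the average of the indicators of \<open>{h \<ge> i / n}\<close>, \<open>i = 1, \<dots>, n\<close>,
  the bound follows from the one for the counts of these sets; no independence between the counts
  of different sets is used.
\<close>

lemma (in prob_space) cond_poisson_process_sum:
  assumes sub: "subalgebra M F" and pois: "cond_poisson_process M F \<Gamma> \<mu>"
    and D: "D \<in> sets borel" "bounded D" "D \<subseteq> {0..}"
    and sets: "\<And>\<omega>. sets (\<mu> \<omega>) = sets borel"
    and meas: "\<And>B. B \<in> sets borel \<Longrightarrow> B \<subseteq> D \<Longrightarrow> (\<lambda>\<omega>. measure (\<mu> \<omega>) B) \<in> borel_measurable F"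
    and bd: "\<And>\<omega>. \<omega> \<in> space M \<Longrightarrow> emeasure (\<mu> \<omega>) D \<le> ennreal R" and R: "0 \<le> R"
    and h[measurable]: "h \<in> borel_measurable borel" and h01: "\<And>s. 0 \<le> h s" "\<And>s. h s \<le> 1"
  defines "S \<equiv> \<lambda>\<omega>. \<Sum>k\<in>arrivals_in \<Gamma> \<omega> D. h (real_of_ereal (\<Gamma> k \<omega>))"
    and "m \<equiv> \<lambda>\<omega>. LINT s|\<mu> \<omega>. indicator D s * h s"
  shows "integrable M S" and "integrable M m" and "expectation (\<lambda>\<omega>. \<bar>S \<omega> - m \<omega>\<bar>) \<le> sqrt R"
proof -
  have \<Gamma>[measurable]: "1 \<le> k \<Longrightarrow> \<Gamma> k \<in> borel_measurable M" for k
    using pois by (auto simp: cond_poisson_process_def)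
  note [measurable] = D(1)
  have arr[measurable]: "B \<in> sets borel \<Longrightarrow> Measurable.pred M (\<lambda>\<omega>. k \<in> arrivals_in \<Gamma> \<omega> B)" for k B
    by (intro measurable_arrivals_in \<Gamma>)
  define B where "B n i = {s\<in>D. real i / real n \<le> h s}" for n i :: nat
  have B[measurable]: "B n i \<in> sets borel" for n i
  proof -
    have "B n i = D \<inter> {s\<in>space borel. real i / real n \<le> h s}" by (auto simp: B_def)
    also have "\<dots> \<in> sets borel" by measurable
    finally show ?thesis .
  qed
  have B_D: "B n i \<subseteq> D" for n i
    by (auto simp: B_def)
  have bdd: "bounded (B n i)" "B n i \<subseteq> {0..}" for n i
    using D(2,3) B_D[of n i] bounded_subset by auto
  have fin_em: "emeasure (\<mu> \<omega>) D < \<infinity>" if "\<omega> \<in> space M" for \<omega>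
    using bd[OF that] by (auto simp: less_top[symmetric] top_unique)
  have D\<mu>: "D \<in> sets (\<mu> \<omega>)" "B n i \<in> sets (\<mu> \<omega>)" for \<omega> n i
    by (simp_all add: sets)
  have meas_D: "measure (\<mu> \<omega>) D \<le> R" if "\<omega> \<in> space M" for \<omega>
    using bd[OF that] R by (simp add: measure_def enn2real_leI)
  have meas_B: "measure (\<mu> \<omega>) (B n i) \<le> R" if "\<omega> \<in> space M" for \<omega> n i
    using bd[OF that] R emeasure_mono[OF B_D D\<mu>(1), of \<omega> n i]
    by (auto simp: measure_def intro!: enn2real_leI elim: order_trans)
  have meas_D': "\<forall>\<omega>\<in>space M. measure (\<mu> \<omega>) D \<le> R"
    and meas_B': "\<forall>\<omega>\<in>space M. measure (\<mu> \<omega>) (B n i) \<le> R" for n i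
    using meas_D meas_B by auto
  have measF: "(\<lambda>\<omega>. measure (\<mu> \<omega>) (B n i)) \<in> borel_measurable F" for n i
    by (intro meas B B_D)
  have measM[measurable]: "(\<lambda>\<omega>. measure (\<mu> \<omega>) (B n i)) \<in> borel_measurable M" for n i
    using measurable_from_subalg[OF sub measF] .
  note cD = cond_poisson_process_count[OF sub pois D meas[OF D(1) order_refl] meas_D']
  note cB = cond_poisson_process_count[OF sub pois B bdd measF meas_B']
  define Sn where "Sn n \<omega> = (\<Sum>i\<in>{1..n}. real (card (arrivals_in \<Gamma> \<omega> (B n i)))) / real n" for n \<omega>
  define mn where "mn n \<omega> = (\<Sum>i\<in>{1..n}. measure (\<mu> \<omega>) (B n i)) / real n" for n \<omega>
  \<comment> \<open>This is \<open>layer_approx\<close> integrated over \<open>D\<close> against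
    \<open>\<mu> \<omega>\<close>: a uniform error \<open>1 / real n\<close> times a total mass of
    at most \<open>R\<close>.\<close>
  have m_approx: "\<bar>mn n \<omega> - m \<omega>\<bar> \<le> R / real n" if \<omega>: "\<omega> \<in> space M" and n: "0 < n" for n \<omega>
  proof -
    have int_D: "integrable (\<mu> \<omega>) (indicator D :: real \<Rightarrow> real)"
      using fin_em[OF \<omega>] D\<mu> by simp
    have int: "integrable (\<mu> \<omega>) (\<lambda>s. indicator D s * g s)"
      if "g \<in> borel_measurable borel" "\<And>s. \<bar>g s\<bar> \<le> 1" for g :: "real \<Rightarrow> real"
    proof (rule Bochner_Integration.integrable_bound[OF int_D])
      have "(\<lambda>s. indicator D s * g s) \<in> borel_measurable borel" using that by measurable
      then show "(\<lambda>s. indicator D s * g s) \<in> borel_measurable (\<mu> \<omega>)"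
        using measurable_cong_sets[OF sets[of \<omega>] refl] by auto
    qed (use that(2) in \<open>auto simp: indicator_def\<close>)
    have meas_eq: "measure (\<mu> \<omega>) (B n i) = (LINT s|\<mu> \<omega>. indicator D s * of_bool (real i / real n \<le> h s))" for i
    proof -
      have "measure (\<mu> \<omega>) (B n i) = (LINT s|\<mu> \<omega>. indicator (B n i) s)"
        using sets_eq_imp_space_eq[OF sets[of \<omega>]] by simp
      also have "\<dots> = (LINT s|\<mu> \<omega>. indicator D s * of_bool (real i / real n \<le> h s))"
        by (intro Bochner_Integration.integral_cong) (auto simp: B_def indicator_def)
      finally show ?thesis .
    qed
    define lay where "lay s = (\<Sum>i\<in>{1..n}. of_bool (real i / real n \<le> h s)) / real n" for s
    have lay[measurable]: "lay \<in> borel_measurable borel"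
      unfolding lay_def by measurable
    have lay01: "\<bar>lay s\<bar> \<le> 1" for s
      using sum_bounded_above[of "{1..n}" "\<lambda>i. of_bool (real i / real n \<le> h s)" "1::real"] n
      by (simp add: lay_def sum_nonneg divide_le_eq)
    have "mn n \<omega> = (LINT s|\<mu> \<omega>. indicator D s * lay s)"
    proof -
      have "mn n \<omega> = (LINT s|\<mu> \<omega>. (\<Sum>i\<in>{1..n}. indicator D s * of_bool (real i / real n \<le> h s))) / real n"
        unfolding mn_def meas_eq by (subst Bochner_Integration.integral_sum) (auto intro!: int)
      also have "\<dots> = (LINT s|\<mu> \<omega>. (\<Sum>i\<in>{1..n}. indicator D s * of_bool (real i / real n \<le> h s)) / real n)"
        by (simp only: integral_divide_zero)
      finally show ?thesis
        by (simp only: lay_def sum_distrib_left times_divide_eq_right)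
    qed
    then have "mn n \<omega> - m \<omega> = (LINT s|\<mu> \<omega>. indicator D s * lay s - indicator D s * h s)"
      unfolding m_def using h01 lay01
      by (subst Bochner_Integration.integral_diff) (auto intro!: int)
    also have "\<bar>\<dots>\<bar> \<le> (LINT s|\<mu> \<omega>. indicator D s * (1 / real n))"
    proof (rule integral_abs_bound_integral)
      show "integrable (\<mu> \<omega>) (\<lambda>s. indicator D s * (1 / real n))"
        using int_D by simp
      show "integrable (\<mu> \<omega>) (\<lambda>s. indicator D s * lay s - indicator D s * h s)"
        using h01 lay01 by (auto intro!: Bochner_Integration.integrable_diff int)
    qed (use layer_approx[OF h01 n] in \<open>auto simp: indicator_def lay_def\<close>)
    also have "\<dots> = measure (\<mu> \<omega>) D / real n"
      using sets_eq_imp_space_eq[OF sets[of \<omega>]] by simp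
    also have "\<dots> \<le> R / real n"
      using meas_D[OF \<omega>] by (simp add: divide_right_mono)
    finally show ?thesis .
  qed
  \<comment> \<open>Measurability in \<omega> is assumed for the measures of sets, not for integrals
    of \<open>h\<close>; it reaches \<open>m\<close> as a pointwise limit of the
    \<open>mn\<close>.\<close>
  have m_meas[measurable]: "m \<in> borel_measurable M"
  proof (rule borel_measurable_LIMSEQ_real)
    show "(\<lambda>n. mn (Suc n) \<omega>) \<longlonglongrightarrow> m \<omega>" if "\<omega> \<in> space M" for \<omega>
    proof (rule LIM_zero_cancel, rule Lim_null_comparison)
      show "\<forall>\<^sub>F n in sequentially. norm (mn (Suc n) \<omega> - m \<omega>) \<le> R / real (Suc n)"
        unfolding real_norm_def by (intro always_eventually allI m_approx that) simp
      show "(\<lambda>n. R / real (Suc n)) \<longlonglongrightarrow> 0"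
        by (rule LIMSEQ_Suc) (rule lim_const_over_n)
    qed
  qed (simp add: mn_def)
  have mn_bd: "\<bar>mn n \<omega>\<bar> \<le> R" if "\<omega> \<in> space M" for n \<omega>
    using sum_bounded_above[of "{1..n}" "\<lambda>i. measure (\<mu> \<omega>) (B n i)" R] meas_B[OF that] R
    by (cases "n = 0") (auto simp: mn_def sum_nonneg divide_le_eq mult.commute)
  \<comment> \<open>The case of a single level, \<open>n = 1\<close>: \<open>R\<close> for the
    approximation and \<open>R\<close> for its error. Only boundedness matters here.\<close>
  have m_bd: "\<bar>m \<omega>\<bar> \<le> 2 * R" if "\<omega> \<in> space M" for \<omega>
    using m_approx[OF that, of 1] mn_bd[OF that, of 1] by auto
  show int_m: "integrable M m"
    using m_bd by (intro integrable_const_bound[where B = "2 * R"]) auto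
  have S_meas[measurable]: "S \<in> borel_measurable M"
    unfolding S_def
  proof (rule borel_measurable_sum_random_set)
    fix k show "(\<lambda>\<omega>. of_bool (k \<in> arrivals_in \<Gamma> \<omega> D) * h (real_of_ereal (\<Gamma> k \<omega>))) \<in> borel_measurable M"
    proof (cases "1 \<le> k")
      case False then show ?thesis by (simp add: arrivals_in_def)
    qed measurable
  qed measurable
  have S_bd: "\<bar>S \<omega>\<bar> \<le> real (card (arrivals_in \<Gamma> \<omega> D))" for \<omega>
    using sum_bounded_above[of "arrivals_in \<Gamma> \<omega> D" "\<lambda>k. h (real_of_ereal (\<Gamma> k \<omega>))" 1] h01
    by (simp add: S_def sum_nonneg)
  show int_S: "integrable M S"
    using S_bd by (intro Bochner_Integration.integrable_bound[OF cD(2)]) auto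
  \<comment> \<open>The counterpart of \<open>m_approx\<close> for the random sum: every arrival in
    \<open>D\<close> contributes an error of at most \<open>1 / real n\<close>. It needs a finite
    set of arrivals, which holds almost surely.\<close>
  have S_approx: "AE \<omega> in M. \<bar>S \<omega> - Sn n \<omega>\<bar> \<le> real (card (arrivals_in \<Gamma> \<omega> D)) / real n" if n: "0 < n" for n
    using cD(1)
  proof (rule AE_mp, intro AE_I2 impI)
    fix \<omega> assume fin: "finite (arrivals_in \<Gamma> \<omega> D)"
    have "real (card (arrivals_in \<Gamma> \<omega> (B n i)))
        = (\<Sum>k\<in>arrivals_in \<Gamma> \<omega> D. of_bool (real i / real n \<le> h (real_of_ereal (\<Gamma> k \<omega>))))" for i
    proof -
      have "arrivals_in \<Gamma> \<omega> (B n i)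
          = {k\<in>arrivals_in \<Gamma> \<omega> D. real i / real n \<le> h (real_of_ereal (\<Gamma> k \<omega>))}"
        by (auto simp: arrivals_in_def B_def)
      then show ?thesis using fin by (simp add: sum.If_cases of_bool_def Int_def)
    qed
    then have "Sn n \<omega> = (\<Sum>i\<in>{1..n}. \<Sum>k\<in>arrivals_in \<Gamma> \<omega> D. of_bool (real i / real n \<le> h (real_of_ereal (\<Gamma> k \<omega>)))) / real n"
      by (simp only: Sn_def)
    also have "\<dots> = (\<Sum>k\<in>arrivals_in \<Gamma> \<omega> D. (\<Sum>i\<in>{1..n}. of_bool (real i / real n \<le> h (real_of_ereal (\<Gamma> k \<omega>)))) / real n)"
      by (simp only: sum.swap[of _ _ "{1..n}"] sum_divide_distrib)
    finally have Sn: "Sn n \<omega> = \<dots>" .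
    have "\<bar>S \<omega> - Sn n \<omega>\<bar> \<le> (\<Sum>k\<in>arrivals_in \<Gamma> \<omega> D. 1 / real n)"
      unfolding S_def Sn sum_subtractf[symmetric] using layer_approx[OF h01 n]
      by (intro order_trans[OF sum_abs] sum_mono) (simp only: abs_minus_commute)
    then show "\<bar>S \<omega> - Sn n \<omega>\<bar> \<le> real (card (arrivals_in \<Gamma> \<omega> D)) / real n" by simp
  qed
  \<comment> \<open>The two discretisation errors have mean at most \<open>R / real n\<close> each
    and vanish as the levels are refined. The middle term averages \<open>n\<close> deviations of
    Poisson counts, each at most \<open>sqrt R\<close> in L1, so it does not grow with the number of
    levels.\<close>
  have main: "expectation (\<lambda>\<omega>. \<bar>S \<omega> - m \<omega>\<bar>) \<le> sqrt R + 2 * R / real n" if n: "0 < n" for n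
  proof -
    have int_dev: "integrable M (\<lambda>\<omega>. \<bar>real (card (arrivals_in \<Gamma> \<omega> (B n i))) - measure (\<mu> \<omega>) (B n i)\<bar>)" for i
    proof -
      have "integrable M (\<lambda>\<omega>. measure (\<mu> \<omega>) (B n i))"
        using meas_B by (intro integrable_const_bound[where B = R]) auto
      then show ?thesis using cB(2) by (intro integrable_abs Bochner_Integration.integrable_diff)
    qed
    have "expectation (\<lambda>\<omega>. \<bar>S \<omega> - m \<omega>\<bar>)
        \<le> expectation (\<lambda>\<omega>. real (card (arrivals_in \<Gamma> \<omega> D)) / real n
            + (\<Sum>i\<in>{1..n}. \<bar>real (card (arrivals_in \<Gamma> \<omega> (B n i))) - measure (\<mu> \<omega>) (B n i)\<bar>) / real n + R / real n)"
    proof (rule integral_mono_AE)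
      show "AE \<omega> in M. \<bar>S \<omega> - m \<omega>\<bar> \<le> real (card (arrivals_in \<Gamma> \<omega> D)) / real n
            + (\<Sum>i\<in>{1..n}. \<bar>real (card (arrivals_in \<Gamma> \<omega> (B n i))) - measure (\<mu> \<omega>) (B n i)\<bar>) / real n + R / real n"
        using S_approx[OF n]
      proof (rule AE_mp, intro AE_I2 impI)
        fix \<omega> assume \<omega>: "\<omega> \<in> space M" and S: "\<bar>S \<omega> - Sn n \<omega>\<bar> \<le> real (card (arrivals_in \<Gamma> \<omega> D)) / real n"
        have "\<bar>Sn n \<omega> - mn n \<omega>\<bar> \<le> (\<Sum>i\<in>{1..n}. \<bar>real (card (arrivals_in \<Gamma> \<omega> (B n i))) - measure (\<mu> \<omega>) (B n i)\<bar>) / real n"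
          unfolding Sn_def mn_def diff_divide_distrib[symmetric] sum_subtractf[symmetric]
          by (simp add: divide_right_mono)
        then show "\<bar>S \<omega> - m \<omega>\<bar> \<le> real (card (arrivals_in \<Gamma> \<omega> D)) / real n
            + (\<Sum>i\<in>{1..n}. \<bar>real (card (arrivals_in \<Gamma> \<omega> (B n i))) - measure (\<mu> \<omega>) (B n i)\<bar>) / real n + R / real n"
          using S m_approx[OF \<omega> n] by linarith
      qed
    qed (intro integrable_abs Bochner_Integration.integrable_diff Bochner_Integration.integrable_add
          integrable_divide Bochner_Integration.integrable_sum int_S int_m cD(2) int_dev integrable_const)+
    also have "\<dots> = expectation (\<lambda>\<omega>. real (card (arrivals_in \<Gamma> \<omega> D))) / real n
            + (\<Sum>i\<in>{1..n}. expectation (\<lambda>\<omega>. \<bar>real (card (arrivals_in \<Gamma> \<omega> (B n i))) - measure (\<mu> \<omega>) (B n i)\<bar>)) / real n + R / real n"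
    proof -
      show ?thesis
        using int_dev cD(2) by (simp add: Bochner_Integration.integral_sum Bochner_Integration.integrable_sum prob_space)
    qed
    also have "\<dots> \<le> R / real n + (\<Sum>i\<in>{1..n}. sqrt R) / real n + R / real n"
      using cD(3) cB(4) by (intro add_mono divide_right_mono sum_mono) auto
    also have "\<dots> = sqrt R + 2 * R / real n" using n by simp
    finally show ?thesis .
  qed
  have "(\<lambda>n. sqrt R + 2 * R / real n) \<longlonglongrightarrow> sqrt R + 0"
    by (intro tendsto_intros lim_const_over_n)
  then have "expectation (\<lambda>\<omega>. \<bar>S \<omega> - m \<omega>\<bar>) \<le> sqrt R + 0"
    using main by (intro LIMSEQ_le_const) (auto intro: exI[of _ 1])
  then show "expectation (\<lambda>\<omega>. \<bar>S \<omega> - m \<omega>\<bar>) \<le> sqrt R" by simp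
qed

section \<open>Service times\<close>

text \<open>The rays are the sections of the measurable region \<open>f s < r\<close> in the plane.
  With \<open>f s = t - s\<close> the measure is the probability that a job arriving at
  \<open>s\<close> is still active at \<open>t\<close>.\<close>

lemma borel_measurable_kernel_greaterThan:
  assumes \<nu>: "\<nu> \<in> borel \<rightarrow>\<^sub>M prob_algebra borel" and [measurable]: "f \<in> borel_measurable borel"
  shows "(\<lambda>s. measure (\<nu> s) {f s :: real<..}) \<in> borel_measurable borel"
proof (rule measure_measurable_prob_algebra2[OF _ \<nu>])
  have "Sigma (space borel) (\<lambda>s. {f s<..}) = {x\<in>space (borel \<Otimes>\<^sub>M borel). f (fst x) < snd x}"
    by (auto simp: space_pair_measure)
  also have "\<dots> \<in> sets (borel \<Otimes>\<^sub>M borel)" by measurable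
  finally show "Sigma (space borel) (\<lambda>s. {f s<..}) \<in> sets (borel \<Otimes>\<^sub>M borel)" .
qed

text \<open>Expanding the product gives four terms. Given \<open>G\<close>, the events for
  \<open>j\<close>, for \<open>k\<close> and for both have probabilities \<open>p\<close>,
  \<open>q\<close> and \<open>p * q\<close> wherever the two arrivals exist; the
  \<open>G\<close>-measurable factor \<open>Y\<close> vanishes elsewhere. All four expectations thus
  equal that of \<open>Y * p * q\<close> and cancel in pairs.\<close>

lemma (in prob_space) service_times_uncorrelated:
  assumes sub: "subalgebra M G" and serv: "cond_service_times M G \<Gamma> \<nu> L"
    and \<nu>: "\<nu> \<in> borel \<rightarrow>\<^sub>M prob_algebra borel"
    and jk: "1 \<le> j" "1 \<le> k" "j \<noteq> k"
    and \<Gamma>: "\<Gamma> j \<in> borel_measurable G" "\<Gamma> k \<in> borel_measurable G"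
    and T: "T \<in> sets G" "\<And>\<omega>. \<omega> \<in> T \<Longrightarrow> \<Gamma> j \<omega> < \<infinity>" "T' \<in> sets G" "\<And>\<omega>. \<omega> \<in> T' \<Longrightarrow> \<Gamma> k \<omega> < \<infinity>"
    and A: "A \<in> sets borel" "A' \<in> sets borel"
  defines "dev \<equiv> \<lambda>k A \<omega>. indicator A (L k \<omega>) - measure (\<nu> (real_of_ereal (\<Gamma> k \<omega>))) A"
  shows "expectation (\<lambda>\<omega>. (indicator T \<omega> * dev j A \<omega>) * (indicator T' \<omega> * dev k A' \<omega>)) = 0"
proof -
  have L[measurable]: "L j \<in> borel_measurable M" "L k \<in> borel_measurable M"
    using serv jk by (auto simp: cond_service_times_def)
  note [measurable] = A T(1,3) \<Gamma>
  have \<nu>_meas: "(\<lambda>s. measure (\<nu> s) B) \<in> borel_measurable borel" if "B \<in> sets borel" for B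
    using that by (intro measure_measurable_prob_algebra2[OF _ \<nu>] pair_measureI) auto
  have \<nu>_prob: "prob_space (\<nu> s)" for s
    using measurable_space[OF \<nu>, of s] by (simp add: space_prob_algebra)
  have \<nu>_bd: "measure (\<nu> s) B \<le> 1" for s B
    using \<nu>_prob[of s] by (rule prob_space.prob_le_1)
  define p where "p \<omega> = measure (\<nu> (real_of_ereal (\<Gamma> j \<omega>))) A" for \<omega>
  define q where "q \<omega> = measure (\<nu> (real_of_ereal (\<Gamma> k \<omega>))) A'" for \<omega>
  have pq[measurable]: "p \<in> borel_measurable G" "q \<in> borel_measurable G"
    unfolding p_def q_def using \<Gamma> by (auto intro!: measurable_compose[OF _ \<nu>_meas[OF A(1)]] measurable_compose[OF _ \<nu>_meas[OF A(2)]])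
  have pq01: "0 \<le> p \<omega>" "p \<omega> \<le> 1" "0 \<le> q \<omega>" "q \<omega> \<le> 1" for \<omega>
    by (auto simp: p_def q_def \<nu>_bd)
  define Y where "Y \<omega> = indicator T \<omega> * (indicator T' \<omega> :: real)" for \<omega>
  have Y[measurable]: "Y \<in> borel_measurable G"
    unfolding Y_def by measurable
  have Y_cases: "Y \<omega> = 0 \<or> Y \<omega> = 1" for \<omega>
    by (auto simp: Y_def indicator_def)
  note to_M = measurable_from_subalg[OF sub]
  have YM[measurable]: "Y \<in> borel_measurable M" "p \<in> borel_measurable M" "q \<in> borel_measurable M"
    by (auto intro: to_M)
  define E1 where "E1 = {\<omega>\<in>space M. L j \<omega> \<in> A}"
  define E2 where "E2 = {\<omega>\<in>space M. L k \<omega> \<in> A'}"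
  have E[measurable]: "E1 \<in> sets M" "E2 \<in> sets M" unfolding E1_def E2_def by measurable
  have cp: "AE \<omega> in M. (\<forall>k\<in>I. \<Gamma> k \<omega> < \<infinity>) \<longrightarrow> cprob M G {\<omega>'\<in>space M. \<forall>k\<in>I. L k \<omega>' \<in> AA k} \<omega>
             = (\<Prod>k\<in>I. measure (\<nu> (real_of_ereal (\<Gamma> k \<omega>))) (AA k))"
    if "finite I" "I \<subseteq> {1..}" "\<forall>k\<in>I. AA k \<in> sets borel" for I AA
    using serv[unfolded cond_service_times_def, THEN conjunct2, rule_format, of I AA] that by blast
  have T_fin: "\<omega> \<in> T \<Longrightarrow> \<Gamma> j \<omega> \<noteq> \<infinity>" "\<omega> \<in> T' \<Longrightarrow> \<Gamma> k \<omega> \<noteq> \<infinity>" for \<omega>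
    using T(2)[of \<omega>] T(4)[of \<omega>] by auto
  have cp1: "AE \<omega> in M. Y \<omega> * q \<omega> \<noteq> 0 \<longrightarrow> cprob M G E1 \<omega> = p \<omega>"
    using cp[of "{j}" "\<lambda>_. A"] jk A
    by (rule_tac AE_mp) (auto simp: E1_def p_def Y_def indicator_def dest: T_fin intro!: AE_I2)
  have cp2: "AE \<omega> in M. Y \<omega> * p \<omega> \<noteq> 0 \<longrightarrow> cprob M G E2 \<omega> = q \<omega>"
    using cp[of "{k}" "\<lambda>_. A'"] jk A
    by (rule_tac AE_mp) (auto simp: E2_def q_def Y_def indicator_def dest: T_fin intro!: AE_I2)
  have cp3: "AE \<omega> in M. Y \<omega> \<noteq> 0 \<longrightarrow> cprob M G (E1 \<inter> E2) \<omega> = p \<omega> * q \<omega>"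
  proof -
    have "E1 \<inter> E2 = {\<omega>'\<in>space M. \<forall>i\<in>{j, k}. L i \<omega>' \<in> (if i = j then A else A')}"
      using jk by (auto simp: E1_def E2_def)
    then show ?thesis
      using cp[of "{j, k}" "\<lambda>i. if i = j then A else A'"] jk A
      by (rule_tac AE_mp) (auto simp: p_def q_def Y_def indicator_def dest: T_fin intro!: AE_I2)
  qed
  have bd: "\<bar>Y \<omega>\<bar> \<le> 1" "\<bar>Y \<omega> * p \<omega>\<bar> \<le> 1" "\<bar>Y \<omega> * q \<omega>\<bar> \<le> 1" for \<omega>
    using Y_cases[of \<omega>] pq01[of \<omega>] by auto
  have e1: "expectation (\<lambda>\<omega>. (Y \<omega> * q \<omega>) * indicator E1 \<omega>) = expectation (\<lambda>\<omega>. (Y \<omega> * q \<omega>) * p \<omega>)"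
    using bd cp1 by (intro integral_mult_indicator_eq_cprob[OF sub]) auto
  have e2: "expectation (\<lambda>\<omega>. (Y \<omega> * p \<omega>) * indicator E2 \<omega>) = expectation (\<lambda>\<omega>. (Y \<omega> * p \<omega>) * q \<omega>)"
    using bd cp2 by (intro integral_mult_indicator_eq_cprob[OF sub]) auto
  have e3: "expectation (\<lambda>\<omega>. Y \<omega> * indicator (E1 \<inter> E2) \<omega>) = expectation (\<lambda>\<omega>. Y \<omega> * (p \<omega> * q \<omega>))"
    using bd cp3 by (intro integral_mult_indicator_eq_cprob[OF sub]) auto
  have i: "integrable M (\<lambda>\<omega>. Y \<omega> * indicator (E1 \<inter> E2) \<omega>)" "integrable M (\<lambda>\<omega>. (Y \<omega> * q \<omega>) * indicator E1 \<omega>)"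
    "integrable M (\<lambda>\<omega>. (Y \<omega> * p \<omega>) * indicator E2 \<omega>)" "integrable M (\<lambda>\<omega>. Y \<omega> * (p \<omega> * q \<omega>))"
  proof -
    have "\<bar>Y \<omega> * indicator (E1 \<inter> E2) \<omega>\<bar> \<le> 1" "\<bar>(Y \<omega> * q \<omega>) * indicator E1 \<omega>\<bar> \<le> 1"
      "\<bar>(Y \<omega> * p \<omega>) * indicator E2 \<omega>\<bar> \<le> 1" "\<bar>Y \<omega> * (p \<omega> * q \<omega>)\<bar> \<le> 1" for \<omega>
      using Y_cases[of \<omega>] pq01[of \<omega>] by (auto simp: indicator_def mult_le_one)
    then show "integrable M (\<lambda>\<omega>. Y \<omega> * indicator (E1 \<inter> E2) \<omega>)" "integrable M (\<lambda>\<omega>. (Y \<omega> * q \<omega>) * indicator E1 \<omega>)"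
      "integrable M (\<lambda>\<omega>. (Y \<omega> * p \<omega>) * indicator E2 \<omega>)" "integrable M (\<lambda>\<omega>. Y \<omega> * (p \<omega> * q \<omega>))"
      by (auto intro!: integrable_const_bound[where B = 1])
  qed
  have "expectation (\<lambda>\<omega>. (indicator T \<omega> * dev j A \<omega>) * (indicator T' \<omega> * dev k A' \<omega>))
      = expectation (\<lambda>\<omega>. (Y \<omega> * indicator (E1 \<inter> E2) \<omega> - (Y \<omega> * q \<omega>) * indicator E1 \<omega>)
          - ((Y \<omega> * p \<omega>) * indicator E2 \<omega> - Y \<omega> * (p \<omega> * q \<omega>)))"
    by (intro Bochner_Integration.integral_cong)
      (auto simp: dev_def Y_def p_def q_def E1_def E2_def indicator_def algebra_simps)
  also have "\<dots> = 0"
    using i e1 e2 e3 by (simp add: algebra_simps)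
  finally show ?thesis .
qed

lemma (in prob_space) expectation_square_sum_uncorrelated:
  fixes \<xi> :: "'i \<Rightarrow> 'a \<Rightarrow> real"
  assumes "finite I" and [measurable]: "\<And>i. i \<in> I \<Longrightarrow> \<xi> i \<in> borel_measurable M"
    and bd: "\<And>i \<omega>. i \<in> I \<Longrightarrow> \<bar>\<xi> i \<omega>\<bar> \<le> 1"
    and orth: "\<And>i j. i \<in> I \<Longrightarrow> j \<in> I \<Longrightarrow> i \<noteq> j \<Longrightarrow> expectation (\<lambda>\<omega>. \<xi> i \<omega> * \<xi> j \<omega>) = 0"
  shows "integrable M (\<lambda>\<omega>. (\<Sum>i\<in>I. \<xi> i \<omega>)\<^sup>2)"
    and "expectation (\<lambda>\<omega>. (\<Sum>i\<in>I. \<xi> i \<omega>)\<^sup>2) = (\<Sum>i\<in>I. expectation (\<lambda>\<omega>. (\<xi> i \<omega>)\<^sup>2))"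
proof -
  have int: "integrable M (\<lambda>\<omega>. \<xi> i \<omega> * \<xi> j \<omega>)" if "i \<in> I" "j \<in> I" for i j
    using that bd by (intro integrable_const_bound[where B = 1]) (auto simp: abs_mult intro!: mult_le_one)
  have eq: "(\<Sum>i\<in>I. \<xi> i \<omega>)\<^sup>2 = (\<Sum>i\<in>I. \<Sum>j\<in>I. \<xi> i \<omega> * \<xi> j \<omega>)" for \<omega>
    by (simp add: power2_eq_square sum_product)
  show "integrable M (\<lambda>\<omega>. (\<Sum>i\<in>I. \<xi> i \<omega>)\<^sup>2)"
    unfolding eq by (intro Bochner_Integration.integrable_sum int)
  have "expectation (\<lambda>\<omega>. (\<Sum>i\<in>I. \<xi> i \<omega>)\<^sup>2) = (\<Sum>i\<in>I. \<Sum>j\<in>I. expectation (\<lambda>\<omega>. \<xi> i \<omega> * \<xi> j \<omega>))"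
    unfolding eq using int by (simp add: Bochner_Integration.integral_sum Bochner_Integration.integrable_sum)
  also have "\<dots> = (\<Sum>i\<in>I. \<Sum>j\<in>I. if j = i then expectation (\<lambda>\<omega>. (\<xi> i \<omega>)\<^sup>2) else 0)"
    by (intro sum.cong refl) (auto simp: orth power2_eq_square)
  also have "\<dots> = (\<Sum>i\<in>I. expectation (\<lambda>\<omega>. (\<xi> i \<omega>)\<^sup>2))"
    using \<open>finite I\<close> by simp
  finally show "expectation (\<lambda>\<omega>. (\<Sum>i\<in>I. \<xi> i \<omega>)\<^sup>2) = (\<Sum>i\<in>I. expectation (\<lambda>\<omega>. (\<xi> i \<omega>)\<^sup>2))" .
qed

section \<open>Rounding of thresholds and thinning of the arrivals\<close>

lemma scaled_floor_approx:
  fixes s :: real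
  assumes "0 \<le> s"
  defines "D \<equiv> \<lambda>n. real (nat \<lfloor>real (Suc n) * s\<rfloor>) / real (Suc n)"
  shows "D n \<le> s" and "D \<longlonglongrightarrow> s"
proof -
  have fl: "real (nat \<lfloor>real (Suc n) * s\<rfloor>) \<le> real (Suc n) * s" "real (Suc n) * s - 1 \<le> real (nat \<lfloor>real (Suc n) * s\<rfloor>)" for n
    using assms(1) by (auto simp: of_nat_nat simp del: of_nat_Suc)
  have le: "D n \<le> s" "s - 1 / real (Suc n) \<le> D n" for n
  proof -
    show "D n \<le> s"
      using fl(1)[of n] by (simp add: D_def pos_divide_le_eq mult.commute del: of_nat_Suc)
    have "s - 1 / real (Suc n) = (real (Suc n) * s - 1) / real (Suc n)"
      by (simp add: diff_divide_distrib del: of_nat_Suc)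
    then show "s - 1 / real (Suc n) \<le> D n"
      using fl(2)[of n] by (simp add: D_def divide_right_mono del: of_nat_Suc)
  qed
  show "D n \<le> s" by (rule le)
  have "(\<lambda>n. s - 1 / real (Suc n)) \<longlonglongrightarrow> s - 0"
    by (intro tendsto_intros LIMSEQ_Suc[OF lim_const_over_n])
  then show "D \<longlonglongrightarrow> s"
    by (intro tendsto_sandwich[of "\<lambda>n. s - 1 / real (Suc n)" D sequentially "\<lambda>_. s"])
      (auto simp: le simp del: of_nat_Suc)
qed

text \<open>The side of the approximation matters: if \<open>a n\<close> approached \<open>b\<close>
  from below, the indicator at \<open>x = b\<close> would be \<open>1\<close> along the sequence and
  \<open>0\<close> in the limit. This is why arrival times are rounded down, which makes the
  thresholds decrease to their limit from above or meet it.\<close>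

lemma tendsto_indicator_greaterThan:
  fixes a :: "nat \<Rightarrow> real"
  assumes "a \<longlonglongrightarrow> b" "\<And>n. b \<le> a n"
  shows "(\<lambda>n. indicator {a n<..} x :: real) \<longlonglongrightarrow> indicator {b<..} x"
proof (cases "b < x")
  case True
  then have "\<forall>\<^sub>F n in sequentially. a n < x"
    using order_tendstoD(2)[OF assms(1)] by simp
  then show ?thesis
    using True by (intro tendsto_eventually) (auto elim: eventually_mono)
next
  case False
  then have "\<not> a n < x" for n using assms(2)[of n] by linarith
  then show ?thesis using False by simp
qed

lemma tendsto_measure_greaterThan:
  fixes a :: "nat \<Rightarrow> real"
  assumes "prob_space P" and sets: "sets P = sets borel" and "a \<longlonglongrightarrow> b" "\<And>n. b \<le> a n"
  shows "(\<lambda>n. measure P {a n<..}) \<longlonglongrightarrow> measure P {b<..}"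
proof -
  interpret prob_space P by fact
  have "(\<lambda>n. integral\<^sup>L P (indicator {a n<..} :: real \<Rightarrow> real)) \<longlonglongrightarrow> integral\<^sup>L P (indicator {b<..})"
    using tendsto_indicator_greaterThan[OF assms(3,4)]
    by (intro integral_dominated_convergence[where w = "\<lambda>_. 1"]) (auto simp: sets intro!: borel_measurable_indicator)
  moreover have "space P = UNIV" using sets_eq_imp_space_eq[OF sets] by simp
  ultimately show ?thesis by simp
qed

text \<open>
  The hypothesis on \<open>L\<close> concerns fixed sets only, whereas a job is active if \<open>L k\<close> exceeds the random
  threshold \<open>t - \<Gamma> k\<close>; the threshold is therefore discretised by rounding \<open>\<Gamma> k\<close> down.
\<close>

lemma (in prob_space) service_times_thinning:
  fixes t :: real
  assumes sub: "subalgebra M G" and serv: "cond_service_times M G \<Gamma> \<nu> L"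
    and \<nu>: "\<nu> \<in> borel \<rightarrow>\<^sub>M prob_algebra borel"
    and \<Gamma>: "\<And>k. 1 \<le> k \<Longrightarrow> \<Gamma> k \<in> borel_measurable G"
    and fin: "AE \<omega> in M. finite (arrivals_in \<Gamma> \<omega> {0..<t})"
    and int: "integrable M (\<lambda>\<omega>. real (card (arrivals_in \<Gamma> \<omega> {0..<t})))"
    and R: "expectation (\<lambda>\<omega>. real (card (arrivals_in \<Gamma> \<omega> {0..<t}))) \<le> R"
  defines "N \<equiv> \<lambda>\<omega>. \<Sum>k\<in>arrivals_in \<Gamma> \<omega> {0..<t}. indicator {t - real_of_ereal (\<Gamma> k \<omega>)<..} (L k \<omega>) :: real"
    and "S \<equiv> \<lambda>\<omega>. \<Sum>k\<in>arrivals_in \<Gamma> \<omega> {0..<t}.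
      measure (\<nu> (real_of_ereal (\<Gamma> k \<omega>))) {t - real_of_ereal (\<Gamma> k \<omega>)<..}"
  shows "expectation (\<lambda>\<omega>. \<bar>N \<omega> - S \<omega>\<bar>) \<le> sqrt R"
proof -
  have L[measurable]: "L k \<in> borel_measurable M" if "1 \<le> k" for k
    using serv that by (auto simp: cond_service_times_def)
  note to_M = measurable_from_subalg[OF sub]
  have \<Gamma>M[measurable]: "\<Gamma> k \<in> borel_measurable M" if "1 \<le> k" for k
    using to_M[OF \<Gamma>[OF that]] .
  have space_G: "space G = space M" using sub by (simp add: subalgebra_def)
  have \<nu>_prob: "prob_space (\<nu> s)" "sets (\<nu> s) = sets borel" for s
    using measurable_space[OF \<nu>, of s] by (auto simp: space_prob_algebra)
  have \<nu>_bd: "measure (\<nu> s) B \<le> 1" for s B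
    using \<nu>_prob(1)[of s] by (rule prob_space.prob_le_1)
  note \<nu>_meas = borel_measurable_kernel_greaterThan[OF \<nu>]
  define \<gamma> where "\<gamma> k \<omega> = real_of_ereal (\<Gamma> k \<omega>)" for k \<omega>
  define D where "D n s = real (nat \<lfloor>real (Suc n) * s\<rfloor>) / real (Suc n)" for n and s :: real
  have D[measurable]: "D n \<in> borel_measurable borel" for n unfolding D_def by measurable
  define T where "T k = {\<omega>\<in>space M. k \<in> arrivals_in \<Gamma> \<omega> {0..<t}}" for k
  have TG: "T k \<in> sets G" for k
    using measurable_arrivals_in[of \<Gamma> G "{0..<t}" k] \<Gamma> by (simp add: T_def pred_def space_G)
  have T[measurable]: "T k \<in> sets M" for k
    using TG sub by (auto simp: subalgebra_def)
  have T_D: "\<omega> \<in> T k \<Longrightarrow> 1 \<le> k \<and> 0 \<le> \<gamma> k \<omega> \<and> \<gamma> k \<omega> < t \<and> \<Gamma> k \<omega> < \<infinity>" for k \<omega>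
    by (auto simp: T_def arrivals_in_def \<gamma>_def)
  define dev where "dev k A \<omega> = indicator A (L k \<omega>) - measure (\<nu> (\<gamma> k \<omega>)) A" for k A \<omega>
  \<comment> \<open>\<open>\<xi> n k\<close> is the centred activity indicator with rounded
    threshold, \<open>\<xi>' k\<close> the one with the exact threshold. Only the threshold is
    rounded: the law \<open>\<nu> (\<gamma> k \<omega>)\<close> keeps the exact arrival
    time.\<close>
  define \<xi> where "\<xi> n k \<omega> = indicator (T k) \<omega> * dev k {t - D n (\<gamma> k \<omega>)<..} \<omega>" for n k \<omega>
  define \<xi>' where "\<xi>' k \<omega> = indicator (T k) \<omega> * dev k {t - \<gamma> k \<omega><..} \<omega>" for k \<omega>
  have ind_eq: "indicator {a<..} x = (of_bool (a < x) :: real)" for a x :: real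
    by (auto simp: indicator_def)
  have \<xi>_meas[measurable]: "\<xi> n k \<in> borel_measurable M" "\<xi>' k \<in> borel_measurable M" if "1 \<le> k" for n k
    using that unfolding \<xi>_def \<xi>'_def dev_def \<gamma>_def ind_eq
    by (auto intro!: borel_measurable_times borel_measurable_diff
        measurable_compose[OF _ \<nu>_meas[of "\<lambda>s. t - D n s"]] measurable_compose[OF _ \<nu>_meas[of "\<lambda>s. t - s"]])
  have dev_bd: "\<bar>dev k A \<omega>\<bar> \<le> 1" for k A \<omega>
    using \<nu>_bd[of "\<gamma> k \<omega>" A] measure_nonneg[of "\<nu> (\<gamma> k \<omega>)" A] by (auto simp: dev_def indicator_def abs_le_iff simp del: measure_nonneg)
  have \<xi>_bd: "\<bar>\<xi> n k \<omega>\<bar> \<le> indicator (T k) \<omega>" "\<bar>\<xi>' k \<omega>\<bar> \<le> indicator (T k) \<omega>" for n k \<omega>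
    using dev_bd by (auto simp: \<xi>_def \<xi>'_def indicator_def)
  have \<xi>_bd1: "\<bar>\<xi> n k \<omega>\<bar> \<le> 1" for n k \<omega>
    using \<xi>_bd(1)[of n k \<omega>] by (cases "\<omega> \<in> T k") auto
  have orth: "expectation (\<lambda>\<omega>. \<xi> n j \<omega> * \<xi> n k \<omega>) = 0" if jk: "1 \<le> j" "1 \<le> k" "j \<noteq> k" for n j k
  proof -
    \<comment> \<open>\<open>Ti k i\<close> fixes the grid cell of the k-th arrival and belongs to
      \<open>G\<close>. On it the rounded threshold is a constant, so orthogonality for fixed sets
      applies to each pair of cells.\<close>
    define Ti where "Ti k i = {\<omega>\<in>T k. nat \<lfloor>real (Suc n) * \<gamma> k \<omega>\<rfloor> = i}" for k i
    have TiG: "Ti k i \<in> sets G" if "1 \<le> k" for k i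
    proof -
      have [measurable]: "\<Gamma> k \<in> borel_measurable G" "T k \<in> sets G" using \<Gamma>[OF that] TG by auto
      have "Ti k i = T k \<inter> {\<omega>\<in>space G. nat \<lfloor>real (Suc n) * real_of_ereal (\<Gamma> k \<omega>)\<rfloor> = i}"
        by (auto simp: Ti_def T_def space_G \<gamma>_def)
      also have "\<dots> \<in> sets G" by measurable
      finally show ?thesis .
    qed
    have Ti: "Ti k i \<in> sets M" if "1 \<le> k" for k i
      using TiG[OF that] sub by (auto simp: subalgebra_def)
    \<comment> \<open>Arrivals in \<open>T k\<close> come before \<open>t\<close>, so their grid
      indices do not exceed this floor and the decomposition into cells is a finite sum.\<close>
    define I where "I = {..nat \<lfloor>real (Suc n) * t\<rfloor>}"
    define A where "A i = {t - real i / real (Suc n)<..}" for i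
    have \<xi>_eq: "\<xi> n k \<omega> = (\<Sum>i\<in>I. indicator (Ti k i) \<omega> * dev k (A i) \<omega>)" for k \<omega>
    proof (cases "\<omega> \<in> T k")
      case True
      define i where "i = nat \<lfloor>real (Suc n) * \<gamma> k \<omega>\<rfloor>"
      have "i \<in> I"
        unfolding i_def I_def using T_D[OF True]
        by (auto intro!: nat_mono floor_mono mult_left_mono simp del: of_nat_Suc)
      have "(\<Sum>i\<in>I. indicator (Ti k i) \<omega> * dev k (A i) \<omega>) = (\<Sum>i'\<in>I. if i' = i then dev k (A i') \<omega> else 0)"
        using True by (intro sum.cong) (auto simp: Ti_def i_def)
      also have "\<dots> = \<xi> n k \<omega>"
        using True \<open>i \<in> I\<close> by (simp add: \<xi>_def A_def D_def i_def I_def del: of_nat_Suc)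
      finally show ?thesis ..
    next
      case False then show ?thesis by (simp add: \<xi>_def Ti_def)
    qed
    have dev_meas: "(\<lambda>\<omega>. indicator (Ti k i) \<omega> * dev k (A i) \<omega>) \<in> borel_measurable M" if "1 \<le> k" for k i
    proof -
      note [measurable] = Ti[OF that] L[OF that] \<Gamma>M[OF that]
      show ?thesis
        unfolding dev_def \<gamma>_def A_def ind_eq
        by (intro borel_measurable_times borel_measurable_diff
          measurable_compose[OF _ \<nu>_meas[of "\<lambda>_. t - real i / real (Suc n)"]]) measurable
    qed
    have "integrable M (\<lambda>\<omega>. (indicator (Ti j i) \<omega> * dev j (A i) \<omega>) * (indicator (Ti k i') \<omega> * dev k (A i') \<omega>))" for i i'
    proof (rule integrable_const_bound[where B = 1])
      have "\<bar>(indicator (Ti j i) \<omega> * dev j (A i) \<omega>) * (indicator (Ti k i') \<omega> * dev k (A i') \<omega>)\<bar> \<le> 1" for \<omega>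
        unfolding abs_mult using dev_bd by (intro mult_le_one mult_nonneg_nonneg) (auto simp: indicator_def)
      then show "AE \<omega> in M. norm ((indicator (Ti j i) \<omega> * dev j (A i) \<omega>) * (indicator (Ti k i') \<omega> * dev k (A i') \<omega>)) \<le> 1"
        by simp
    qed (intro borel_measurable_times dev_meas jk)
    then have "expectation (\<lambda>\<omega>. \<xi> n j \<omega> * \<xi> n k \<omega>)
        = (\<Sum>i\<in>I. \<Sum>i'\<in>I. expectation (\<lambda>\<omega>. (indicator (Ti j i) \<omega> * dev j (A i) \<omega>) * (indicator (Ti k i') \<omega> * dev k (A i') \<omega>)))"
      unfolding \<xi>_eq sum_product
      by (simp only: Bochner_Integration.integral_sum Bochner_Integration.integrable_sum)
    also have "\<dots> = 0"
      using service_times_uncorrelated[OF sub serv \<nu> jk \<Gamma>[OF jk(1)] \<Gamma>[OF jk(2)]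
          TiG[OF jk(1)] _ TiG[OF jk(2)] _, folded \<gamma>_def, folded dev_def] T_D
      by (intro sum.neutral ballI) (auto simp: Ti_def A_def)
    finally show ?thesis .
  qed
  have card_bd: "(\<Sum>k\<in>{1..K}. indicator (T k) \<omega>) \<le> real (card (arrivals_in \<Gamma> \<omega> {0..<t}))"
    if "finite (arrivals_in \<Gamma> \<omega> {0..<t})" for K \<omega>
  proof -
    have "(\<Sum>k\<in>{1..K}. indicator (T k) \<omega>) = real (card {k\<in>{1..K}. \<omega> \<in> T k})"
      by (simp add: indicator_def sum.If_cases Int_def)
    also have "\<dots> \<le> real (card (arrivals_in \<Gamma> \<omega> {0..<t}))"
      using that by (intro of_nat_mono card_mono) (auto simp: T_def)
    finally show ?thesis .
  qed
  \<comment> \<open>By orthogonality only the diagonal terms remain, and each is at most the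
    probability that \<open>k\<close> is an arrival in \<open>{0..<t}\<close>. Their sum is at most
    the expected number of arrivals, uniformly in the grid \<open>n\<close> and the cutoff
    \<open>K\<close>.\<close>
  have bound: "expectation (\<lambda>\<omega>. \<bar>\<Sum>k\<in>{1..K}. \<xi> n k \<omega>\<bar>) \<le> sqrt R" for n K
  proof -
    have sq: "integrable M (\<lambda>\<omega>. (\<Sum>k\<in>{1..K}. \<xi> n k \<omega>)\<^sup>2)"
      "expectation (\<lambda>\<omega>. (\<Sum>k\<in>{1..K}. \<xi> n k \<omega>)\<^sup>2) = (\<Sum>k\<in>{1..K}. expectation (\<lambda>\<omega>. (\<xi> n k \<omega>)\<^sup>2))"
      by (rule expectation_square_sum_uncorrelated; use \<xi>_bd1 orth in simp)+
    note sq(2)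
    also have "(\<Sum>k\<in>{1..K}. expectation (\<lambda>\<omega>. (\<xi> n k \<omega>)\<^sup>2)) \<le> (\<Sum>k\<in>{1..K}. expectation (indicator (T k)))"
    proof (intro sum_mono integral_mono_AE AE_I2)
      fix k \<omega> assume k: "k \<in> {1..K}"
      show "(\<xi> n k \<omega>)\<^sup>2 \<le> indicator (T k) \<omega>"
        using \<xi>_bd(1)[of n k \<omega>] by (cases "\<omega> \<in> T k") (auto simp: abs_square_le_1)
      show "integrable M (\<lambda>\<omega>. (\<xi> n k \<omega>)\<^sup>2)"
        using k \<xi>_bd1 by (intro integrable_const_bound[where B = 1]) (auto simp: abs_square_le_1)
      show "integrable M (indicator (T k) :: 'a \<Rightarrow> real)"
        by (simp add: less_top[symmetric])
    qed
    also have "\<dots> = expectation (\<lambda>\<omega>. \<Sum>k\<in>{1..K}. indicator (T k) \<omega>)"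
      by (subst Bochner_Integration.integral_sum) (auto simp: less_top[symmetric])
    also have "\<dots> \<le> expectation (\<lambda>\<omega>. real (card (arrivals_in \<Gamma> \<omega> {0..<t})))"
      using fin card_bd int by (intro integral_mono_AE) (auto simp: less_top[symmetric])
    also have "\<dots> \<le> R" by (rule R)
    finally show ?thesis
      using sq(1) by (intro expectation_abs_le_sqrt) auto
  qed
  have \<xi>_lim: "(\<lambda>n. \<xi> n k \<omega>) \<longlonglongrightarrow> \<xi>' k \<omega>" for k \<omega>
  proof (cases "\<omega> \<in> T k")
    case True
    have 0: "0 \<le> \<gamma> k \<omega>" using T_D[OF True] by simp
    have D_lim: "(\<lambda>n. D n (\<gamma> k \<omega>)) \<longlonglongrightarrow> \<gamma> k \<omega>"
      unfolding D_def by (intro scaled_floor_approx(2) 0)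
    have "t - \<gamma> k \<omega> \<le> t - D n (\<gamma> k \<omega>)" for n
      using scaled_floor_approx(1)[OF 0, of n] by (simp add: D_def)
    then show ?thesis
      unfolding \<xi>_def \<xi>'_def dev_def
      by (intro D_lim tendsto_mult tendsto_diff tendsto_const tendsto_indicator_greaterThan tendsto_measure_greaterThan \<nu>_prob)
  next
    case False then show ?thesis by (simp add: \<xi>_def \<xi>'_def)
  qed
  \<comment> \<open>The grid is refined while \<open>K\<close> is fixed, so that the constant
    \<open>real K\<close> dominates.\<close>
  have bound': "expectation (\<lambda>\<omega>. \<bar>\<Sum>k\<in>{1..K}. \<xi>' k \<omega>\<bar>) \<le> sqrt R" for K
  proof -
    have "(\<lambda>n. expectation (\<lambda>\<omega>. \<bar>\<Sum>k\<in>{1..K}. \<xi> n k \<omega>\<bar>)) \<longlonglongrightarrow> expectation (\<lambda>\<omega>. \<bar>\<Sum>k\<in>{1..K}. \<xi>' k \<omega>\<bar>)"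
    proof (rule integral_dominated_convergence[where w = "\<lambda>_. real K"])
      show "AE \<omega> in M. (\<lambda>n. \<bar>\<Sum>k\<in>{1..K}. \<xi> n k \<omega>\<bar>) \<longlonglongrightarrow> \<bar>\<Sum>k\<in>{1..K}. \<xi>' k \<omega>\<bar>"
        by (intro AE_I2 tendsto_intros \<xi>_lim)
      have "\<bar>\<Sum>k\<in>{1..K}. \<xi> n k \<omega>\<bar> \<le> real K" for n \<omega>
        using \<xi>_bd1 order_trans[OF sum_abs sum_bounded_above[of "{1..K}" "\<lambda>k. \<bar>\<xi> n k \<omega>\<bar>" 1]] by simp
      then show "AE \<omega> in M. norm \<bar>\<Sum>k\<in>{1..K}. \<xi> n k \<omega>\<bar> \<le> real K" for n
        by simp
    qed simp_all
    then show ?thesis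
      by (rule LIMSEQ_le_const2) (use bound in auto)
  qed
  have split_eq: "N \<omega> - S \<omega> = (\<Sum>k\<in>arrivals_in \<Gamma> \<omega> {0..<t}. \<xi>' k \<omega>)" if "\<omega> \<in> space M" for \<omega>
    unfolding N_def S_def sum_subtractf[symmetric] using that
    by (intro sum.cong) (auto simp: \<xi>'_def dev_def \<gamma>_def T_def)
  \<comment> \<open>Now the cutoff is removed. The integrable number of arrivals dominates all
    partial sums, and almost surely the sums are eventually constant.\<close>
  have "(\<lambda>K. expectation (\<lambda>\<omega>. \<bar>\<Sum>k\<in>{1..K}. \<xi>' k \<omega>\<bar>)) \<longlonglongrightarrow> expectation (\<lambda>\<omega>. \<bar>N \<omega> - S \<omega>\<bar>)"
  proof (rule integral_dominated_convergence[OF _ _ int])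
    show "AE \<omega> in M. (\<lambda>K. \<bar>\<Sum>k\<in>{1..K}. \<xi>' k \<omega>\<bar>) \<longlonglongrightarrow> \<bar>N \<omega> - S \<omega>\<bar>"
      using fin
    proof (rule AE_mp, intro AE_I2 impI)
      fix \<omega> assume \<omega>: "\<omega> \<in> space M" and fin: "finite (arrivals_in \<Gamma> \<omega> {0..<t})"
      define K0 where "K0 = Max (insert 0 (arrivals_in \<Gamma> \<omega> {0..<t}))"
      have "(\<Sum>k\<in>{1..K}. \<xi>' k \<omega>) = (\<Sum>k\<in>arrivals_in \<Gamma> \<omega> {0..<t}. \<xi>' k \<omega>)" if "K0 \<le> K" for K
      proof (rule sum.mono_neutral_right)
        show "arrivals_in \<Gamma> \<omega> {0..<t} \<subseteq> {1..K}"
        proof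
          fix k assume k: "k \<in> arrivals_in \<Gamma> \<omega> {0..<t}"
          then have "k \<le> K0" unfolding K0_def using fin by (intro Max_ge) auto
          with that k show "k \<in> {1..K}" by (auto simp: arrivals_in_def)
        qed
        show "\<forall>k\<in>{1..K} - arrivals_in \<Gamma> \<omega> {0..<t}. \<xi>' k \<omega> = 0"
          by (auto simp: \<xi>'_def T_def)
      qed simp
      then show "(\<lambda>K. \<bar>\<Sum>k\<in>{1..K}. \<xi>' k \<omega>\<bar>) \<longlonglongrightarrow> \<bar>N \<omega> - S \<omega>\<bar>"
        unfolding split_eq[OF \<omega>] by (intro tendsto_eventually eventually_sequentiallyI[of K0]) simp
    qed
    show "AE \<omega> in M. norm \<bar>\<Sum>k\<in>{1..K}. \<xi>' k \<omega>\<bar> \<le> real (card (arrivals_in \<Gamma> \<omega> {0..<t}))" for K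
      using fin
    proof (rule AE_mp, intro AE_I2 impI)
      fix \<omega> assume fin: "finite (arrivals_in \<Gamma> \<omega> {0..<t})"
      have "\<bar>\<Sum>k\<in>{1..K}. \<xi>' k \<omega>\<bar> \<le> (\<Sum>k\<in>{1..K}. indicator (T k) \<omega>)"
        by (intro order_trans[OF sum_abs] sum_mono \<xi>_bd)
      then show "norm \<bar>\<Sum>k\<in>{1..K}. \<xi>' k \<omega>\<bar> \<le> real (card (arrivals_in \<Gamma> \<omega> {0..<t}))"
        using card_bd[OF fin, of K] by simp
    qed
    have "(\<lambda>\<omega>. \<Sum>k\<in>arrivals_in \<Gamma> \<omega> {0..<t}. \<xi>' k \<omega>) \<in> borel_measurable M"
    proof (rule borel_measurable_sum_random_set)
      fix k show "(\<lambda>\<omega>. of_bool (k \<in> arrivals_in \<Gamma> \<omega> {0..<t}) * \<xi>' k \<omega>) \<in> borel_measurable M"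
      proof (cases "1 \<le> k")
        case False then show ?thesis by (simp add: arrivals_in_def)
      next
        case True
        have "Measurable.pred M (\<lambda>\<omega>. k \<in> arrivals_in \<Gamma> \<omega> {0..<t})"
          by (intro measurable_arrivals_in \<Gamma>M) auto
        then show ?thesis using \<xi>_meas(2)[OF True] by measurable
      qed
    qed (intro measurable_arrivals_in \<Gamma>M; simp)
    then show "(\<lambda>\<omega>. \<bar>N \<omega> - S \<omega>\<bar>) \<in> borel_measurable M"
      by (intro borel_measurable_abs) (simp cong: measurable_cong add: split_eq)
  qed simp
  then show ?thesis
    by (rule LIMSEQ_le_const2) (use bound' in auto)
qed

section \<open>Positivity of integrals, joint measurability, and service laws as a kernel\<close>

lemma integral_pos_on:
  fixes f :: "'a \<Rightarrow> real"
  assumes int: "integrable M f" and nn: "\<And>x. x \<in> space M \<Longrightarrow> 0 \<le> f x"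
    and A: "A \<in> sets M" "emeasure M A \<noteq> 0" and pos: "\<And>x. x \<in> A \<Longrightarrow> 0 < f x"
  shows "0 < integral\<^sup>L M f"
proof (rule ccontr)
  assume "\<not> 0 < integral\<^sup>L M f"
  then have "integral\<^sup>L M f = 0"
    using integral_nonneg_AE[of f M] nn by (auto simp: le_less)
  then have "AE x in M. f x = 0"
    using integral_nonneg_eq_0_iff_AE[OF int] nn by simp
  then have "AE x in M. x \<notin> A"
    using pos by (auto elim!: eventually_mono simp: less_irrefl) force
  then have "emeasure M A = 0"
    using A(1) AE_iff_null_sets by blast
  with A(2) show False ..
qed

text \<open>Sampling the first argument on a grid to the right of \<open>s\<close> involves only
  countably many sections of \<open>f\<close>, hence is jointly measurable; right-continuity makes
  the samples converge. This serves both the densities, in the arrival time, and the environment, in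
  time.\<close>

lemma borel_measurable_pair_right_continuous:
  fixes f :: "real \<Rightarrow> 'a \<Rightarrow> real"
  assumes f: "\<And>s. 0 < s \<Longrightarrow> f s \<in> borel_measurable N"
    and rc: "\<And>s x. 0 < s \<Longrightarrow> x \<in> space N \<Longrightarrow> ((\<lambda>u. f u x) \<longlongrightarrow> f s x) (at_right s)"
  shows "(\<lambda>p. indicator {0<..} (fst p) * f (fst p) (snd p)) \<in> borel_measurable (borel \<Otimes>\<^sub>M N)"
proof (rule borel_measurable_LIMSEQ_real)
  \<comment> \<open>The added \<open>1\<close> puts the grid point strictly beyond \<open>s\<close>,
    as convergence along \<open>at_right s\<close> demands, and keeps it positive, where the
    sections of \<open>f\<close> are known to be measurable.\<close>
  define u where "u n s = (real (nat \<lfloor>real (Suc n) * s\<rfloor>) + 1) / real (Suc n)" for n s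
  show "(\<lambda>n. indicator {0<..} (fst p) * f (u n (fst p)) (snd p))
      \<longlonglongrightarrow> indicator {0<..} (fst p) * f (fst p) (snd p)" if "p \<in> space (borel \<Otimes>\<^sub>M N)" for p
  proof (cases "0 < fst p")
    case True
    define s where "s = fst p"
    have s: "0 < s" using True by (simp add: s_def)
    have gt: "s < u n s" for n
    proof -
      have "real (Suc n) * s < real (nat \<lfloor>real (Suc n) * s\<rfloor>) + 1"
        using s by (simp add: of_nat_nat del: of_nat_Suc)
      then show ?thesis by (simp add: u_def pos_less_divide_eq mult.commute del: of_nat_Suc)
    qed
    have "(\<lambda>n. real (nat \<lfloor>real (Suc n) * s\<rfloor>) / real (Suc n) + 1 / real (Suc n)) \<longlonglongrightarrow> s + 0"
      using s by (intro tendsto_add scaled_floor_approx(2) LIMSEQ_Suc[OF lim_const_over_n]) simp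
    then have "(\<lambda>n. u n s) \<longlonglongrightarrow> s"
      by (simp add: u_def add_divide_distrib del: of_nat_Suc)
    then have "filterlim (\<lambda>n. u n s) (at_right s) sequentially"
      using gt less_imp_neq[OF gt] by (simp add: filterlim_at eq_commute[of _ s])
    then have "(\<lambda>n. f (u n s) (snd p)) \<longlonglongrightarrow> f s (snd p)"
      using that s by (intro filterlim_compose[OF rc]) (auto simp: space_pair_measure)
    then show ?thesis by (intro tendsto_mult tendsto_const) (simp add: s_def)
  qed simp
  fix n
  have "(\<lambda>p. f ((real i + 1) / real (Suc n)) (snd p)) \<in> borel_measurable (borel \<Otimes>\<^sub>M N)" for i :: nat
    by (intro measurable_compose[OF measurable_snd f]) simp
  then have *: "(\<lambda>p. f ((real (nat \<lfloor>real (Suc n) * fst p\<rfloor>) + 1) / real (Suc n)) (snd p)) \<in> borel_measurable (borel \<Otimes>\<^sub>M N)"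
    by (rule measurable_compose_countable) measurable
  show "(\<lambda>p. indicator {0<..} (fst p) * f (u n (fst p)) (snd p)) \<in> borel_measurable (borel \<Otimes>\<^sub>M N)"
    unfolding u_def by (rule borel_measurable_times[OF _ *]) measurable
qed

text \<open>
  The densities are only measurable in \<open>r\<close> separately; joint measurability comes from continuity in \<open>s\<close>.
\<close>

lemma service_law_kernel:
  assumes meas: "\<And>s. 0 \<le> s \<Longrightarrow> l s \<in> borel_measurable borel"
    and prob: "\<And>s. 0 \<le> s \<Longrightarrow> prob_space (service_law l s)"
    and cont: "\<And>s r. 0 < s \<Longrightarrow> 0 < r \<Longrightarrow> isCont (\<lambda>u. l u r) s"
  shows "(\<lambda>s. service_law l (max 0 s)) \<in> borel \<rightarrow>\<^sub>M prob_algebra borel"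
proof (rule measurable_prob_algebraI)
  show "prob_space (service_law l (max 0 s))" for s by (rule prob) simp
  show "(\<lambda>s. service_law l (max 0 s)) \<in> borel \<rightarrow>\<^sub>M subprob_algebra borel"
  proof (rule measurable_subprob_algebra)
    show "subprob_space (service_law l (max 0 s))" for s
      by (intro prob_space_imp_subprob_space prob) simp
    show "sets (service_law l (max 0 s)) = sets borel" for s
      by (simp add: service_law_def)
    fix A :: "real set" assume A[measurable]: "A \<in> sets borel"
    \<comment> \<open>The strict indicators keep \<open>F\<close> where continuity in the arrival
      time is available, at positive \<open>s\<close> and \<open>r\<close>. The point
      \<open>r = 0\<close> is Lebesgue-null, and all \<open>s \<le> 0\<close> share the law at
      \<open>0\<close>, which enters as a constant.\<close>
    define F where "F p = indicator {0<..} (fst p) * (indicator {0<..} (snd p) * l (fst p) (snd p))" for p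
    have F: "F \<in> borel_measurable (borel \<Otimes>\<^sub>M borel)"
      unfolding F_def
    proof (rule borel_measurable_pair_right_continuous)
      fix s r :: real assume s: "0 < s"
      have [measurable]: "l s \<in> borel_measurable borel" using meas s by simp
      show "(\<lambda>r. indicator {0<..} r * l s r) \<in> borel_measurable borel" by measurable
      show "((\<lambda>u. indicator {0<..} r * l u r) \<longlongrightarrow> indicator {0<..} r * l s r) (at_right s)"
        using cont[OF s, of r] by (cases "0 < r") (auto simp: isCont_def intro: tendsto_mono[OF at_le])
    qed
    have "emeasure (service_law l (max 0 s)) A = (if 0 < s then \<integral>\<^sup>+ r. ennreal (F (s, r)) * indicator A r \<partial>lborel
        else emeasure (service_law l 0) A)" for s
    proof (cases "0 < s")
      case True
      have [measurable]: "l s \<in> borel_measurable borel" using meas True by simp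
      have "emeasure (service_law l s) A = (\<integral>\<^sup>+ r. ennreal (indicator {0..} r * l s r) * indicator A r \<partial>lborel)"
        unfolding service_law_def by (intro emeasure_density) simp_all
      also have "\<dots> = (\<integral>\<^sup>+ r. ennreal (F (s, r)) * indicator A r \<partial>lborel)"
      proof (rule nn_integral_cong_AE)
        show "AE r in lborel. ennreal (indicator {0..} r * l s r) * indicator A r = ennreal (F (s, r)) * indicator A r"
          using AE_lborel_singleton[of "0::real"] by eventually_elim (use True in \<open>auto simp: F_def indicator_def\<close>)
      qed
      finally show ?thesis using True by simp
    qed simp
    moreover have "(\<lambda>s. \<integral>\<^sup>+ r. ennreal (F (s, r)) * indicator A r \<partial>lborel) \<in> borel_measurable borel"
      using F by (intro lborel.borel_measurable_nn_integral) (simp add: case_prod_beta', measurable)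
    ultimately show "(\<lambda>s. emeasure (service_law l (max 0 s)) A) \<in> borel_measurable borel"
      by simp
  qed
qed

text \<open>An active job departs strictly after \<open>t\<close>, while \<open>service_tail\<close>
  integrates over the closed ray; the endpoint is Lebesgue-null.\<close>

lemma measure_service_law_greaterThan:
  assumes meas: "l s \<in> borel_measurable borel" and nn: "\<And>r. 0 \<le> r \<Longrightarrow> 0 \<le> l s r" and r: "0 \<le> r"
  shows "measure (service_law l s) {r<..} = service_tail l s r"
proof -
  have "measure (service_law l s) {r<..} = integral\<^sup>L (service_law l s) (indicator {r<..})"
    by (simp add: service_law_def)
  also have "\<dots> = (LINT x|lborel. (indicator {0..} x * l s x) *\<^sub>R indicator {r<..} x)"
    unfolding service_law_def using meas nn
    by (intro integral_density) (auto simp: indicator_def)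
  also have "\<dots> = (LINT x|lborel. indicator {r..} x *\<^sub>R l s x)"
    using AE_lborel_singleton[of r] meas r
    by (intro integral_cong_AE) (auto elim!: eventually_mono simp: indicator_def)
  finally show ?thesis by (simp add: service_tail_def set_lebesgue_integral_def)
qed

text \<open>Arrival times are nonnegative, so the values of the kernel at negative times are never
  seen. This permits a kernel that is measurable on the whole line.\<close>

lemma cond_service_times_max:
  assumes serv: "cond_service_times M G \<Gamma> \<nu> L"
    and nn: "\<And>k \<omega>. 1 \<le> k \<Longrightarrow> \<omega> \<in> space M \<Longrightarrow> 0 \<le> \<Gamma> k \<omega>"
  shows "cond_service_times M G \<Gamma> (\<lambda>s. \<nu> (max 0 s)) L"
  unfolding cond_service_times_def
proof (intro conjI allI impI)
  show "1 \<le> k \<Longrightarrow> L k \<in> borel_measurable M" for k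
    using serv by (simp add: cond_service_times_def)
  fix I :: "nat set" and A :: "nat \<Rightarrow> real set"
  assume I: "finite I \<and> I \<subseteq> {1..} \<and> (\<forall>k\<in>I. A k \<in> sets borel)"
  have "AE \<omega> in M. (\<forall>k\<in>I. \<Gamma> k \<omega> < \<infinity>) \<longrightarrow>
           cprob M G {\<omega>'\<in>space M. \<forall>k\<in>I. L k \<omega>' \<in> A k} \<omega>
             = (\<Prod>k\<in>I. measure (\<nu> (real_of_ereal (\<Gamma> k \<omega>))) (A k))"
    using serv I unfolding cond_service_times_def by blast
  then show "AE \<omega> in M. (\<forall>k\<in>I. \<Gamma> k \<omega> < \<infinity>) \<longrightarrow>
           cprob M G {\<omega>'\<in>space M. \<forall>k\<in>I. L k \<omega>' \<in> A k} \<omega>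
             = (\<Prod>k\<in>I. measure (\<nu> (max 0 (real_of_ereal (\<Gamma> k \<omega>)))) (A k))"
  proof (rule AE_mp, intro AE_I2 impI)
    fix \<omega> assume \<omega>: "\<omega> \<in> space M" "\<forall>k\<in>I. \<Gamma> k \<omega> < \<infinity>"
      and eq: "(\<forall>k\<in>I. \<Gamma> k \<omega> < \<infinity>) \<longrightarrow>
           cprob M G {\<omega>'\<in>space M. \<forall>k\<in>I. L k \<omega>' \<in> A k} \<omega>
             = (\<Prod>k\<in>I. measure (\<nu> (real_of_ereal (\<Gamma> k \<omega>))) (A k))"
    have "max 0 (real_of_ereal (\<Gamma> k \<omega>)) = real_of_ereal (\<Gamma> k \<omega>)" if "k \<in> I" for k
      using nn[of k \<omega>] that I \<omega>(1) by (auto intro!: max_absorb2 real_of_ereal_pos)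
    then show "cprob M G {\<omega>'\<in>space M. \<forall>k\<in>I. L k \<omega>' \<in> A k} \<omega>
             = (\<Prod>k\<in>I. measure (\<nu> (max 0 (real_of_ereal (\<Gamma> k \<omega>)))) (A k))"
      using eq \<omega>(2) by (simp cong: prod.cong)
  qed
qed

section \<open>Ergodic averages with integrable weights\<close>

text \<open>\<open>J_bd\<close> controls the weighted average by the L1 norm of the weight,
  uniformly in \<epsilon>. Hence the weights that average out, those with \<open>\<Phi>\<close>, are
  closed under sums, multiples and dominated limits. The ergodic hypothesis supplies the intervals
  \<open>{0..u}\<close>, a Dynkin argument the Borel subsets of \<open>{0..t}\<close>, and
  approximation by simple functions the rest.\<close>

lemma (in prob_space) ergodic_weighted_average:
  fixes X :: "real \<Rightarrow> 'a \<Rightarrow> real"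
  assumes X[measurable]: "(\<lambda>p. X (snd p) (fst p)) \<in> borel_measurable (M \<Otimes>\<^sub>M borel)"
    and X_bd: "\<And>s \<omega>. \<bar>X s \<omega>\<bar> \<le> B"
    and erg: "((\<lambda>T. expectation (\<lambda>\<omega>. \<bar>1 / T * (LINT r:{0..T}|lborel. X r \<omega>) - \<kappa>\<bar>)) \<longlongrightarrow> 0) at_top"
    and t: "0 < t" and g: "integrable lborel g"
  shows "((\<lambda>\<epsilon>. expectation (\<lambda>\<omega>. \<bar>(LINT s:{0..t}|lborel. g s * (X (s / \<epsilon>) \<omega> - \<kappa>))\<bar>)) \<longlongrightarrow> 0) (at_right 0)"
proof -
  define b where "b = B + \<bar>\<kappa>\<bar>"
  define W where "W \<epsilon> s \<omega> = indicator {0..t} s * (X (s / \<epsilon>) \<omega> - \<kappa>)" for \<epsilon> s \<omega>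
  have b: "0 \<le> b" using order_trans[OF abs_ge_zero X_bd] by (simp add: b_def)
  have W_bd: "\<bar>W \<epsilon> s \<omega>\<bar> \<le> b" for \<epsilon> s \<omega>
    using X_bd[of "s / \<epsilon>" \<omega>] b by (auto simp: W_def b_def indicator_def)
  have W_meas: "(\<lambda>p. W \<epsilon> (snd p) (fst p)) \<in> borel_measurable (M \<Otimes>\<^sub>M borel)" for \<epsilon>
  proof -
    have "(\<lambda>p. (fst p, snd p / \<epsilon>)) \<in> M \<Otimes>\<^sub>M borel \<rightarrow>\<^sub>M M \<Otimes>\<^sub>M borel"
      by measurable
    from measurable_compose[OF this X] show ?thesis
      unfolding W_def by (intro borel_measurable_times borel_measurable_diff) (simp_all, measurable)
  qed
  have W_sec[measurable]: "(\<lambda>s. W \<epsilon> s \<omega>) \<in> borel_measurable borel" if "\<omega> \<in> space M" for \<epsilon> \<omega>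
    using measurable_Pair2[OF W_meas that] by simp
  define J where "J f \<epsilon> \<omega> = (LINT s|lborel. f s * W \<epsilon> s \<omega>)" for f \<epsilon> \<omega>
  define \<Phi> where "\<Phi> f \<longleftrightarrow> ((\<lambda>\<epsilon>. expectation (\<lambda>\<omega>. \<bar>J f \<epsilon> \<omega>\<bar>)) \<longlongrightarrow> 0) (at_right 0)" for f
  have J_int: "integrable lborel (\<lambda>s. f s * W \<epsilon> s \<omega>)" if f: "integrable lborel f" and \<omega>: "\<omega> \<in> space M" for f \<epsilon> \<omega>
  proof (rule Bochner_Integration.integrable_bound)
    show "integrable lborel (\<lambda>s. b * f s)" using f by simp
    show "(\<lambda>s. f s * W \<epsilon> s \<omega>) \<in> borel_measurable lborel"
      using borel_measurable_integrable[OF f] W_sec[OF \<omega>] by measurable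
    show "AE s in lborel. norm (f s * W \<epsilon> s \<omega>) \<le> norm (b * f s)"
      using mult_left_mono[OF W_bd abs_ge_zero] b by (simp add: abs_mult mult.commute)
  qed
  have J_bd: "\<bar>J f \<epsilon> \<omega>\<bar> \<le> b * (LINT s|lborel. \<bar>f s\<bar>)" if f: "integrable lborel f" and \<omega>: "\<omega> \<in> space M" for f \<epsilon> \<omega>
  proof -
    have "\<bar>J f \<epsilon> \<omega>\<bar> \<le> (LINT s|lborel. b * \<bar>f s\<bar>)"
      unfolding J_def using J_int[OF f \<omega>] f mult_left_mono[OF W_bd abs_ge_zero]
      by (intro integral_abs_bound_integral) (auto simp: abs_mult mult.commute)
    then show ?thesis by simp
  qed
  have J_meas: "J f \<epsilon> \<in> borel_measurable M" if f: "integrable lborel f" for f \<epsilon>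
  proof -
    have [measurable]: "f \<in> borel_measurable borel" using borel_measurable_integrable[OF f] by simp
    have "(\<lambda>p. f (snd p) * W \<epsilon> (snd p) (fst p)) \<in> borel_measurable (M \<Otimes>\<^sub>M lborel)"
      using W_meas[of \<epsilon>] by measurable
    then show ?thesis
      unfolding J_def by (intro lborel.borel_measurable_lebesgue_integral) (simp add: case_prod_beta')
  qed
  have J_integrable: "integrable M (\<lambda>\<omega>. \<bar>J f \<epsilon> \<omega>\<bar>)" if f: "integrable lborel f" for f \<epsilon>
    using J_bd[OF f] J_meas[OF f]
    by (intro integrable_abs integrable_const_bound[where B = "b * (LINT s|lborel. \<bar>f s\<bar>)"]) auto
  have J_add: "J (\<lambda>s. f s + h s) \<epsilon> \<omega> = J f \<epsilon> \<omega> + J h \<epsilon> \<omega>"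
    if "integrable lborel f" "integrable lborel h" "\<omega> \<in> space M" for f h \<epsilon> \<omega>
    unfolding J_def using that by (simp add: distrib_right J_int)
  have \<Phi>_add: "\<Phi> (\<lambda>s. f s + h s)" if f: "integrable lborel f" "integrable lborel h" and \<Phi>: "\<Phi> f" "\<Phi> h" for f h
    unfolding \<Phi>_def
  proof (rule Lim_null_comparison)
    show "((\<lambda>\<epsilon>. expectation (\<lambda>\<omega>. \<bar>J f \<epsilon> \<omega>\<bar>) + expectation (\<lambda>\<omega>. \<bar>J h \<epsilon> \<omega>\<bar>)) \<longlongrightarrow> 0) (at_right 0)"
      using tendsto_add[OF \<Phi>[unfolded \<Phi>_def]] by simp
    have "expectation (\<lambda>\<omega>. \<bar>J (\<lambda>s. f s + h s) \<epsilon> \<omega>\<bar>) \<le> expectation (\<lambda>\<omega>. \<bar>J f \<epsilon> \<omega>\<bar> + \<bar>J h \<epsilon> \<omega>\<bar>)" for \<epsilon>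
      using f by (intro integral_mono) (auto simp: J_integrable J_add)
    then show "\<forall>\<^sub>F \<epsilon> in at_right 0. norm (expectation (\<lambda>\<omega>. \<bar>J (\<lambda>s. f s + h s) \<epsilon> \<omega>\<bar>))
        \<le> expectation (\<lambda>\<omega>. \<bar>J f \<epsilon> \<omega>\<bar>) + expectation (\<lambda>\<omega>. \<bar>J h \<epsilon> \<omega>\<bar>)"
      using f by (intro always_eventually) (simp add: J_integrable)
  qed
  have \<Phi>_cmult: "\<Phi> (\<lambda>s. c * f s)" if "\<Phi> f" for c f
  proof -
    have "J (\<lambda>s. c * f s) \<epsilon> \<omega> = c * J f \<epsilon> \<omega>" for \<epsilon> \<omega>
      unfolding J_def mult.assoc by simp
    then show ?thesis
      using tendsto_mult_right_zero[OF that[unfolded \<Phi>_def], of "\<bar>c\<bar>"] by (simp add: \<Phi>_def abs_mult)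
  qed
  \<comment> \<open>\<open>W\<close> vanishes outside \<open>{0..t}\<close>, so only the values of
    the weight there matter.\<close>
  have \<Phi>_cong: "\<Phi> f \<longleftrightarrow> \<Phi> h" if "\<And>s. 0 \<le> s \<Longrightarrow> s \<le> t \<Longrightarrow> f s = h s" for f h
  proof -
    have "f s * W \<epsilon> s \<omega> = h s * W \<epsilon> s \<omega>" for s \<epsilon> \<omega>
      using that by (auto simp: W_def indicator_def)
    then show ?thesis by (simp only: \<Phi>_def J_def)
  qed
  \<comment> \<open>A single \<open>q i\<close> close to \<open>f\<close> in L1 is chosen before
    \<epsilon> tends to \<open>0\<close>; this order works because \<open>J_bd\<close> bounds the
    cost of the replacement by the same number for all \<epsilon>.\<close>
  have \<Phi>_lim: "\<Phi> f" if q: "\<And>i. integrable lborel (q i)" "\<And>i. \<Phi> (q i)" and lim: "\<And>s. (\<lambda>i. q i s) \<longlonglongrightarrow> f s"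
    and w: "integrable lborel w" "\<And>i s. \<bar>q i s\<bar> \<le> w s" and f: "integrable lborel f" for q f and w :: "real \<Rightarrow> real"
  proof -
    have [measurable]: "f \<in> borel_measurable borel" "q i \<in> borel_measurable borel" for i
      using borel_measurable_integrable[OF f] borel_measurable_integrable[OF q(1)] by auto
    have "(\<lambda>i. LINT s|lborel. \<bar>f s - q i s\<bar>) \<longlonglongrightarrow> (LINT s|(lborel :: real measure). \<bar>0\<bar>)"
    proof (rule integral_dominated_convergence)
      show "integrable lborel (\<lambda>s. \<bar>f s\<bar> + w s)" using f w by simp
      show "AE s in lborel. (\<lambda>i. \<bar>f s - q i s\<bar>) \<longlonglongrightarrow> \<bar>0\<bar>"
      proof (rule AE_I2)
        fix s show "(\<lambda>i. \<bar>f s - q i s\<bar>) \<longlonglongrightarrow> \<bar>0\<bar>"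
          using tendsto_rabs[OF tendsto_diff[OF tendsto_const[of "f s"] lim[of s]]] by simp
      qed
      show "AE s in lborel. norm \<bar>f s - q i s\<bar> \<le> \<bar>f s\<bar> + w s" for i
        using w(2)[of i] by (intro AE_I2) (smt (verit, best) real_norm_def)
    qed auto
    then have lim0: "(\<lambda>i. b * (LINT s|lborel. \<bar>f s - q i s\<bar>)) \<longlonglongrightarrow> 0"
      by (intro tendsto_mult_right_zero) simp
    show ?thesis unfolding \<Phi>_def
    proof (rule tendstoI)
      fix e :: real assume e: "0 < e"
      obtain i where i: "b * (LINT s|lborel. \<bar>f s - q i s\<bar>) < e / 2"
        using order_tendstoD(2)[OF lim0, of "e / 2"] e by (auto simp: eventually_sequentially)
      have le: "expectation (\<lambda>\<omega>. \<bar>J f \<epsilon> \<omega>\<bar>) \<le> expectation (\<lambda>\<omega>. \<bar>J (q i) \<epsilon> \<omega>\<bar>) + b * (LINT s|lborel. \<bar>f s - q i s\<bar>)" for \<epsilon>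
      proof -
        have fq: "integrable lborel (\<lambda>s. f s - q i s)" using f q by simp
        have "\<bar>J f \<epsilon> \<omega>\<bar> \<le> \<bar>J (q i) \<epsilon> \<omega>\<bar> + b * (LINT s|lborel. \<bar>f s - q i s\<bar>)" if "\<omega> \<in> space M" for \<omega>
          using J_add[OF q(1)[of i] fq that, of \<epsilon>] J_bd[OF fq that, of \<epsilon>] by simp
        then have "expectation (\<lambda>\<omega>. \<bar>J f \<epsilon> \<omega>\<bar>) \<le> expectation (\<lambda>\<omega>. \<bar>J (q i) \<epsilon> \<omega>\<bar> + b * (LINT s|lborel. \<bar>f s - q i s\<bar>))"
          using J_integrable[OF f] J_integrable[OF q(1)]
          by (intro integral_mono Bochner_Integration.integrable_add integrable_const)
        then show ?thesis
          using J_integrable[OF q(1)] by (simp add: prob_space)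
      qed
      have "\<forall>\<^sub>F \<epsilon> in at_right 0. expectation (\<lambda>\<omega>. \<bar>J (q i) \<epsilon> \<omega>\<bar>) < e / 2"
        using order_tendstoD(2)[OF q(2)[of i, unfolded \<Phi>_def], of "e / 2"] e by simp
      then show "\<forall>\<^sub>F \<epsilon> in at_right 0. dist (expectation (\<lambda>\<omega>. \<bar>J f \<epsilon> \<omega>\<bar>)) 0 < e"
      proof (rule eventually_mono)
        fix \<epsilon> assume "expectation (\<lambda>\<omega>. \<bar>J (q i) \<epsilon> \<omega>\<bar>) < e / 2"
        then show "dist (expectation (\<lambda>\<omega>. \<bar>J f \<epsilon> \<omega>\<bar>)) 0 < e"
          using le[of \<epsilon>] i by (simp add: dist_real_def)
      qed
    qed
  qed
  \<comment> \<open>Substituting \<open>s = \<epsilon> * r\<close> stretches \<open>{0..u}\<close>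
    to \<open>{0..u / \<epsilon>}\<close>, so \<open>J\<close> is \<open>u\<close> times the centred
    time average over a window whose length tends to infinity.\<close>
  have \<Phi>_interval: "\<Phi> (indicator {0..u})" if u: "0 < u" "u \<le> t" for u
  proof -
    have "J (indicator {0..u}) \<epsilon> \<omega> = u * (1 / (u / \<epsilon>) * (LINT r:{0..u / \<epsilon>}|lborel. X r \<omega>) - \<kappa>)"
      if \<epsilon>: "0 < \<epsilon>" and \<omega>: "\<omega> \<in> space M" for \<epsilon> \<omega>
    proof -
      have X_sec: "(\<lambda>r. X r \<omega>) \<in> borel_measurable borel"
        using measurable_Pair2[OF X \<omega>] by simp
      have Icc_int: "integrable lborel (indicator {0..u / \<epsilon>} :: real \<Rightarrow> real)"
        by (intro integrable_real_indicator) (auto simp: emeasure_lborel_Icc_eq)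
      have X_int: "integrable lborel (\<lambda>r. indicator {0..u / \<epsilon>} r * X r \<omega>)"
      proof (rule Bochner_Integration.integrable_bound)
        show "integrable lborel (\<lambda>r. indicator {0..u / \<epsilon>} r * B)" using Icc_int by simp
        show "(\<lambda>r. indicator {0..u / \<epsilon>} r * X r \<omega>) \<in> borel_measurable lborel" using X_sec by measurable
      qed (use X_bd order_trans[OF abs_ge_zero X_bd] in \<open>auto simp: indicator_def\<close>)
      have "J (indicator {0..u}) \<epsilon> \<omega> = (LINT s|lborel. indicator {0..u} s * (X (s / \<epsilon>) \<omega> - \<kappa>))"
        unfolding J_def W_def using u by (intro Bochner_Integration.integral_cong) (auto simp: indicator_def)
      also have "\<dots> = \<epsilon> * (LINT r|lborel. indicator {0..u} (\<epsilon> * r) * (X (\<epsilon> * r / \<epsilon>) \<omega> - \<kappa>))"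
        using lborel_integral_real_affine[of \<epsilon> "\<lambda>s. indicator {0..u} s * (X (s / \<epsilon>) \<omega> - \<kappa>)" 0] \<epsilon> by simp
      also have "(LINT r|lborel. indicator {0..u} (\<epsilon> * r) * (X (\<epsilon> * r / \<epsilon>) \<omega> - \<kappa>))
          = (LINT r|lborel. indicator {0..u / \<epsilon>} r * X r \<omega> - indicator {0..u / \<epsilon>} r * \<kappa>)"
        using \<epsilon> by (intro Bochner_Integration.integral_cong)
          (auto simp: indicator_def pos_le_divide_eq mult.commute zero_le_mult_iff)
      also have "\<dots> = (LINT r|lborel. indicator {0..u / \<epsilon>} r * X r \<omega>) - u / \<epsilon> * \<kappa>"
        using X_int Icc_int u \<epsilon> by (subst Bochner_Integration.integral_diff) auto
      finally show ?thesis
        using \<epsilon> u by (simp add: set_lebesgue_integral_def right_diff_distrib)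
    qed
    then have "\<forall>\<^sub>F \<epsilon> in at_right 0. expectation (\<lambda>\<omega>. \<bar>J (indicator {0..u}) \<epsilon> \<omega>\<bar>)
        = u * expectation (\<lambda>\<omega>. \<bar>1 / (u / \<epsilon>) * (LINT r:{0..u / \<epsilon>}|lborel. X r \<omega>) - \<kappa>\<bar>)"
      using u by (auto intro!: eventually_at_rightI[of 0 1] simp: abs_mult cong: Bochner_Integration.integral_cong)
    moreover have "filterlim (\<lambda>\<epsilon>. u / \<epsilon>) at_top (at_right 0)"
      using u filterlim_tendsto_pos_mult_at_top[OF tendsto_const u(1) filterlim_inverse_at_top_right]
      by (simp add: divide_inverse)
    then have "((\<lambda>\<epsilon>. u * expectation (\<lambda>\<omega>. \<bar>1 / (u / \<epsilon>) * (LINT r:{0..u / \<epsilon>}|lborel. X r \<omega>) - \<kappa>\<bar>)) \<longlongrightarrow> 0) (at_right 0)"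
      by (intro tendsto_mult_right_zero filterlim_compose[OF erg])
    ultimately show ?thesis
      unfolding \<Phi>_def by (simp add: tendsto_cong)
  qed
  have ind_int: "integrable lborel (indicator (A \<inter> {0..t}) :: real \<Rightarrow> real)" if A: "A \<in> sets borel" for A
  proof -
    have "emeasure lborel (A \<inter> {0..t}) \<le> emeasure lborel {0..t}"
      using A by (intro emeasure_mono) auto
    then have "emeasure lborel (A \<inter> {0..t}) < \<infinity>"
      using t by (simp add: le_less_trans)
    then show ?thesis using A by simp
  qed
  have \<Phi>_set: "\<Phi> (indicator (A \<inter> {0..t}))" if "A \<in> sets borel" for A
  proof -
    \<comment> \<open>The rays \<open>{..a}\<close> form an intersection-stable generator. Cut down
      to \<open>{0..t}\<close> they are intervals starting at \<open>0\<close>, as the ergodic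
      hypothesis requires, or null sets.\<close>
    have sets_eq: "sets (borel :: real measure) = sigma_sets UNIV (range (\<lambda>a. {..a}))"
      by (subst borel_eq_atMost) simp
    have "Int_stable (range (\<lambda>a::real. {..a}))"
      by (auto simp: Int_stable_def)
    moreover have "range (\<lambda>a::real. {..a}) \<subseteq> Pow UNIV" by simp
    ultimately show ?thesis using that[unfolded sets_eq]
    proof (induction rule: sigma_sets_induct_disjoint)
      case (basic A)
      then obtain a where A: "A = {..a}" by auto
      show ?case
      proof (cases "0 < a")
        case True
        have "A \<inter> {0..t} = {0..min a t}" by (auto simp: A)
        then show ?thesis using \<Phi>_interval[of "min a t"] True t by simp
      next
        case False
        have "J (indicator (A \<inter> {0..t})) \<epsilon> \<omega> = 0" for \<epsilon> \<omega>
          unfolding J_def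
        proof (rule integral_eq_zero_AE)
          show "AE s in lborel. indicator (A \<inter> {0..t}) s * W \<epsilon> s \<omega> = 0"
            using AE_lborel_singleton[of "0::real"] by eventually_elim (use False in \<open>auto simp: A indicator_def\<close>)
        qed
        then show ?thesis by (simp add: \<Phi>_def)
      qed
    next
      case empty
      show ?case by (simp add: \<Phi>_def J_def)
    next
      case (compl A)
      have A: "A \<in> sets borel" using compl(1) by (simp add: sets_eq)
      have "\<Phi> (\<lambda>s. indicator (UNIV \<inter> {0..t}) s + (- 1) * indicator (A \<inter> {0..t}) s)"
        using compl(2) \<Phi>_interval[OF t order_refl] ind_int[OF A] ind_int[of UNIV]
        by (intro \<Phi>_add \<Phi>_cmult) auto
      then show ?case
        by (subst \<Phi>_cong) (auto simp: indicator_def)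
    next
      case (union A)
      have A: "A i \<in> sets borel" for i using union(2) by (auto simp: sets_eq)
      \<comment> \<open>Disjointness turns the indicator of a finite union into a sum, so additivity
        applies. The countable union is then a pointwise limit dominated by the indicator of
        \<open>{0..t}\<close>.\<close>
      have fin: "\<Phi> (indicator ((\<Union>i<n. A i) \<inter> {0..t}))" for n :: nat
      proof (induction n)
        case 0 show ?case by (simp add: \<Phi>_def J_def)
      next
        case (Suc n)
        have "\<Phi> (\<lambda>s. indicator ((\<Union>i<n. A i) \<inter> {0..t}) s + indicator (A n \<inter> {0..t}) s)"
          using Suc union(3) A by (intro \<Phi>_add ind_int) auto
        moreover have "s \<notin> A n" if "s \<in> A i" "i < n" for s i
          using disjoint_family_onD[OF union(1), of i n] that by auto
        ultimately show ?case
          by (subst \<Phi>_cong) (auto simp: indicator_def less_Suc_eq)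
      qed
      show ?case
      proof (rule \<Phi>_lim[OF _ fin])
        show "(\<lambda>n. indicator ((\<Union>i<n. A i) \<inter> {0..t}) s) \<longlonglongrightarrow> (indicator (\<Union> (range A) \<inter> {0..t}) s :: real)" for s
        proof (cases "s \<in> \<Union> (range A)")
          case True
          then obtain i where "s \<in> A i" by auto
          then show ?thesis
            by (intro tendsto_eventually eventually_sequentiallyI[of "Suc i"]) (auto simp: indicator_def)
        qed (simp add: indicator_def)
        show "integrable lborel (indicator (UNIV \<inter> {0..t}) :: real \<Rightarrow> real)" by (intro ind_int) simp
        show "\<bar>indicator ((\<Union>i<n. A i) \<inter> {0..t}) s\<bar> \<le> (indicator (UNIV \<inter> {0..t}) s :: real)" for n s
          by (auto simp: indicator_def)
      qed (use A in \<open>auto intro!: ind_int\<close>)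
    qed
  qed
  have "\<Phi> g" using g
  proof (induction rule: integrable_induct)
    case (base A c)
    have "\<Phi> (\<lambda>s. c * indicator (A \<inter> {0..t}) s)"
      using base by (intro \<Phi>_cmult \<Phi>_set) auto
    then show ?case by (subst \<Phi>_cong) (auto simp: indicator_def)
  next
    case (add f g) then show ?case by (intro \<Phi>_add)
  next
    case (lim f s)
    \<comment> \<open>The factor \<open>2\<close> is the bound that the induction rule guarantees
      for its simple approximants.\<close>
    show ?case
      using lim by (intro \<Phi>_lim[of s f "\<lambda>x. 2 * \<bar>f x\<bar>"]) auto
  qed
  then show ?thesis
    by (simp add: \<Phi>_def J_def W_def set_lebesgue_integral_def mult.left_commute)
qed

section \<open>Active jobs\<close>

text \<open>
  This holds also when infinitely many jobs are active: then both sides are \<open>0\<close>.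
\<close>

lemma active_jobs_eq_card:
  "active_jobs \<Gamma> L t \<omega> = real (card {k. 1 \<le> k \<and> \<Gamma> k \<omega> < ereal t \<and> ereal t < \<Gamma> k \<omega> + ereal (L k \<omega>)})"
    (is "_ = real (card ?A)")
proof -
  have "active_jobs \<Gamma> L t \<omega> = infsum (\<lambda>_. 1) ?A"
    unfolding active_jobs_def by (rule infsum_cong_neutral) auto
  also have "\<dots> = real (card ?A)"
  proof (cases "finite ?A")
    case False
    then show ?thesis
      using infsum_not_exists[OF infsum_diverge_constant[of ?A "1::real"]] by simp
  qed simp
  finally show ?thesis .
qed

text \<open>Every active job arrived in \<open>{0..<t}\<close>: the value \<open>\<infinity>\<close>
  is never below \<open>t\<close>, and nothing arrives before \<open>0\<close>. The strict
  inequality for the departure produces the open rays used throughout.\<close>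

lemma active_jobs_eq_sum:
  assumes nn: "\<And>k. 1 \<le> k \<Longrightarrow> 0 \<le> \<Gamma> k \<omega>" and fin: "finite (arrivals_in \<Gamma> \<omega> {0..<t})"
  shows "active_jobs \<Gamma> L t \<omega>
    = (\<Sum>k\<in>arrivals_in \<Gamma> \<omega> {0..<t}. indicator {t - real_of_ereal (\<Gamma> k \<omega>)<..} (L k \<omega>))"
proof -
  have eq: "{k. 1 \<le> k \<and> \<Gamma> k \<omega> < ereal t \<and> ereal t < \<Gamma> k \<omega> + ereal (L k \<omega>)}
      = {k\<in>arrivals_in \<Gamma> \<omega> {0..<t}. t - real_of_ereal (\<Gamma> k \<omega>) < L k \<omega>}"
  proof (rule set_eqI)
    fix k
    show "k \<in> {k. 1 \<le> k \<and> \<Gamma> k \<omega> < ereal t \<and> ereal t < \<Gamma> k \<omega> + ereal (L k \<omega>)}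
      \<longleftrightarrow> k \<in> {k\<in>arrivals_in \<Gamma> \<omega> {0..<t}. t - real_of_ereal (\<Gamma> k \<omega>) < L k \<omega>}"
      using nn[of k] by (cases "\<Gamma> k \<omega>") (auto simp: arrivals_in_def)
  qed
  show ?thesis
    unfolding active_jobs_eq_card eq using fin
    by (simp add: indicator_def sum.If_cases Int_def)
qed

lemma borel_measurable_active_jobs:
  assumes "\<And>k. 1 \<le> k \<Longrightarrow> \<Gamma> k \<in> borel_measurable M" "\<And>k. 1 \<le> k \<Longrightarrow> L k \<in> borel_measurable M"
  shows "active_jobs \<Gamma> L t \<in> borel_measurable M"
proof -
  have pred: "Measurable.pred M (\<lambda>\<omega>. g \<omega> < ereal t \<and> ereal t < g \<omega> + ereal (h \<omega>))"
    if [measurable]: "g \<in> borel_measurable M" "h \<in> borel_measurable M" for g h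
    by measurable
  have "{\<omega>\<in>space M. k \<in> {k. 1 \<le> k \<and> \<Gamma> k \<omega> < ereal t \<and> ereal t < \<Gamma> k \<omega> + ereal (L k \<omega>)}} \<in> sets M" for k
  proof (cases "1 \<le> k")
    case True
    show ?thesis using pred[OF assms, OF True True] True by (simp only: pred_def mem_Collect_eq simp_thms)
  next
    case False
    then show ?thesis by (simp only: mem_Collect_eq simp_thms Collect_empty_eq[THEN iffD2] sets.empty_sets)
  qed
  then have "(\<lambda>\<omega>. card {k. 1 \<le> k \<and> \<Gamma> k \<omega> < ereal t \<and> ereal t < \<Gamma> k \<omega> + ereal (L k \<omega>)}) \<in> M \<rightarrow>\<^sub>M count_space UNIV"
    by (rule measurable_card)
  then have "(\<lambda>\<omega>. real (card {k. 1 \<le> k \<and> \<Gamma> k \<omega> < ereal t \<and> ereal t < \<Gamma> k \<omega> + ereal (L k \<omega>)})) \<in> borel_measurable M"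
    by (rule measurable_compose) simp
  then show ?thesis
    by (subst active_jobs_eq_card[abs_def])
qed

text \<open>A triangle inequality through \<open>S\<close> costs \<open>sqrt R\<close> twice: once
  for the service times, given \<open>G\<close>, which contains the arrivals, and once for the
  Poisson fluctuation, given \<open>F\<close>, with respect to which the intensity is
  measurable.\<close>

lemma (in prob_space) active_jobs_L1_bound:
  fixes t :: real
  assumes F: "subalgebra M F" and pois: "cond_poisson_process M F \<Gamma> \<mu>"
    and G: "subalgebra M G" "\<And>k. 1 \<le> k \<Longrightarrow> \<Gamma> k \<in> borel_measurable G"
    and serv: "cond_service_times M G \<Gamma> \<nu> L" and \<nu>: "\<nu> \<in> borel \<rightarrow>\<^sub>M prob_algebra borel"
    and sets: "\<And>\<omega>. sets (\<mu> \<omega>) = sets borel"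
    and meas: "\<And>B. B \<in> sets borel \<Longrightarrow> B \<subseteq> {0..<t} \<Longrightarrow> (\<lambda>\<omega>. measure (\<mu> \<omega>) B) \<in> borel_measurable F"
    and bd: "\<And>\<omega>. \<omega> \<in> space M \<Longrightarrow> emeasure (\<mu> \<omega>) {0..<t} \<le> ennreal R" and R: "0 \<le> R"
  defines "m \<equiv> \<lambda>\<omega>. LINT s|\<mu> \<omega>. indicator {0..<t} s * measure (\<nu> s) {t - s<..}"
  shows "integrable M (active_jobs \<Gamma> L t)" and "integrable M m"
    and "expectation (\<lambda>\<omega>. \<bar>active_jobs \<Gamma> L t \<omega> - m \<omega>\<bar>) \<le> 2 * sqrt R"
proof -
  have \<Gamma>: "\<And>k. 1 \<le> k \<Longrightarrow> \<Gamma> k \<in> borel_measurable M" "\<And>k \<omega>. 1 \<le> k \<Longrightarrow> \<omega> \<in> space M \<Longrightarrow> 0 \<le> \<Gamma> k \<omega>"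
    using pois by (auto simp: cond_poisson_process_def)
  have L: "\<And>k. 1 \<le> k \<Longrightarrow> L k \<in> borel_measurable M"
    using serv by (auto simp: cond_service_times_def)
  define D where "D = {0..<t}"
  have D: "D \<in> sets borel" "bounded D" "D \<subseteq> {0..}" by (auto simp: D_def)
  define h where "h s = measure (\<nu> s) {t - s<..}" for s
  have h_meas: "h \<in> borel_measurable borel"
    unfolding h_def by (rule borel_measurable_kernel_greaterThan[OF \<nu>]) measurable
  have h01: "0 \<le> h s" "h s \<le> 1" for s
    using measurable_space[OF \<nu>, of s] by (auto simp: space_prob_algebra h_def intro: prob_space.prob_le_1)
  have measD: "\<forall>\<omega>\<in>space M. measure (\<mu> \<omega>) D \<le> R"
    using bd R by (auto simp: measure_def D_def intro: enn2real_leI)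
  note count = cond_poisson_process_count[OF F pois D _ measD]
  have count_fin: "AE \<omega> in M. finite (arrivals_in \<Gamma> \<omega> D)"
    and count_int: "integrable M (\<lambda>\<omega>. real (card (arrivals_in \<Gamma> \<omega> D)))"
    and count_le: "expectation (\<lambda>\<omega>. real (card (arrivals_in \<Gamma> \<omega> D))) \<le> R"
    by (intro count meas; simp add: D_def)+
  define S where "S \<omega> = (\<Sum>k\<in>arrivals_in \<Gamma> \<omega> D. h (real_of_ereal (\<Gamma> k \<omega>)))" for \<omega>
  define N where "N \<omega> = (\<Sum>k\<in>arrivals_in \<Gamma> \<omega> D. indicator {t - real_of_ereal (\<Gamma> k \<omega>)<..} (L k \<omega>) :: real)" for \<omega>
  note sum = cond_poisson_process_sum[OF F pois D sets _ _ R h_meas h01]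
  have int_S: "integrable M S" and int_m: "integrable M m" and S_m: "expectation (\<lambda>\<omega>. \<bar>S \<omega> - m \<omega>\<bar>) \<le> sqrt R"
    unfolding S_def[abs_def] m_def h_def[symmetric] D_def[symmetric]
    by (intro sum meas; simp add: D_def bd)+
  have N_S: "expectation (\<lambda>\<omega>. \<bar>N \<omega> - S \<omega>\<bar>) \<le> sqrt R"
    unfolding N_def S_def h_def D_def
    by (intro service_times_thinning[OF G(1) serv \<nu> G(2)] count_fin[unfolded D_def]
        count_int[unfolded D_def] count_le[unfolded D_def])
  have act_meas: "active_jobs \<Gamma> L t \<in> borel_measurable M"
    using \<Gamma> L by (intro borel_measurable_active_jobs) auto
  have act: "AE \<omega> in M. active_jobs \<Gamma> L t \<omega> = N \<omega> \<and> \<bar>active_jobs \<Gamma> L t \<omega>\<bar> \<le> real (card (arrivals_in \<Gamma> \<omega> D))"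
    using count_fin
  proof (rule AE_mp, intro AE_I2 impI)
    fix \<omega> assume "\<omega> \<in> space M" "finite (arrivals_in \<Gamma> \<omega> D)"
    then have eq: "active_jobs \<Gamma> L t \<omega> = N \<omega>"
      unfolding N_def D_def using \<Gamma>(2) by (intro active_jobs_eq_sum) auto
    have "\<bar>N \<omega>\<bar> \<le> (\<Sum>k\<in>arrivals_in \<Gamma> \<omega> D. 1)"
      unfolding N_def by (intro order_trans[OF sum_abs] sum_mono) (simp add: indicator_def)
    then show "active_jobs \<Gamma> L t \<omega> = N \<omega> \<and> \<bar>active_jobs \<Gamma> L t \<omega>\<bar> \<le> real (card (arrivals_in \<Gamma> \<omega> D))"
      using eq by simp
  qed
  show int_act: "integrable M (active_jobs \<Gamma> L t)"
    using act by (intro Bochner_Integration.integrable_bound[OF count_int act_meas]) (auto elim!: eventually_mono)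
  show "integrable M m" by (rule int_m)
  have "expectation (\<lambda>\<omega>. \<bar>active_jobs \<Gamma> L t \<omega> - m \<omega>\<bar>)
      \<le> expectation (\<lambda>\<omega>. \<bar>active_jobs \<Gamma> L t \<omega> - S \<omega>\<bar> + \<bar>S \<omega> - m \<omega>\<bar>)"
    using int_act int_S int_m by (intro integral_mono) auto
  also have "\<dots> = expectation (\<lambda>\<omega>. \<bar>active_jobs \<Gamma> L t \<omega> - S \<omega>\<bar>) + expectation (\<lambda>\<omega>. \<bar>S \<omega> - m \<omega>\<bar>)"
    using int_act int_S int_m by simp
  also have "expectation (\<lambda>\<omega>. \<bar>active_jobs \<Gamma> L t \<omega> - S \<omega>\<bar>) = expectation (\<lambda>\<omega>. \<bar>N \<omega> - S \<omega>\<bar>)"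
  proof (rule integral_cong_AE)
    have N_meas: "N \<in> borel_measurable M"
      unfolding N_def
    proof (rule borel_measurable_sum_random_set)
      fix k
      show p: "Measurable.pred M (\<lambda>\<omega>. k \<in> arrivals_in \<Gamma> \<omega> D)"
        using \<Gamma>(1) D(1) by (rule measurable_arrivals_in)
      show "(\<lambda>\<omega>. of_bool (k \<in> arrivals_in \<Gamma> \<omega> D) * indicator {t - real_of_ereal (\<Gamma> k \<omega>)<..} (L k \<omega>) :: real) \<in> borel_measurable M"
      proof (cases "1 \<le> k")
        case True
        note [measurable] = \<Gamma>(1)[OF True] L[OF True] p
        show ?thesis unfolding indicator_def greaterThan_iff by measurable
      qed (simp add: arrivals_in_def)
    qed
    show "(\<lambda>\<omega>. \<bar>N \<omega> - S \<omega>\<bar>) \<in> borel_measurable M" "(\<lambda>\<omega>. \<bar>active_jobs \<Gamma> L t \<omega> - S \<omega>\<bar>) \<in> borel_measurable M"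
      using N_meas act_meas borel_measurable_integrable[OF int_S] by measurable
    show "AE \<omega> in M. \<bar>active_jobs \<Gamma> L t \<omega> - S \<omega>\<bar> = \<bar>N \<omega> - S \<omega>\<bar>"
      using act by eventually_elim simp
  qed
  finally show "expectation (\<lambda>\<omega>. \<bar>active_jobs \<Gamma> L t \<omega> - m \<omega>\<bar>) \<le> 2 * sqrt R"
    using N_S S_m by simp
qed

section \<open>Convergence in probability\<close>

lemma (in prob_space) tendsto_in_prob_L1:
  assumes int: "\<forall>\<^sub>F i in G. integrable M (X i)"
    and L1: "((\<lambda>i. expectation (\<lambda>\<omega>. \<bar>X i \<omega> - x\<bar>)) \<longlongrightarrow> 0) G"
  shows "tendsto_in_prob M X x G"
  unfolding tendsto_in_prob_def
proof (intro allI impI)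
  fix \<delta> :: real assume \<delta>: "0 < \<delta>"
  show "((\<lambda>i. prob {\<omega>\<in>space M. \<delta> \<le> \<bar>X i \<omega> - x\<bar>}) \<longlongrightarrow> 0) G"
  proof (rule Lim_null_comparison)
    show "((\<lambda>i. expectation (\<lambda>\<omega>. \<bar>X i \<omega> - x\<bar>) / \<delta>) \<longlongrightarrow> 0) G"
      using tendsto_divide[OF L1 tendsto_const[of \<delta>]] \<delta> by simp
    show "\<forall>\<^sub>F i in G. norm (prob {\<omega>\<in>space M. \<delta> \<le> \<bar>X i \<omega> - x\<bar>}) \<le> expectation (\<lambda>\<omega>. \<bar>X i \<omega> - x\<bar>) / \<delta>"
      using int
    proof eventually_elim
      case (elim i)
      then show ?case
        using integral_Markov_inequality_measure[of M "\<lambda>\<omega>. \<bar>X i \<omega> - x\<bar>" "{}" \<delta>] \<delta> by simp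
    qed
  qed
qed

lemma (in prob_space) tendsto_in_prob_divide:
  assumes X: "tendsto_in_prob M X x G" and Y: "tendsto_in_prob M Y x G" and x: "0 < x"
    and meas: "\<forall>\<^sub>F i in G. X i \<in> borel_measurable M \<and> Y i \<in> borel_measurable M"
  shows "tendsto_in_prob M (\<lambda>i \<omega>. X i \<omega> / Y i \<omega>) 1 G"
  unfolding tendsto_in_prob_def
proof (intro allI impI)
  fix \<delta> :: real assume \<delta>: "0 < \<delta>"
  \<comment> \<open>The bound \<open>x / 2\<close> keeps the denominator above \<open>x / 2\<close>;
    the bound \<open>\<delta> * x / 4\<close> makes the difference of numerator and denominator, at
    most twice \<eta>, smaller than \<delta> times that lower bound.\<close>
  define \<eta> where "\<eta> = min (x / 2) (\<delta> * x / 4)"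
  have \<eta>: "0 < \<eta>" "\<eta> \<le> x / 2" "4 * \<eta> \<le> \<delta> * x" using \<delta> x by (auto simp: \<eta>_def)
  have close: "\<bar>a / b - 1\<bar> < \<delta>" if a: "\<bar>a - x\<bar> < \<eta>" and b: "\<bar>b - x\<bar> < \<eta>" for a b
  proof -
    have b_gt: "x / 2 < b" using b \<eta>(2) by linarith
    have "\<bar>a - b\<bar> < 2 * \<eta>" using a b by linarith
    also have "\<dots> \<le> \<delta> * (x / 2)" using \<eta>(3) by simp
    also have "\<dots> \<le> \<delta> * b" using b_gt \<delta> by (intro mult_left_mono) auto
    finally have lt: "\<bar>a - b\<bar> < \<delta> * b" .
    have b_pos: "0 < b" using b_gt x by linarith
    have "a / b - 1 = (a - b) / b" using b_pos by (simp add: diff_divide_distrib)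
    then have "\<bar>a / b - 1\<bar> = \<bar>a - b\<bar> / b" using b_pos by simp
    also have "\<dots> < \<delta>" using lt b_pos by (simp add: pos_divide_less_eq)
    finally show ?thesis .
  qed
  show "((\<lambda>i. prob {\<omega>\<in>space M. \<delta> \<le> \<bar>X i \<omega> / Y i \<omega> - 1\<bar>}) \<longlongrightarrow> 0) G"
  proof (rule Lim_null_comparison)
    show "((\<lambda>i. prob {\<omega>\<in>space M. \<eta> \<le> \<bar>X i \<omega> - x\<bar>} + prob {\<omega>\<in>space M. \<eta> \<le> \<bar>Y i \<omega> - x\<bar>}) \<longlongrightarrow> 0) G"
      using tendsto_add[OF X[unfolded tendsto_in_prob_def, rule_format, OF \<eta>(1)]
          Y[unfolded tendsto_in_prob_def, rule_format, OF \<eta>(1)]] by simp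
    show "\<forall>\<^sub>F i in G. norm (prob {\<omega>\<in>space M. \<delta> \<le> \<bar>X i \<omega> / Y i \<omega> - 1\<bar>})
        \<le> prob {\<omega>\<in>space M. \<eta> \<le> \<bar>X i \<omega> - x\<bar>} + prob {\<omega>\<in>space M. \<eta> \<le> \<bar>Y i \<omega> - x\<bar>}"
      using meas
    proof eventually_elim
      case (elim i)
      then have [measurable]: "X i \<in> borel_measurable M" "Y i \<in> borel_measurable M" by auto
      have "{\<omega>\<in>space M. \<delta> \<le> \<bar>X i \<omega> / Y i \<omega> - 1\<bar>}
          \<subseteq> {\<omega>\<in>space M. \<eta> \<le> \<bar>X i \<omega> - x\<bar>} \<union> {\<omega>\<in>space M. \<eta> \<le> \<bar>Y i \<omega> - x\<bar>}"
        using close by (auto simp: not_less[symmetric])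
      then have "prob {\<omega>\<in>space M. \<delta> \<le> \<bar>X i \<omega> / Y i \<omega> - 1\<bar>}
          \<le> prob ({\<omega>\<in>space M. \<eta> \<le> \<bar>X i \<omega> - x\<bar>} \<union> {\<omega>\<in>space M. \<eta> \<le> \<bar>Y i \<omega> - x\<bar>})"
        by (intro finite_measure_mono) auto
      also have "\<dots> \<le> prob {\<omega>\<in>space M. \<eta> \<le> \<bar>X i \<omega> - x\<bar>} + prob {\<omega>\<in>space M. \<eta> \<le> \<bar>Y i \<omega> - x\<bar>}"
        by (intro measure_Un_le) auto
      finally show ?case by simp
    qed
  qed
qed

lemma tendsto_in_prob_cong:
  assumes "tendsto_in_prob M X x G" and "\<forall>\<^sub>F i in G. \<forall>\<omega>. X i \<omega> = Y i \<omega>"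
  shows "tendsto_in_prob M Y x G"
  unfolding tendsto_in_prob_def
proof (intro allI impI)
  fix \<delta> :: real assume "0 < \<delta>"
  then have "((\<lambda>i. measure M {\<omega>\<in>space M. \<delta> \<le> \<bar>X i \<omega> - x\<bar>}) \<longlongrightarrow> 0) G"
    using assms(1) by (simp add: tendsto_in_prob_def)
  then show "((\<lambda>i. measure M {\<omega>\<in>space M. \<delta> \<le> \<bar>Y i \<omega> - x\<bar>}) \<longlongrightarrow> 0) G"
    by (rule Lim_transform_eventually) (use assms(2) in \<open>auto elim!: eventually_mono\<close>)
qed

text \<open>Both \<open>f\<close> and its negative lie below the absolute value of \<open>f\<close>;
  monotonicity of conditional expectation gives the pointwise inequality, and integration removes
  the conditioning.\<close>

lemma (in finite_measure_subalgebra) integral_abs_real_cond_exp_le: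
  assumes f: "integrable M f"
  shows "(LINT \<omega>|M. \<bar>real_cond_exp M F f \<omega>\<bar>) \<le> (LINT \<omega>|M. \<bar>f \<omega>\<bar>)"
proof -
  have abs_int: "integrable M (\<lambda>\<omega>. \<bar>f \<omega>\<bar>)" "integrable M (\<lambda>\<omega>. - f \<omega>)" using f by auto
  have 1: "AE \<omega> in M. real_cond_exp M F f \<omega> \<le> real_cond_exp M F (\<lambda>\<omega>. \<bar>f \<omega>\<bar>) \<omega>"
    using f abs_int by (intro real_cond_exp_mono) auto
  have 2: "AE \<omega> in M. real_cond_exp M F (\<lambda>\<omega>. (- 1) * f \<omega>) \<omega> \<le> real_cond_exp M F (\<lambda>\<omega>. \<bar>f \<omega>\<bar>) \<omega>"
    using f abs_int by (intro real_cond_exp_mono) auto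
  have "AE \<omega> in M. \<bar>real_cond_exp M F f \<omega>\<bar> \<le> real_cond_exp M F (\<lambda>\<omega>. \<bar>f \<omega>\<bar>) \<omega>"
    using 1 2 real_cond_exp_cmult[OF f, of "- 1"] by eventually_elim auto
  then have "(LINT \<omega>|M. \<bar>real_cond_exp M F f \<omega>\<bar>) \<le> (LINT \<omega>|M. real_cond_exp M F (\<lambda>\<omega>. \<bar>f \<omega>\<bar>) \<omega>)"
    using real_cond_exp_int(1)[OF f] real_cond_exp_int(1)[OF abs_int(1)] by (intro integral_mono_AE) auto
  then show ?thesis
    using real_cond_exp_int(2)[OF abs_int(1)] by simp
qed

section \<open>Averaging the active jobs\<close>

lemma rate_function_continuous_on:
  assumes "rate_function S f"
  shows "continuous_on S f"
proof -
  consider A where "A-lipschitz_on S f" | "C1_on S f"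
    using assms unfolding rate_function_def by blast
  then show ?thesis
  proof cases
    case 1 then show ?thesis by (rule lipschitz_on_continuous_on)
  next
    case 2
    then obtain f' where "\<And>x. x \<in> S \<Longrightarrow> (f has_derivative blinfun_apply (f' x)) (at x within S)"
      unfolding C1_on_def by blast
    then show ?thesis by (rule has_derivative_continuous_on)
  qed
qed

lemma rate_function_bounds:
  assumes "rate_function S f"
  obtains B where "\<And>x. x \<in> S \<Longrightarrow> 0 < f x" "\<And>x. x \<in> S \<Longrightarrow> f x \<le> B"
proof -
  obtain B where "\<forall>y\<in>f ` S. norm y \<le> B"
    using assms unfolding rate_function_def bounded_iff by blast
  then have "f x \<le> B" if "x \<in> S" for x
    using that abs_le_D1[of "f x" B] by auto
  moreover have "0 < f x" if "x \<in> S" for x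
    using assms that by (simp add: rate_function_def)
  ultimately show ?thesis by (rule that[rotated])
qed

lemma subalgebra_sigma:
  assumes "C \<subseteq> sets M"
  shows "subalgebra M (sigma (space M) C)"
proof -
  have "C \<subseteq> Pow (space M)" using assms sets.space_closed by blast
  then show ?thesis
    using assms sets.sigma_sets_subset[of C M] by (simp add: subalgebra_def space_measure_of_conv)
qed

lemma measurable_sigma_Z:
  fixes Z :: "real \<Rightarrow> 'a \<Rightarrow> 'b::topological_space"
  assumes "0 \<le> r"
  shows "Z r \<in> borel_measurable (sigma_Z M Z)"
proof (rule measurableI)
  fix A :: "'b set" assume A: "A \<in> sets borel"
  show "Z r -` A \<inter> space (sigma_Z M Z) \<in> sets (sigma_Z M Z)"
    unfolding sigma_Z_def space_measure_of_conv using assms A by (intro in_measure_of) auto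
qed simp

lemma subalgebra_sigma_Z:
  assumes "\<And>r. 0 \<le> r \<Longrightarrow> Z r \<in> borel_measurable M"
  shows "subalgebra M (sigma_Z M Z)"
  unfolding sigma_Z_def using assms by (intro subalgebra_sigma) (auto intro: measurable_sets)

lemma measurable_sigma_Z_arrivals:
  assumes "1 \<le> k"
  shows "\<Gamma> k \<in> borel_measurable (sigma_Z_arrivals M Z \<Gamma>)"
proof (rule measurableI)
  fix A :: "ereal set" assume A: "A \<in> sets borel"
  show "\<Gamma> k -` A \<inter> space (sigma_Z_arrivals M Z \<Gamma>) \<in> sets (sigma_Z_arrivals M Z \<Gamma>)"
    unfolding sigma_Z_arrivals_def space_measure_of_conv using assms A by (intro in_measure_of) auto
qed simp

lemma subalgebra_sigma_Z_arrivals: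
  assumes "\<And>r. 0 \<le> r \<Longrightarrow> Z r \<in> borel_measurable M" "\<And>k. 1 \<le> k \<Longrightarrow> \<Gamma> k \<in> borel_measurable M"
  shows "subalgebra M (sigma_Z_arrivals M Z \<Gamma>)"
  unfolding sigma_Z_arrivals_def using assms by (intro subalgebra_sigma) (auto intro: measurable_sets)

theorem theorem4p1:
  fixes M :: "'a measure"
    and Z :: "real \<Rightarrow> 'a \<Rightarrow> real ^ 'd"
    and K :: "real \<Rightarrow> real ^ 'd \<Rightarrow> (real ^ 'd) measure"
    and \<pi> :: "(real ^ 'd) measure"
    and lam :: "real \<Rightarrow> real"
    and \<psi> :: "real ^ 'd \<Rightarrow> real"
    and l :: "real \<Rightarrow> real \<Rightarrow> real"
    and \<Gamma> :: "real \<Rightarrow> nat \<Rightarrow> 'a \<Rightarrow> ereal"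
    and L :: "real \<Rightarrow> nat \<Rightarrow> 'a \<Rightarrow> real"
    and \<alpha> \<beta> c C t \<psi>bar :: real
  assumes prob: "prob_space M"
    and Z_rv: "\<And>r. r \<ge> 0 \<Longrightarrow> Z r \<in> borel_measurable M"
    and Z_cadlag: "\<And>\<omega>. \<omega> \<in> space M \<Longrightarrow> cadlag (\<lambda>r. Z r \<omega>)"
    and Z_trans: "transition_probabilities M Z K"
    and inv: "invariant_prob K \<pi>"
    and inv_unique: "\<And>\<pi>'. invariant_prob K \<pi>' \<Longrightarrow> \<pi>' = \<pi>"
    and lam: "rate_function {0..} lam"
    and psi: "rate_function UNIV \<psi>"
    and psibar: "\<psi>bar = (LINT z|\<pi>. \<psi> z)"
    and ergodic:
      "((\<lambda>T. LINT \<omega>|M. \<bar>1 / T * (LINT r:{0..T}|lborel. \<psi> (Z r \<omega>)) - \<psi>bar\<bar>) \<longlongrightarrow> 0) at_top"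
    and alpha: "\<alpha> > 0" and pos_const: "c > 0" "C > 0"
    and dens_meas: "\<And>s. s \<ge> 0 \<Longrightarrow> l s \<in> borel_measurable borel"
    and dens_nonneg: "\<And>s r. s \<ge> 0 \<Longrightarrow> r \<ge> 0 \<Longrightarrow> 0 \<le> l s r"
    and dens_prob: "\<And>s. s \<ge> 0 \<Longrightarrow> prob_space (service_law l s)"
    and dens_lower: "\<And>s r. s > 0 \<Longrightarrow> r > 0 \<Longrightarrow> c * min (r powr (- 1 - \<alpha>)) 1 \<le> l s r"
    and dens_upper: "\<And>s r. s > 0 \<Longrightarrow> r > 0 \<Longrightarrow> l s r \<le> C * min (r powr (- 1 - \<alpha>)) 1"
    and dens_deriv: "\<And>s r. s > 0 \<Longrightarrow> r > 0 \<Longrightarrow>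
      \<exists>D. ((\<lambda>u. l u r) has_real_derivative D) (at s) \<and> D \<le> C * min (r powr (- 1 - \<alpha>)) 1"
    and beta: "\<beta> > 0"
    and arrivals: "\<And>\<epsilon>. \<epsilon> > 0 \<Longrightarrow>
      cond_poisson_process M (sigma_Z M Z) (\<Gamma> \<epsilon>)
        (\<lambda>\<omega>. arrival_intensity \<beta> lam \<psi> (\<lambda>r. Z r \<omega>) \<epsilon>)"
    and services: "\<And>\<epsilon>. \<epsilon> > 0 \<Longrightarrow>
      cond_service_times M (sigma_Z_arrivals M Z (\<Gamma> \<epsilon>)) (\<Gamma> \<epsilon>) (service_law l) (L \<epsilon>)"
    and t: "t > 0"
  shows "tendsto_in_prob M
           (\<lambda>\<epsilon> \<omega>. active_jobs (\<Gamma> \<epsilon>) (L \<epsilon>) t \<omega>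
                     / quenched_mean M Z (active_jobs (\<Gamma> \<epsilon>) (L \<epsilon>) t) \<omega>) 1 (at_right 0)
       \<and> tendsto_in_prob M
           (\<lambda>\<epsilon> \<omega>. \<epsilon> powr \<beta> * active_jobs (\<Gamma> \<epsilon>) (L \<epsilon>) t \<omega> / averaged_mean lam l \<psi>bar t)
           1 (at_right 0)"
proof -
  interpret prob_space M by (rule prob)
  obtain \<Lambda> where lam_pos: "\<And>s. 0 \<le> s \<Longrightarrow> 0 < lam s" and lam_le: "\<And>s. 0 \<le> s \<Longrightarrow> lam s \<le> \<Lambda>"
    using rate_function_bounds[OF lam] by (metis atLeast_iff)
  obtain \<Psi> where psi_pos: "\<And>z. 0 < \<psi> z" and psi_le: "\<And>z. \<psi> z \<le> \<Psi>"
    using rate_function_bounds[OF psi] by (metis UNIV_I)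
  have \<Lambda>: "0 < \<Lambda>" using lam_pos[of 0] lam_le[of 0] by simp
  have \<Psi>: "0 < \<Psi>" using psi_pos psi_le by (rule less_le_trans)
  have psi_cont: "continuous_on UNIV \<psi>"
    using psi by (rule rate_function_continuous_on)
  have psi_meas[measurable]: "\<psi> \<in> borel_measurable borel"
    using psi_cont by (rule borel_measurable_continuous_onI)
  \<comment> \<open>The rate is controlled on nonnegative times only; extension by \<open>0\<close>
    makes it measurable and bounded on the whole line.\<close>
  define lam0 where "lam0 s = indicator {0..} s * lam s" for s
  have lam0_meas[measurable]: "lam0 \<in> borel_measurable borel"
    using borel_measurable_continuous_on_indicator[OF _ rate_function_continuous_on[OF lam]]
    by (simp add: lam0_def[abs_def])
  have lam0_bd: "0 \<le> lam0 s" "lam0 s \<le> \<Lambda>" for s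
    using lam_pos[of s] lam_le[of s] \<Lambda> by (auto simp: lam0_def indicator_def)

  define \<nu> where "\<nu> s = service_law l (max 0 s)" for s
  have \<nu>: "\<nu> \<in> borel \<rightarrow>\<^sub>M prob_algebra borel"
    unfolding \<nu>_def
  proof (rule service_law_kernel)
    show "isCont (\<lambda>u. l u r) s" if "0 < s" "0 < r" for s r
      using dens_deriv[OF that] by (auto intro: DERIV_isCont)
  qed (use dens_meas dens_prob in auto)
  define h where "h s = measure (\<nu> s) {t - s<..}" for s
  have h_meas[measurable]: "h \<in> borel_measurable borel"
    unfolding h_def by (rule borel_measurable_kernel_greaterThan[OF \<nu>]) measurable
  have h01: "0 \<le> h s" "h s \<le> 1" for s
    using measurable_space[OF \<nu>, of s] by (auto simp: space_prob_algebra h_def intro: prob_space.prob_le_1)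
  have h_tail: "h s = service_tail l s (t - s)" if "0 \<le> s" "s \<le> t" for s
    using that dens_meas[of s] dens_nonneg[of s]
    by (simp add: h_def \<nu>_def measure_service_law_greaterThan)
  have h_pos: "0 < h s" if s: "0 < s" "s < t" for s
  proof -
    have ls[measurable]: "l s \<in> borel_measurable borel" using dens_meas s by simp
    have int: "integrable lborel (\<lambda>r. indicator {0..} r * l s r)"
    proof (rule integrableI_nonneg)
      have "(\<integral>\<^sup>+ r. ennreal (indicator {0..} r * l s r) \<partial>lborel) = emeasure (service_law l s) (space (service_law l s))"
        unfolding service_law_def by (subst emeasure_density) (auto intro!: nn_integral_cong)
      also have "\<dots> = 1" using dens_prob[of s] s by (intro prob_space.emeasure_space_1) simp
      finally show "(\<integral>\<^sup>+ r. ennreal (indicator {0..} r * l s r) \<partial>lborel) < \<infinity>" by simp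
    qed (use dens_nonneg[of s] s in \<open>auto simp: indicator_def\<close>)
    have "0 < (LINT r|lborel. indicator {t - s..} r *\<^sub>R l s r)"
    proof (rule integral_pos_on)
      show "integrable lborel (\<lambda>r. indicator {t - s..} r *\<^sub>R l s r)"
        using s by (intro Bochner_Integration.integrable_bound[OF int]) (auto simp: indicator_def)
      show "0 \<le> indicator {t - s..} r *\<^sub>R l s r" for r
        using dens_nonneg[of s r] s by (auto simp: indicator_def)
      \<comment> \<open>Any interval of positive length to the right of \<open>t - s\<close> would
        do; the lower bound on the densities makes the integrand positive there.\<close>
      show "0 < indicator {t - s..} r *\<^sub>R l s r" if "r \<in> {t - s<..<t - s + 1}" for r
      proof -
        have r: "0 < r" "t - s \<le> r" using that s by auto
        have "0 < c * min (r powr (- 1 - \<alpha>)) 1" using pos_const r by simp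
        also have "\<dots> \<le> l s r" using dens_lower s r by simp
        finally show ?thesis using r by simp
      qed
    qed auto
    then show ?thesis using s by (simp add: h_tail service_tail_def set_lebesgue_integral_def)
  qed

  \<comment> \<open>The weight of the averaging lemma: arrival rate times probability of being
    active at \<open>t\<close>. Its integral times \<open>\<psi>bar\<close> is the averaged mean
    \<kappa>.\<close>
  define g where "g s = indicator {0..t} s * (lam0 s * h s)" for s
  have g_meas[measurable]: "g \<in> borel_measurable borel" unfolding g_def by measurable
  have Icc_int: "integrable lborel (indicator {0..t} :: real \<Rightarrow> real)"
    by (intro integrable_real_indicator) (auto simp: emeasure_lborel_Icc_eq)
  have g_bd: "0 \<le> g s" "g s \<le> \<Lambda> * indicator {0..t} s" for s
    using mult_mono[OF lam0_bd(2) h01(2) _ h01(1), of s s] lam0_bd[of s] h01[of s] \<Lambda>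
    by (auto simp: g_def indicator_def)
  have g_int: "integrable lborel g"
    using g_bd by (intro Bochner_Integration.integrable_bound[OF integrable_mult_right[OF Icc_int, of \<Lambda>]])
      (auto intro!: AE_I2 order_trans[OF g_bd(2) abs_ge_self])
  define \<kappa> where "\<kappa> = averaged_mean lam l \<psi>bar t"
  have \<kappa>_eq: "\<kappa> = \<psi>bar * (LINT s|lborel. g s)"
  proof -
    have "(LINT s:{0..t}|lborel. lam s * service_tail l s (t - s)) = (LINT s|lborel. g s)"
      unfolding set_lebesgue_integral_def
      by (intro Bochner_Integration.integral_cong) (auto simp: g_def lam0_def h_tail indicator_def)
    then show ?thesis by (simp add: \<kappa>_def averaged_mean_def)
  qed
  have \<kappa>: "0 < \<kappa>"
  proof -
    have "0 < (LINT s|lborel. g s)"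
    proof (rule integral_pos_on[OF g_int])
      show "0 < g s" if "s \<in> {0<..<t}" for s
        using that h_pos[of s] lam_pos[of s] by (simp add: g_def lam0_def)
    qed (use t g_bd in auto)
    moreover have "0 < \<psi>bar"
    proof -
      have \<pi>: "prob_space \<pi>" "sets \<pi> = sets borel"
        using inv by (auto simp: invariant_prob_def space_prob_algebra)
      interpret \<pi>: prob_space \<pi> by (rule \<pi>)
      have "\<psi> \<in> borel_measurable \<pi>"
        using psi_meas by (simp only: measurable_cong_sets[OF \<pi>(2) refl])
      then have "integrable \<pi> \<psi>"
        using psi_pos psi_le
        by (intro \<pi>.integrable_const_bound[where B = \<Psi>]) (auto simp: less_imp_le)
      then show ?thesis
        unfolding psibar using psi_pos
        by (intro integral_pos_on[where A = "space \<pi>"]) (auto simp: less_imp_le \<pi>.emeasure_space_1)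
    qed
    ultimately show ?thesis by (simp add: \<kappa>_eq)
  qed

  \<comment> \<open>Joint measurability of the environment with respect to its own
    sigma-algebra\<close>
  have F: "subalgebra M (sigma_Z M Z)" and F_meas: "\<And>r. 0 \<le> r \<Longrightarrow> Z r \<in> borel_measurable (sigma_Z M Z)"
    using subalgebra_sigma_Z measurable_sigma_Z Z_rv by blast+
  have space_F: "space (sigma_Z M Z) = space M" using F by (simp add: subalgebra_def)
  define X where "X s \<omega> = indicator {0..} s * \<psi> (Z s \<omega>)" for s \<omega>
  have X_bd: "0 \<le> X s \<omega>" "X s \<omega> \<le> \<Psi>" for s \<omega>
    using psi_pos[of "Z s \<omega>"] psi_le[of "Z s \<omega>"] \<Psi> by (auto simp: X_def indicator_def)
  have X_meas: "(\<lambda>p. X (fst p) (snd p)) \<in> borel_measurable (borel \<Otimes>\<^sub>M sigma_Z M Z)"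
  proof -
    have pos: "(\<lambda>p. indicator {0<..} (fst p) * \<psi> (Z (fst p) (snd p))) \<in> borel_measurable (borel \<Otimes>\<^sub>M sigma_Z M Z)"
    proof (rule borel_measurable_pair_right_continuous)
      fix s :: real and \<omega> assume s: "0 < s"
      show "(\<lambda>\<omega>. \<psi> (Z s \<omega>)) \<in> borel_measurable (sigma_Z M Z)"
        using F_meas[of s] s by (intro measurable_compose[OF _ psi_meas]) simp
      assume "\<omega> \<in> space (sigma_Z M Z)"
      then have "((\<lambda>r. Z r \<omega>) \<longlongrightarrow> Z s \<omega>) (at_right s)"
        using Z_cadlag[of \<omega>] s by (simp add: cadlag_def space_F)
      then show "((\<lambda>u. \<psi> (Z u \<omega>)) \<longlongrightarrow> \<psi> (Z s \<omega>)) (at_right s)"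
        by (intro continuous_on_tendsto_compose[OF psi_cont]) auto
    qed
    \<comment> \<open>Time \<open>0\<close> is treated separately, since the right-continuity
      argument yields measurability on positive times only.\<close>
    have zero: "(\<lambda>p. \<psi> (Z 0 (snd p))) \<in> borel_measurable (borel \<Otimes>\<^sub>M sigma_Z M Z)"
      by (intro measurable_compose[OF measurable_snd] measurable_compose[OF F_meas psi_meas]) simp
    have "(\<lambda>p. if fst p = (0::real) then \<psi> (Z 0 (snd p)) else indicator {0<..} (fst p) * \<psi> (Z (fst p) (snd p)))
        \<in> borel_measurable (borel \<Otimes>\<^sub>M sigma_Z M Z)"
    proof (rule measurable_If[OF zero pos])
      have "Measurable.pred (borel \<Otimes>\<^sub>M sigma_Z M Z) (\<lambda>p. fst p = (0::real))" by measurable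
      then show "{p \<in> space (borel \<Otimes>\<^sub>M sigma_Z M Z). fst p = (0::real)} \<in> sets (borel \<Otimes>\<^sub>M sigma_Z M Z)"
        by (simp add: pred_def)
    qed
    then show ?thesis
      by (rule measurable_cong[THEN iffD1, rotated]) (auto simp: X_def indicator_def)
  qed
  have X_meas_swap: "(\<lambda>p. X (snd p) (fst p)) \<in> borel_measurable (sigma_Z M Z \<Otimes>\<^sub>M borel)"
    using measurable_compose[OF measurable_pair_swap' X_meas] by (simp add: case_prod_beta')
  have X_meas_M: "(\<lambda>p. X (snd p) (fst p)) \<in> borel_measurable (M \<Otimes>\<^sub>M borel)"
  proof -
    have "(\<lambda>p. (fst p, snd p)) \<in> M \<Otimes>\<^sub>M (borel :: real measure) \<rightarrow>\<^sub>M sigma_Z M Z \<Otimes>\<^sub>M borel"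
      using F by (intro measurable_Pair measurable_compose[OF measurable_fst measurable_from_subalg] measurable_snd)
        (auto simp: measurable_ident)
    from measurable_compose[OF this X_meas_swap] show ?thesis by simp
  qed

  \<comment> \<open>The L1 estimate at a fixed scale\<close>
  define N where "N \<epsilon> = active_jobs (\<Gamma> \<epsilon>) (L \<epsilon>) t" for \<epsilon>
  define A where "A \<epsilon> \<omega> = (LINT s:{0..t}|lborel. g s * (X (s / \<epsilon>) \<omega> - \<psi>bar))" for \<epsilon> \<omega>
  have A_lim: "((\<lambda>\<epsilon>. expectation (\<lambda>\<omega>. \<bar>A \<epsilon> \<omega>\<bar>)) \<longlongrightarrow> 0) (at_right 0)"
    unfolding A_def
  proof (rule ergodic_weighted_average[OF X_meas_M _ _ t g_int])
    show "\<bar>X s \<omega>\<bar> \<le> \<Psi>" for s \<omega> using X_bd[of s \<omega>] by simp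
    have "(LINT r:{0..T}|lborel. X r \<omega>) = (LINT r:{0..T}|lborel. \<psi> (Z r \<omega>))" for T \<omega>
      unfolding set_lebesgue_integral_def
      by (intro Bochner_Integration.integral_cong) (auto simp: X_def indicator_def)
    then show "((\<lambda>T. expectation (\<lambda>\<omega>. \<bar>1 / T * (LINT r:{0..T}|lborel. X r \<omega>) - \<psi>bar\<bar>)) \<longlongrightarrow> 0) at_top"
      using ergodic by simp
  qed
  have one: "integrable M (N \<epsilon>)
      \<and> expectation (\<lambda>\<omega>. \<bar>\<epsilon> powr \<beta> * N \<epsilon> \<omega> - \<kappa>\<bar>)
        \<le> 2 * sqrt (\<Lambda> * \<Psi> * t) * \<epsilon> powr (\<beta> / 2) + expectation (\<lambda>\<omega>. \<bar>A \<epsilon> \<omega>\<bar>)" if \<epsilon>: "0 < \<epsilon>" for \<epsilon>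
  proof -
    note pois = arrivals[OF \<epsilon>] and serv = services[OF \<epsilon>]
    define d where "d \<omega> s = \<epsilon> powr (- \<beta>) * (lam0 s * X (s / \<epsilon>) \<omega>)" for \<omega> s
    define \<mu> where "\<mu> \<omega> = arrival_intensity \<beta> lam \<psi> (\<lambda>r. Z r \<omega>) \<epsilon>" for \<omega>
    \<comment> \<open>The intensity density is at most
      \<open>\<epsilon> powr (- \<beta>) * (\<Lambda> * \<Psi>)\<close>, and the time interval has
      length \<open>t\<close>.\<close>
    define R where "R = \<epsilon> powr (- \<beta>) * (\<Lambda> * \<Psi> * t)"
    have R: "0 \<le> R" using \<Lambda> \<Psi> t by (simp add: R_def)
    have d_bd: "0 \<le> d \<omega> s" "d \<omega> s \<le> \<epsilon> powr (- \<beta>) * (\<Lambda> * \<Psi>)" for \<omega> s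
      using lam0_bd[of s] X_bd[of "s / \<epsilon>" \<omega>] \<Lambda> by (auto simp: d_def intro!: mult_left_mono mult_mono)
    have \<mu>_eq: "\<mu> \<omega> = density lborel (\<lambda>s. ennreal (d \<omega> s))" for \<omega>
    proof -
      have "indicator {0..} s * (\<epsilon> powr (- \<beta>) * lam s * \<psi> (Z (s / \<epsilon>) \<omega>)) = d \<omega> s" for s
        using \<epsilon> by (auto simp: d_def lam0_def X_def indicator_def)
      then show ?thesis by (simp add: \<mu>_def arrival_intensity_def)
    qed
    have d_joint: "(\<lambda>p. d (fst p) (snd p)) \<in> borel_measurable (sigma_Z M Z \<Otimes>\<^sub>M borel)"
    proof -
      have "(\<lambda>p. (fst p, snd p / \<epsilon>)) \<in> sigma_Z M Z \<Otimes>\<^sub>M borel \<rightarrow>\<^sub>M sigma_Z M Z \<Otimes>\<^sub>M borel"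
        by measurable
      from measurable_compose[OF this X_meas_swap] show ?thesis
        unfolding d_def by (intro borel_measurable_times) (simp_all, measurable)
    qed
    have d_sec[measurable]: "d \<omega> \<in> borel_measurable borel" if "\<omega> \<in> space M" for \<omega>
      using measurable_Pair2[OF d_joint, of \<omega>] that by (simp add: space_F)
    have \<mu>_em: "emeasure (\<mu> \<omega>) B = (\<integral>\<^sup>+ s. ennreal (d \<omega> s) * indicator B s \<partial>lborel)"
      if "\<omega> \<in> space M" "B \<in> sets borel" for \<omega> B
      unfolding \<mu>_eq using d_sec[OF that(1)] that(2) by (intro emeasure_density) auto
    have \<mu>_meas: "(\<lambda>\<omega>. measure (\<mu> \<omega>) B) \<in> borel_measurable (sigma_Z M Z)" if B[measurable]: "B \<in> sets borel" for B
    proof -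
      have "(\<lambda>\<omega>. \<integral>\<^sup>+ s. ennreal (d \<omega> s) * indicator B s \<partial>lborel) \<in> borel_measurable (sigma_Z M Z)"
        using d_joint by (intro lborel.borel_measurable_nn_integral) (simp add: case_prod_beta', measurable)
      then have "(\<lambda>\<omega>. enn2real (\<integral>\<^sup>+ s. ennreal (d \<omega> s) * indicator B s \<partial>lborel)) \<in> borel_measurable (sigma_Z M Z)"
        by measurable
      then show ?thesis
        by (rule measurable_cong[THEN iffD1, rotated]) (simp add: measure_def \<mu>_em space_F B)
    qed
    have \<mu>_bd: "emeasure (\<mu> \<omega>) {0..<t} \<le> ennreal R" if "\<omega> \<in> space M" for \<omega>
    proof -
      have "emeasure (\<mu> \<omega>) {0..<t} \<le> (\<integral>\<^sup>+ s. ennreal (\<epsilon> powr (- \<beta>) * (\<Lambda> * \<Psi>)) * indicator {0..<t} s \<partial>lborel)"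
        using that d_bd by (subst \<mu>_em) (auto intro!: nn_integral_mono mult_right_mono ennreal_leI)
      also have "\<dots> = ennreal (\<epsilon> powr (- \<beta>) * (\<Lambda> * \<Psi>)) * ennreal t"
        using t by (subst nn_integral_cmult_indicator) auto
      also have "\<dots> = ennreal R"
        using \<Lambda> \<Psi> t by (simp add: R_def ennreal_mult[symmetric] mult.assoc)
      finally show ?thesis .
    qed
    have \<Gamma>: "1 \<le> k \<Longrightarrow> \<Gamma> \<epsilon> k \<in> borel_measurable M" "1 \<le> k \<Longrightarrow> \<omega> \<in> space M \<Longrightarrow> 0 \<le> \<Gamma> \<epsilon> k \<omega>" for k \<omega>
      using pois by (auto simp: cond_poisson_process_def)
    have G: "subalgebra M (sigma_Z_arrivals M Z (\<Gamma> \<epsilon>))"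
      and G_meas: "\<And>k. 1 \<le> k \<Longrightarrow> \<Gamma> \<epsilon> k \<in> borel_measurable (sigma_Z_arrivals M Z (\<Gamma> \<epsilon>))"
      using subalgebra_sigma_Z_arrivals[of Z M "\<Gamma> \<epsilon>"] measurable_sigma_Z_arrivals[of _ "\<Gamma> \<epsilon>" M Z] Z_rv \<Gamma>(1) by auto
    have serv': "cond_service_times M (sigma_Z_arrivals M Z (\<Gamma> \<epsilon>)) (\<Gamma> \<epsilon>) \<nu> (L \<epsilon>)"
      unfolding \<nu>_def using serv \<Gamma>(2) by (rule cond_service_times_max)
    define m where "m \<omega> = (LINT s|\<mu> \<omega>. indicator {0..<t} s * measure (\<nu> s) {t - s<..})" for \<omega>
    note bound = active_jobs_L1_bound[OF F pois[folded \<mu>_def] G G_meas serv' \<nu> _ \<mu>_meas \<mu>_bd R, folded m_def N_def]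
    have int_N: "integrable M (N \<epsilon>)" and int_m: "integrable M m"
      and N_m: "expectation (\<lambda>\<omega>. \<bar>N \<epsilon> \<omega> - m \<omega>\<bar>) \<le> 2 * sqrt R"
      using bound by (simp_all add: \<mu>_eq)
    \<comment> \<open>The factor \<open>\<epsilon> powr \<beta>\<close> cancels the scaling of the
      intensity and leaves the integral of \<open>g\<close> against the fast environment;
      subtracting \<kappa> centres the environment at \<open>\<psi>bar\<close>. The half-open and
      the closed interval differ in the null set of \<open>t\<close> alone.\<close>
    have m_A: "\<epsilon> powr \<beta> * m \<omega> - \<kappa> = A \<epsilon> \<omega>" if \<omega>: "\<omega> \<in> space M" for \<omega>
    proof -
      have X_sec[measurable]: "(\<lambda>s. X (s / \<epsilon>) \<omega>) \<in> borel_measurable borel"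
        using measurable_compose[OF _ measurable_Pair2[OF X_meas_M \<omega>], of "\<lambda>s. s / \<epsilon>" borel] by simp
      have gX_int: "integrable lborel (\<lambda>s. g s * X (s / \<epsilon>) \<omega>)"
      proof (rule Bochner_Integration.integrable_bound)
        show "integrable lborel (\<lambda>s. g s * \<Psi>)" using g_int by simp
        show "AE s in lborel. norm (g s * X (s / \<epsilon>) \<omega>) \<le> norm (g s * \<Psi>)"
          using g_bd(1) X_bd \<Psi> by (auto simp: abs_mult intro!: mult_left_mono)
      qed measurable
      have "m \<omega> = (LINT s|lborel. d \<omega> s *\<^sub>R (indicator {0..<t} s * h s))"
        unfolding m_def \<mu>_eq h_def[symmetric] using d_sec[OF \<omega>] d_bd
        by (intro integral_density) auto
      also have "\<dots> = (LINT s|lborel. \<epsilon> powr (- \<beta>) * (g s * X (s / \<epsilon>) \<omega>))"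
      proof (rule integral_cong_AE)
        show "AE s in lborel. d \<omega> s *\<^sub>R (indicator {0..<t} s * h s) = \<epsilon> powr (- \<beta>) * (g s * X (s / \<epsilon>) \<omega>)"
          using AE_lborel_singleton[of t] by eventually_elim (auto simp: d_def g_def indicator_def)
      qed (use d_sec[OF \<omega>] in measurable)
      finally have "\<epsilon> powr \<beta> * m \<omega> = (LINT s|lborel. g s * X (s / \<epsilon>) \<omega>)"
        using \<epsilon> by (simp add: powr_minus field_simps)
      moreover have "A \<epsilon> \<omega> = (LINT s|lborel. g s * X (s / \<epsilon>) \<omega> - \<psi>bar * g s)"
        unfolding A_def set_lebesgue_integral_def
        by (intro Bochner_Integration.integral_cong) (auto simp: g_def indicator_def algebra_simps)
      ultimately show ?thesis
        using gX_int g_int by (simp add: \<kappa>_eq)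
    qed
    have "expectation (\<lambda>\<omega>. \<bar>\<epsilon> powr \<beta> * N \<epsilon> \<omega> - \<kappa>\<bar>)
        \<le> expectation (\<lambda>\<omega>. \<epsilon> powr \<beta> * \<bar>N \<epsilon> \<omega> - m \<omega>\<bar> + \<bar>\<epsilon> powr \<beta> * m \<omega> - \<kappa>\<bar>)"
    proof (rule integral_mono)
      show "\<bar>\<epsilon> powr \<beta> * N \<epsilon> \<omega> - \<kappa>\<bar> \<le> \<epsilon> powr \<beta> * \<bar>N \<epsilon> \<omega> - m \<omega>\<bar> + \<bar>\<epsilon> powr \<beta> * m \<omega> - \<kappa>\<bar>" for \<omega>
      proof -
        have "\<epsilon> powr \<beta> * \<bar>N \<epsilon> \<omega> - m \<omega>\<bar> = \<bar>\<epsilon> powr \<beta> * N \<epsilon> \<omega> - \<epsilon> powr \<beta> * m \<omega>\<bar>"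
          by (simp add: abs_mult right_diff_distrib[symmetric])
        then show ?thesis by linarith
      qed
    qed (use int_N int_m in auto)
    also have "\<dots> = \<epsilon> powr \<beta> * expectation (\<lambda>\<omega>. \<bar>N \<epsilon> \<omega> - m \<omega>\<bar>) + expectation (\<lambda>\<omega>. \<bar>\<epsilon> powr \<beta> * m \<omega> - \<kappa>\<bar>)"
      using int_N int_m by simp
    also have "expectation (\<lambda>\<omega>. \<bar>\<epsilon> powr \<beta> * m \<omega> - \<kappa>\<bar>) = expectation (\<lambda>\<omega>. \<bar>A \<epsilon> \<omega>\<bar>)"
      by (intro Bochner_Integration.integral_cong) (auto simp: m_A)
    also have "\<epsilon> powr \<beta> * expectation (\<lambda>\<omega>. \<bar>N \<epsilon> \<omega> - m \<omega>\<bar>) \<le> \<epsilon> powr \<beta> * (2 * sqrt R)"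
      using N_m by (intro mult_left_mono) auto
    \<comment> \<open>The normalisation \<open>\<epsilon> powr \<beta>\<close> against the
      fluctuation \<open>\<epsilon> powr (- \<beta> / 2)\<close> leaves a positive power, which
      tends to \<open>0\<close>.\<close>
    also have "\<epsilon> powr \<beta> * (2 * sqrt R) = 2 * sqrt (\<Lambda> * \<Psi> * t) * \<epsilon> powr (\<beta> / 2)"
    proof -
      have "sqrt (\<epsilon> powr (- \<beta>)) = \<epsilon> powr (- \<beta> / 2)"
        using \<epsilon> by (simp add: powr_half_sqrt[symmetric] powr_powr)
      then have "\<epsilon> powr \<beta> * sqrt R = sqrt (\<Lambda> * \<Psi> * t) * (\<epsilon> powr \<beta> * \<epsilon> powr (- \<beta> / 2))"
        by (simp add: R_def real_sqrt_mult)
      also have "\<epsilon> powr \<beta> * \<epsilon> powr (- \<beta> / 2) = \<epsilon> powr (\<beta> / 2)"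
        by (simp add: powr_add[symmetric])
      finally show ?thesis by simp
    qed
    finally show ?thesis using int_N by simp
  qed

  \<comment> \<open>Limits of the normalised count, its quenched mean, and their ratio\<close>
  define Q where "Q \<epsilon> = quenched_mean M Z (N \<epsilon>)" for \<epsilon>
  interpret F: finite_measure_subalgebra M "sigma_Z M Z"
    using F by (rule finite_measure_subalgebraI)
  have pos: "\<forall>\<^sub>F \<epsilon> in at_right 0. 0 < (\<epsilon>::real)"
    by (rule eventually_at_right_less)
  have N_lim: "((\<lambda>\<epsilon>. expectation (\<lambda>\<omega>. \<bar>\<epsilon> powr \<beta> * N \<epsilon> \<omega> - \<kappa>\<bar>)) \<longlongrightarrow> 0) (at_right 0)"
  proof (rule Lim_null_comparison)
    have "((\<lambda>\<epsilon>. \<epsilon> powr (\<beta> / 2)) \<longlongrightarrow> 0 powr (\<beta> / 2)) (at_right 0)"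
      using beta by (intro tendsto_powr2 tendsto_ident_at tendsto_const)
        (auto simp: eventually_at_filter)
    then have "((\<lambda>\<epsilon>. 2 * sqrt (\<Lambda> * \<Psi> * t) * \<epsilon> powr (\<beta> / 2)) \<longlongrightarrow> 0) (at_right 0)"
      by (intro tendsto_mult_right_zero) simp
    from tendsto_add[OF this A_lim]
    show "((\<lambda>\<epsilon>. 2 * sqrt (\<Lambda> * \<Psi> * t) * \<epsilon> powr (\<beta> / 2) + expectation (\<lambda>\<omega>. \<bar>A \<epsilon> \<omega>\<bar>)) \<longlongrightarrow> 0) (at_right 0)"
      by simp
    show "\<forall>\<^sub>F \<epsilon> in at_right 0. norm (expectation (\<lambda>\<omega>. \<bar>\<epsilon> powr \<beta> * N \<epsilon> \<omega> - \<kappa>\<bar>))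
        \<le> 2 * sqrt (\<Lambda> * \<Psi> * t) * \<epsilon> powr (\<beta> / 2) + expectation (\<lambda>\<omega>. \<bar>A \<epsilon> \<omega>\<bar>)"
      using pos by eventually_elim (use one in simp)
  qed
  have Q_le: "integrable M (Q \<epsilon>)
      \<and> expectation (\<lambda>\<omega>. \<bar>\<epsilon> powr \<beta> * Q \<epsilon> \<omega> - \<kappa>\<bar>) \<le> expectation (\<lambda>\<omega>. \<bar>\<epsilon> powr \<beta> * N \<epsilon> \<omega> - \<kappa>\<bar>)"
    if \<epsilon>: "0 < \<epsilon>" for \<epsilon>
  proof -
    have int_N: "integrable M (N \<epsilon>)" using one[OF \<epsilon>] by simp
    then have int_Q: "integrable M (Q \<epsilon>)"
      unfolding Q_def quenched_mean_def by (rule F.real_cond_exp_int(1))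
    have int: "integrable M (\<lambda>\<omega>. \<epsilon> powr \<beta> * N \<epsilon> \<omega>)" "integrable M (\<lambda>\<omega>. \<kappa>)"
      using int_N by auto
    \<comment> \<open>Constants pass through conditional expectation, so the contraction can be
      applied to the centred and scaled count as a whole.\<close>
    have "AE \<omega> in M. \<epsilon> powr \<beta> * Q \<epsilon> \<omega> - \<kappa>
        = real_cond_exp M (sigma_Z M Z) (\<lambda>\<omega>. \<epsilon> powr \<beta> * N \<epsilon> \<omega> - \<kappa>) \<omega>"
      using F.real_cond_exp_diff[OF int] F.real_cond_exp_cmult[OF int_N, of "\<epsilon> powr \<beta>"]
        F.real_cond_exp_F_meas[OF int(2) borel_measurable_const]
      by eventually_elim (simp add: Q_def quenched_mean_def)
    then have "expectation (\<lambda>\<omega>. \<bar>\<epsilon> powr \<beta> * Q \<epsilon> \<omega> - \<kappa>\<bar>)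
        = expectation (\<lambda>\<omega>. \<bar>real_cond_exp M (sigma_Z M Z) (\<lambda>\<omega>. \<epsilon> powr \<beta> * N \<epsilon> \<omega> - \<kappa>) \<omega>\<bar>)"
      using borel_measurable_integrable[OF int_Q] by (intro integral_cong_AE) auto
    then show ?thesis
      using F.integral_abs_real_cond_exp_le[of "\<lambda>\<omega>. \<epsilon> powr \<beta> * N \<epsilon> \<omega> - \<kappa>"] int int_Q by simp
  qed
  have Q_lim: "((\<lambda>\<epsilon>. expectation (\<lambda>\<omega>. \<bar>\<epsilon> powr \<beta> * Q \<epsilon> \<omega> - \<kappa>\<bar>)) \<longlongrightarrow> 0) (at_right 0)"
    using N_lim by (rule Lim_null_comparison[rotated]) (use pos in eventually_elim, use Q_le in simp)
  have N_int: "\<forall>\<^sub>F \<epsilon> in at_right 0. integrable M (\<lambda>\<omega>. \<epsilon> powr \<beta> * N \<epsilon> \<omega>)"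
    using pos by eventually_elim (use one in simp)
  have Q_int: "\<forall>\<^sub>F \<epsilon> in at_right 0. integrable M (\<lambda>\<omega>. \<epsilon> powr \<beta> * Q \<epsilon> \<omega>)"
    using pos by eventually_elim (use Q_le in simp)
  have N_prob: "tendsto_in_prob M (\<lambda>\<epsilon> \<omega>. \<epsilon> powr \<beta> * N \<epsilon> \<omega>) \<kappa> (at_right 0)"
    by (rule tendsto_in_prob_L1[OF N_int N_lim])
  have Q_prob: "tendsto_in_prob M (\<lambda>\<epsilon> \<omega>. \<epsilon> powr \<beta> * Q \<epsilon> \<omega>) \<kappa> (at_right 0)"
    by (rule tendsto_in_prob_L1[OF Q_int Q_lim])
  have "tendsto_in_prob M (\<lambda>\<epsilon> \<omega>. (\<epsilon> powr \<beta> * N \<epsilon> \<omega>) / (\<epsilon> powr \<beta> * Q \<epsilon> \<omega>)) 1 (at_right 0)"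
  proof (rule tendsto_in_prob_divide[OF N_prob Q_prob \<kappa>])
    show "\<forall>\<^sub>F \<epsilon> in at_right 0. (\<lambda>\<omega>. \<epsilon> powr \<beta> * N \<epsilon> \<omega>) \<in> borel_measurable M
        \<and> (\<lambda>\<omega>. \<epsilon> powr \<beta> * Q \<epsilon> \<omega>) \<in> borel_measurable M"
      using N_int Q_int by eventually_elim (intro conjI borel_measurable_integrable)
  qed
  then have "tendsto_in_prob M (\<lambda>\<epsilon> \<omega>. N \<epsilon> \<omega> / Q \<epsilon> \<omega>) 1 (at_right 0)"
  proof (rule tendsto_in_prob_cong)
    show "\<forall>\<^sub>F \<epsilon> in at_right 0. \<forall>\<omega>. (\<epsilon> powr \<beta> * N \<epsilon> \<omega>) / (\<epsilon> powr \<beta> * Q \<epsilon> \<omega>) = N \<epsilon> \<omega> / Q \<epsilon> \<omega>"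
      using pos by eventually_elim simp
  qed
  moreover have "tendsto_in_prob M (\<lambda>\<epsilon> \<omega>. (\<epsilon> powr \<beta> * N \<epsilon> \<omega>) / \<kappa>) 1 (at_right 0)"
  proof (rule tendsto_in_prob_divide[OF N_prob _ \<kappa>])
    \<comment> \<open>The second limit is the ratio lemma with a constant denominator, whose
      deviation from \<kappa> is \<open>0\<close>.\<close>
    show "tendsto_in_prob M (\<lambda>\<epsilon> \<omega>. \<kappa>) \<kappa> (at_right (0::real))"
      by (simp add: tendsto_in_prob_def not_le)
    show "\<forall>\<^sub>F \<epsilon> in at_right 0. (\<lambda>\<omega>. \<epsilon> powr \<beta> * N \<epsilon> \<omega>) \<in> borel_measurable M
        \<and> (\<lambda>\<omega>. \<kappa>) \<in> borel_measurable M"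
      using N_int by eventually_elim (intro conjI borel_measurable_integrable borel_measurable_const)
  qed
  ultimately show ?thesis
    by (simp only: N_def Q_def \<kappa>_def)
qed

end
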